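(* Fix the combinatorial structure of a quantum graph as in the context (vertices, $K\ge1$ infinite leads, $M$ finite edges). For any compact $\mathcal L\subset(0,\infty)$, compact $I\subset(0,\infty)$, $R>0$ and $\gamma<1$ there exists $\epsilon_0>0$ such that the following holds for every choice of finite-edge lengths $\ell_m\in\mathcal L$, $K+1\le m\le K+M$: if there exist $u\in\mathcal H_R\cap\mathcal D(P)$ and $\lambda_0\in I$ with $\|u\|_{L^2}=1$ and $\|(P-\lambda_0^2)u\|=\epsilon<\epsilon_0$, then \[ \operatorname{Res}(P)\cap D(\lambda_0,\epsilon^\gamma)\neq\emptyset, \] where $D(\lambda_0,r)=\{\lambda\in\mathbb C:|\lambda-\lambda_0|<r\}$.
   Context: The graph has vertices $v_1,\dots,v_J$, $K\ge1$ infinite leads $e_1,\dots,e_K$, each identified with $[0,\infty)$ with its unique vertex at $x=0$, and $M$ finite edges $e_{K+1},\dots,e_{K+M}$, $e_m$ identified with $[0,\ell_m]$ and having two distinct vertices as endpoints. $L^2=\bigoplus_{m=1}^{K+M}L^2([0,\ell_m])$ ($\ell_k=\infty$ for leads). $P$ acts by $(Pu)_m=-u_m''$ with domain $\mathcal D(P)$: $u_m\in H^2([0,\ell_m])$, $u$ continuous at each vertex ($u_m(v)=u_\ell(v)$ for common vertices), and $\sum_{e_m\ni v}\partial_\nu u_m(v)=0$ at every vertex, with $\partial_\nu u_m(0)=-u_m'(0)$, $\partial_\nu u_m(\ell_m)=u_m'(\ell_m)$. $\operatorname{Res}(P)$ is the set of poles of the meromorphic continuation of $\lambda\mapsto(P-\lambda^2)^{-1}$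 from $\operatorname{Im}\lambda>0$ to $\mathbb C$ as an operator $L^2_{\mathrm{comp}}\to L^2_{\mathrm{loc}}$. $\mathcal H_R:=\bigoplus_{m=1}^K L^2([0,R])\oplus\bigoplus_{m=K+1}^{K+M}L^2([0,\ell_m])$, viewed as the subspace of $L^2$ of functions vanishing on the leads for $x>R$.
   Formalization: The formal statement requires ε > 0; for ε = 0 (an exact compactly supported eigenfunction, which can exist) the disc D(λ0, ε^γ) with 0 < γ < 1 is empty and the claim as written would fail. *)

theory Defs
  imports "HOL-Analysis.Analysis" "HOL-Complex_Analysis.Complex_Analysis"
begin

text \<open>Combinatorial structure.  Edges are indexed by m < K + M (0-based):
  m < K are the infinite leads, K \<le> m < K + M are the finite edges.
  Vertices are 0, ..., J-1.  lv m is the vertex of lead m (at x = 0);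
  iv m, tv m are the vertices of finite edge m at x = 0 and x = l m.\<close>

definition qgraph :: "nat \<Rightarrow> nat \<Rightarrow> nat \<Rightarrow> (nat \<Rightarrow> nat) \<Rightarrow> (nat \<Rightarrow> nat) \<Rightarrow> (nat \<Rightarrow> nat) \<Rightarrow> bool" where
  "qgraph J K M lv iv tv \<longleftrightarrow>
     (\<forall>m<K. lv m < J) \<and>
     (\<forall>m. K \<le> m \<and> m < K + M \<longrightarrow> iv m < J \<and> tv m < J \<and> iv m \<noteq> tv m)"

definition edom :: "nat \<Rightarrow> (nat \<Rightarrow> real) \<Rightarrow> nat \<Rightarrow> real set" where
  "edom K l m = (if m < K then {0..} else {0..l m})"

definition L2_on :: "real set \<Rightarrow> (real \<Rightarrow> complex) \<Rightarrow> bool" where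
  "L2_on S w \<longleftrightarrow> (\<lambda>x. indicator S x *\<^sub>R w x) \<in> borel_measurable lborel \<and>
                  integrable lborel (\<lambda>x. indicator S x * (cmod (w x))\<^sup>2)"

definition gnorm2 :: "nat \<Rightarrow> nat \<Rightarrow> (nat \<Rightarrow> real) \<Rightarrow> (nat \<Rightarrow> real \<Rightarrow> complex) \<Rightarrow> real" where
  "gnorm2 K M l u = (\<Sum>m<K+M. LINT x:edom K l m|lborel. (cmod (u m x))\<^sup>2)"

definition gpair :: "nat \<Rightarrow> nat \<Rightarrow> (nat \<Rightarrow> real) \<Rightarrow> (nat \<Rightarrow> real \<Rightarrow> complex)
    \<Rightarrow> (nat \<Rightarrow> real \<Rightarrow> complex) \<Rightarrow> complex" where
  "gpair K M l u g = (\<Sum>m<K+M. LINT x:edom K l m|lborel. u m x * cnj (g m x))"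

text \<open>opP ... u f: u \<in> D(P) and P u = f.  Here du is the first derivative;
  u_m \<in> H^2 is expressed by: u_m, u_m', u_m'' square integrable, u_m is C^1 with
  derivative du_m, and du_m is absolutely continuous with derivative u_m'' = - f_m, i.e.
  du_m(x) = du_m(0) - \<integral>_0^x f_m.  Vertex conditions: continuity and Kirchhoff
  (sum of outgoing normal derivatives vanishes).\<close>
definition opP :: "nat \<Rightarrow> nat \<Rightarrow> nat \<Rightarrow> (nat \<Rightarrow> nat) \<Rightarrow> (nat \<Rightarrow> nat) \<Rightarrow> (nat \<Rightarrow> nat)
    \<Rightarrow> (nat \<Rightarrow> real) \<Rightarrow> (nat \<Rightarrow> real \<Rightarrow> complex) \<Rightarrow> (nat \<Rightarrow> real \<Rightarrow> complex) \<Rightarrow> bool" where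
  "opP J K M lv iv tv l u f \<longleftrightarrow>
    (\<exists>du :: nat \<Rightarrow> real \<Rightarrow> complex.
      (\<forall>m<K+M.
         L2_on (edom K l m) (u m) \<and> L2_on (edom K l m) (du m) \<and> L2_on (edom K l m) (f m) \<and>
         (\<forall>x\<in>edom K l m. (u m has_vector_derivative du m x) (at x within edom K l m)) \<and>
         (\<forall>x\<in>edom K l m. du m x = du m 0 - (LINT t:{0..x}|lborel. f m t))) \<and>
      (\<forall>v<J.
         (let E = {(m, 0) | m. m < K \<and> lv m = v} \<union>
                  {(m, 0) | m. K \<le> m \<and> m < K + M \<and> iv m = v} \<union>
                  {(m, l m) | m. K \<le> m \<and> m < K + M \<and> tv m = v}
          in \<forall>(m, x)\<in>E. \<forall>(m', x')\<in>E. u m x = u m' x') \<and>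
         (\<Sum>m\<in>{m. m < K \<and> lv m = v}. - du m 0) +
         (\<Sum>m\<in>{m. K \<le> m \<and> m < K + M \<and> iv m = v}. - du m 0) +
         (\<Sum>m\<in>{m. K \<le> m \<and> m < K + M \<and> tv m = v}. du m (l m)) = 0))"

definition L2comp :: "nat \<Rightarrow> nat \<Rightarrow> (nat \<Rightarrow> real) \<Rightarrow> (nat \<Rightarrow> real \<Rightarrow> complex) \<Rightarrow> bool" where
  "L2comp K M l f \<longleftrightarrow> (\<forall>m<K+M. L2_on (edom K l m) (f m)) \<and>
     (\<exists>R. \<forall>m<K. AE x in lborel. x > R \<longrightarrow> f m x = 0)"

text \<open>Matrix element \<langle>(P - \<lambda>^2)^{-1} f, g\<rangle> (meaningful for Im \<lambda> > 0).\<close>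
definition res_elem :: "nat \<Rightarrow> nat \<Rightarrow> nat \<Rightarrow> (nat \<Rightarrow> nat) \<Rightarrow> (nat \<Rightarrow> nat) \<Rightarrow> (nat \<Rightarrow> nat)
    \<Rightarrow> (nat \<Rightarrow> real) \<Rightarrow> complex \<Rightarrow> (nat \<Rightarrow> real \<Rightarrow> complex) \<Rightarrow> (nat \<Rightarrow> real \<Rightarrow> complex) \<Rightarrow> complex" where
  "res_elem J K M lv iv tv l k f g =
     (THE w. \<exists>u h. opP J K M lv iv tv l u h \<and>
        (\<forall>m<K+M. AE x in lborel. x \<in> edom K l m \<longrightarrow> h m x - k\<^sup>2 * u m x = f m x) \<and>
        w = gpair K M l u g)"

text \<open>Resonances: poles of the meromorphic continuation of
  \<lambda> \<mapsto> (P - \<lambda>^2)^{-1} : L^2_comp \<rightarrow> L^2_loc from Im \<lambda> > 0, detected through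
  its matrix elements \<langle>R(\<lambda>) f, g\<rangle> with f, g \<in> L^2_comp.\<close>
definition Res :: "nat \<Rightarrow> nat \<Rightarrow> nat \<Rightarrow> (nat \<Rightarrow> nat) \<Rightarrow> (nat \<Rightarrow> nat) \<Rightarrow> (nat \<Rightarrow> nat)
    \<Rightarrow> (nat \<Rightarrow> real) \<Rightarrow> complex set" where
  "Res J K M lv iv tv l = {z. \<exists>f g G. L2comp K M l f \<and> L2comp K M l g \<and>
       G meromorphic_on UNIV \<and>
       (\<forall>k. Im k > 0 \<longrightarrow> G k = res_elem J K M lv iv tv l k f g) \<and>
       is_pole G z}"

end

theory Submission
  imports Defs "HOL-Real_Asymp.Real_Asymp" "Jordan_Normal_Form.Determinant"
begin

text \<open>
  On each edge a solution of \<open>(P - k\<^sup>2) w = f\<close> is given by variation of constants, and the free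
  amplitudes solve a finite linear system that is entire in \<open>k\<close>.  Cramer's rule writes a matrix
  element \<open>\<langle>R(k) f, g\<rangle>\<close> as a quotient of entire functions; the denominator is bounded on discs and,
  at \<open>k = i\<close>, bounded away from \<open>0\<close>, uniformly in the edge lengths.  Hence, if no pole lies in
  \<open>D(k0, \<epsilon>\<^sup>\<gamma>)\<close>, the matrix elements are bounded by a power of \<open>1 / \<epsilon>\<close> on half that disc, while
  self-adjointness gives the bound \<open>\<parallel>f\<parallel> \<parallel>g\<parallel> / |Im k\<^sup>2|\<close> for \<open>Im k > 0\<close>.  The maximum principle of
  Tang and Zworski interpolates between the two and yields, for \<open>f = (P - k0\<^sup>2) u\<close> and \<open>g = u\<close>, a
  value of modulus less than \<open>1\<close> at \<open>k0\<close>.  But \<open>u = R(k) f + (k0\<^sup>2 - k\<^sup>2) R(k) u\<close> for \<open>Im k > 0\<close>,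
  and letting \<open>k\<close> tend to \<open>k0\<close> shows that this value is \<open>\<parallel>u\<parallel>\<^sup>2 = 1\<close>.
\<close>

section \<open>Holomorphic functions\<close>

text \<open>The growth bound may be a bad power of \<open>1 / \<epsilon>\<close>, because the
  interpolation sees only its logarithm \<open>A\<close>. What remains to be checked is that
  \<open>A * \<epsilon>\<close> is small against the radius \<open>\<epsilon> powr \<gamma>\<close>;
  with \<open>A\<close> of order \<open>ln (1 / \<epsilon>)\<close> this is where
  \<open>\<gamma> < 1\<close> enters. The power itself comes from the zeros of the denominator.
  Their number in a large disc is controlled by an upper bound on the disc and a lower bound at a
  single point. The point \<open>\<i>\<close> serves every choice of lengths: the determinant has no
  zero in the upper half-plane, where a square-integrable solution of the homogeneous equation must
  vanish. Uniformity in the lengths is thus reduced to a few constants. The matrix of the system has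
  fixed size and depends continuously on \<open>k\<close> and the lengths, which range over a
  compact set, and the data are estimated through the length and norm bounds. Since
  \<open>Res\<close> is defined by scalar matrix elements, a pole-free disc may be used for each
  pair of functions separately; the pairs \<open>(f, u)\<close> and \<open>(u, u)\<close> are
  enough.\<close>

lemma prod_list_norm_ge:
  fixes zs :: "complex list"
  assumes "\<And>w. w \<in> set zs \<Longrightarrow> d \<le> cmod (z - w)" "0 \<le> d"
  shows "d ^ length zs \<le> cmod (\<Prod>w\<leftarrow>zs. z - w)"
  using assms by (induction zs) (auto simp: norm_mult intro!: mult_mono)

lemma prod_list_norm_le:
  fixes zs :: "complex list"
  assumes "\<And>w. w \<in> set zs \<Longrightarrow> cmod (z - w) \<le> d" "0 \<le> d"
  shows "cmod (\<Prod>w\<leftarrow>zs. z - w) \<le> d ^ length zs"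
  using assms by (induction zs) (auto simp: norm_mult intro!: mult_mono)

text \<open>Seen from the circle of radius \<open>3 * \<rho>\<close> every listed zero is at
  distance at least \<open>2 * \<rho>\<close>, seen from the centre at distance less than
  \<open>\<rho>\<close>. Each zero therefore costs a factor 2 in \<open>C / c\<close>; the third
  claim is a Jensen-type count of zeros based on the maximum principle alone.\<close>

lemma factored_holomorphic_bounds:
  fixes D E :: "complex \<Rightarrow> complex"
  assumes E: "E holomorphic_on ball \<kappa> (4 * \<rho>)" and \<rho>: "\<rho> > 0"
    and bd: "\<And>z. z \<in> ball \<kappa> (4 * \<rho>) \<Longrightarrow> cmod (D z) \<le> C"
    and low: "c \<le> cmod (D \<kappa>)" and c: "c > 0"
    and zs: "set zs \<subseteq> ball \<kappa> \<rho>"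
    and eq: "\<And>z. z \<in> ball \<kappa> (4 * \<rho>) \<Longrightarrow> D z = (\<Prod>w\<leftarrow>zs. z - w) * E z"
  shows "c / \<rho> ^ length zs \<le> cmod (E \<kappa>)"
    and "z \<in> cball \<kappa> (3 * \<rho>) \<Longrightarrow> cmod (E z) \<le> C / (2 * \<rho>) ^ length zs"
    and "2 ^ length zs \<le> C / c"
proof -
  define n where "n = length zs"
  have Dk1: "D \<kappa> = (\<Prod>w\<leftarrow>zs. \<kappa> - w) * E \<kappa>"
    using eq[of \<kappa>] \<rho> by auto
  have "cmod (\<Prod>w\<leftarrow>zs. \<kappa> - w) \<le> \<rho> ^ n"
    unfolding n_def using zs \<rho> by (intro prod_list_norm_le) (auto simp: dist_norm)
  then have "c \<le> \<rho> ^ n * cmod (E \<kappa>)"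
    using low unfolding Dk1 norm_mult
    by (meson mult_right_mono norm_ge_zero order_trans)
  then show E1: "c / \<rho> ^ length zs \<le> cmod (E \<kappa>)"
    using \<rho> by (simp add: n_def field_simps)
  have E2: "cmod (E z) \<le> C / (2 * \<rho>) ^ length zs" if z: "z \<in> cball \<kappa> (3 * \<rho>)" for z
  proof (rule maximum_modulus_frontier[where S = "cball \<kappa> (3 * \<rho>)" and f = E])
    show "E holomorphic_on interior (cball \<kappa> (3 * \<rho>))"
      using \<rho> by (intro holomorphic_on_subset[OF E]) auto
    show "continuous_on (closure (cball \<kappa> (3 * \<rho>))) E"
      using \<rho> by (intro holomorphic_on_imp_continuous_on holomorphic_on_subset[OF E]) auto
    fix y assume "y \<in> frontier (cball \<kappa> (3 * \<rho>))"
    then have y: "dist \<kappa> y = 3 * \<rho>" using \<rho> by (simp add: sphere_def)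
    have ge: "(2 * \<rho>) ^ n \<le> cmod (\<Prod>w\<leftarrow>zs. y - w)"
      unfolding n_def
    proof (rule prod_list_norm_ge)
      fix w assume "w \<in> set zs"
      then have "dist \<kappa> w < \<rho>" using zs by auto
      then show "2 * \<rho> \<le> cmod (y - w)"
        using y dist_triangle[of \<kappa> y w] by (simp add: dist_norm norm_minus_commute)
    qed (use \<rho> in auto)
    have "(2 * \<rho>) ^ n * cmod (E y) \<le> cmod (D y)"
      using eq[of y] y \<rho> ge by (simp add: norm_mult mult_right_mono)
    also have "\<dots> \<le> C" using bd[of y] y \<rho> by simp
    finally show "cmod (E y) \<le> C / (2 * \<rho>) ^ length zs"
      using \<rho> by (simp add: n_def field_simps)
  qed (use z in auto)
  then show "z \<in> cball \<kappa> (3 * \<rho>) \<Longrightarrow> cmod (E z) \<le> C / (2 * \<rho>) ^ length zs" .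
  have "c / \<rho> ^ length zs \<le> C / (2 * \<rho>) ^ length zs"
    using E1 E2[of \<kappa>] \<rho> by auto
  then have "c \<le> C / 2 ^ length zs"
    using \<rho> by (simp add: power_mult_distrib field_simps)
  then show "2 ^ length zs \<le> C / c"
    using c by (simp add: field_simps)
qed

text \<open>The zero count bounds the length of every list that can be divided out of
  \<open>D\<close>, so a longest list exists; a zero of the remaining factor would produce a longer
  one. Zeros are thereby listed with multiplicity.\<close>

lemma zero_factorization:
  fixes D :: "complex \<Rightarrow> complex"
  assumes D: "D holomorphic_on ball \<kappa> (4 * \<rho>)" and \<rho>: "\<rho> > 0"
    and bd: "\<And>z. z \<in> ball \<kappa> (4 * \<rho>) \<Longrightarrow> cmod (D z) \<le> C"
    and low: "c \<le> cmod (D \<kappa>)" and c: "c > 0"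
  obtains zs E where "E holomorphic_on ball \<kappa> (4 * \<rho>)" "set zs \<subseteq> ball \<kappa> \<rho>"
    "\<And>z. z \<in> ball \<kappa> (4 * \<rho>) \<Longrightarrow> D z = (\<Prod>w\<leftarrow>zs. z - w) * E z"
    "\<And>z. z \<in> ball \<kappa> \<rho> \<Longrightarrow> E z \<noteq> 0"
proof -
  let ?U = "ball \<kappa> (4 * \<rho>)"
  define P where "P zs \<longleftrightarrow> set zs \<subseteq> ball \<kappa> \<rho> \<and>
     (\<exists>E. E holomorphic_on ?U \<and> (\<forall>z\<in>?U. D z = (\<Prod>w\<leftarrow>zs. z - w) * E z))" for zs
  have len: "length zs < Suc (nat \<lceil>C / c\<rceil>)" if "P zs" for zs
  proof -
    from that obtain E where "set zs \<subseteq> ball \<kappa> \<rho>" "E holomorphic_on ?U"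
      "\<forall>z\<in>?U. D z = (\<Prod>w\<leftarrow>zs. z - w) * E z" unfolding P_def by blast
    then have "2 ^ length zs \<le> C / c"
      by (intro factored_holomorphic_bounds(3)[where D = D and E = E and \<kappa> = \<kappa> and \<rho> = \<rho>])
         (use \<rho> bd low c in auto)
    moreover have "real (length zs) < 2 ^ length zs" by (rule of_nat_less_two_power)
    ultimately have "real (length zs) \<le> real_of_int \<lceil>C / c\<rceil>"
      by linarith
    then show ?thesis by linarith
  qed
  have "P []" unfolding P_def using D by auto
  then obtain zs where zs: "P zs" and mx: "\<And>ys. P ys \<Longrightarrow> length ys \<le> length zs"
    using ex_has_greatest_nat[of P "[]" length "Suc (nat \<lceil>C / c\<rceil>)"] len by (meson less_imp_le)
  then obtain E where E: "set zs \<subseteq> ball \<kappa> \<rho>" "E holomorphic_on ?U"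
      "\<And>z. z \<in> ?U \<Longrightarrow> D z = (\<Prod>w\<leftarrow>zs. z - w) * E z" unfolding P_def by blast
  have nz: "E w \<noteq> 0" if w: "w \<in> ball \<kappa> \<rho>" for w
  proof
    assume Ew: "E w = 0"
    \<comment> \<open>The difference quotient of \<open>E\<close> at its zero, with the removable
      singularity filled in, is the new cofactor.\<close>
    define E' where "E' = (\<lambda>z. if z = w then deriv E w else (E z - E w) / (z - w))"
    have "w \<in> ?U" using w \<rho> by auto
    then have "E' holomorphic_on ?U"
      unfolding E'_def by (intro pole_lemma_open E) auto
    moreover have "D z = (\<Prod>w\<leftarrow>w # zs. z - w) * E' z" if "z \<in> ?U" for z
      using E(3)[OF that] Ew by (auto simp: E'_def)
    ultimately have "P (w # zs)" using E(1) w unfolding P_def by auto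
    from mx[OF this] show False by simp
  qed
  from that[OF E(2) E(1) E(3) nz] show ?thesis .
qed

text \<open>Borel--Caratheodory: apply the Schwarz lemma to \<open>h / (2 A - h)\<close>, where \<open>h\<close> is
  a logarithm of \<open>E / E \<kappa>\<close> and \<open>A\<close> bounds its real part.\<close>

lemma nonvanishing_lower_bound:
  fixes E :: "complex \<Rightarrow> complex"
  assumes E: "E holomorphic_on ball \<kappa> \<rho>" and \<rho>: "\<rho> > 0"
    and nz: "\<And>z. z \<in> ball \<kappa> \<rho> \<Longrightarrow> E z \<noteq> 0"
    and bd: "\<And>z. z \<in> ball \<kappa> \<rho> \<Longrightarrow> cmod (E z) \<le> C"
    and low: "c \<le> cmod (E \<kappa>)" and c: "c > 0"
    and z: "z \<in> cball \<kappa> (\<rho> / 2)"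
  shows "c * exp (- 2 * (ln (C / c) + 1)) \<le> cmod (E z)"
proof -
  have \<kappa>: "\<kappa> \<in> ball \<kappa> \<rho>" using \<rho> by simp
  have Cc: "c \<le> C" using low bd[OF \<kappa>] by linarith
  \<comment> \<open>The summand 1 keeps \<open>A\<close> positive when \<open>C = c\<close> and
    makes the bound on \<open>Re (h w)\<close> strict.\<close>
  define A where "A = ln (C / c) + 1"
  have A: "A \<ge> 1" unfolding A_def using Cc c by simp
  obtain g where g: "g holomorphic_on ball \<kappa> \<rho>" "\<And>z. z \<in> ball \<kappa> \<rho> \<Longrightarrow> E z = exp (g z)"
    using contractible_imp_holomorphic_log[OF E _ nz] convex_imp_contractible[OF convex_ball] by metis
  define h where "h z = g (\<kappa> + of_real \<rho> * z) - g \<kappa>" for z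
  have sub: "\<kappa> + of_real \<rho> * w \<in> ball \<kappa> \<rho>" if "cmod w < 1" for w
    using that \<rho> by (simp add: dist_norm norm_mult)
  have h: "h holomorphic_on ball 0 1" unfolding h_def
    by (intro holomorphic_intros holomorphic_on_compose_gen[OF _ g(1), unfolded o_def])
       (use sub in auto)
  have Eh: "E (\<kappa> + of_real \<rho> * w) = E \<kappa> * exp (h w)" if "cmod w < 1" for w
    using g(2)[OF sub[OF that]] g(2)[OF \<kappa>] by (simp add: h_def exp_diff)
  have Reh: "Re (h w) < A" if "cmod w < 1" for w
  proof -
    have "c * exp (Re (h w)) \<le> cmod (E \<kappa>) * exp (Re (h w))" using low by simp
    also have "\<dots> = cmod (E (\<kappa> + of_real \<rho> * w))"
      by (simp add: Eh[OF that] norm_mult)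
    also have "\<dots> \<le> C" by (rule bd[OF sub[OF that]])
    finally have "exp (Re (h w)) \<le> C / c" using c by (simp add: field_simps)
    then have "Re (h w) \<le> ln (C / c)" using Cc c by (simp add: ln_ge_iff)
    then show ?thesis unfolding A_def by simp
  qed
  define \<phi> where "\<phi> w = h w / (2 * of_real A - h w)" for w
  have den: "2 * of_real A - h w \<noteq> 0" if "cmod w < 1" for w
  proof
    assume "2 * of_real A - h w = 0"
    then have "Re (2 * of_real A - h w) = 0" by simp
    then show False using Reh[OF that] A by simp
  qed
  have lt: "cmod (\<phi> w) < 1" if w: "cmod w < 1" for w
  proof -
    \<comment> \<open>The half-plane \<open>Re < A\<close> consists of the points closer to 0 than
      to \<open>2 * A\<close>.\<close>
    have "(cmod (h w))\<^sup>2 < (cmod (2 * of_real A - h w))\<^sup>2"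
    proof -
      have "0 < 4 * (A * (A - Re (h w)))" using Reh[OF w] A by simp
      then show ?thesis unfolding cmod_power2 by (simp add: power2_eq_square algebra_simps)
    qed
    then have "cmod (h w) < cmod (2 * of_real A - h w)"
      by (rule power_less_imp_less_base) auto
    then show ?thesis unfolding \<phi>_def norm_divide using den[OF w] by simp
  qed
  define w where "w = (z - \<kappa>) / of_real \<rho>"
  have zw: "z = \<kappa> + of_real \<rho> * w" unfolding w_def using \<rho> by simp
  have w: "cmod w \<le> 1 / 2"
    using z \<rho> by (simp add: w_def norm_divide dist_norm norm_minus_commute field_simps)
  then have w1: "cmod w < 1" by simp
  have "\<phi> holomorphic_on ball 0 1" unfolding \<phi>_def
    by (intro holomorphic_intros h) (use den in auto)
  moreover have "\<phi> 0 = 0" by (simp add: \<phi>_def h_def)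
  ultimately have "cmod (\<phi> w) \<le> cmod w"
    using Schwarz_Lemma(1)[of \<phi> w] lt w1 by auto
  then have ph: "cmod (h w) \<le> (1 / 2) * cmod (2 * of_real A - h w)"
  proof -
    have "cmod (h w) \<le> cmod w * cmod (2 * of_real A - h w)"
      using \<open>cmod (\<phi> w) \<le> cmod w\<close> den[OF w1] by (simp add: \<phi>_def norm_divide field_simps)
    also have "\<dots> \<le> (1 / 2) * cmod (2 * of_real A - h w)" using w by (intro mult_right_mono) auto
    finally show ?thesis .
  qed
  \<comment> \<open>Inserted into \<open>ph\<close>, this leaves half of \<open>cmod (h w)\<close>
    on the right, which is absorbed on the left.\<close>
  have "cmod (2 * of_real A - h w) \<le> 2 * A + cmod (h w)"
    using norm_triangle_ineq4[of "2 * of_real A" "h w"] A by (simp add: norm_mult)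
  then have "cmod (h w) \<le> 2 * A" using ph by linarith
  then have "- (2 * A) \<le> Re (h w)" using abs_Re_le_cmod[of "h w"] by linarith
  then have "c * exp (- (2 * A)) \<le> cmod (E \<kappa>) * exp (Re (h w))"
    using low c by (intro mult_mono) auto
  also have "\<dots> = cmod (E z)" unfolding zw by (simp add: Eh[OF w1] norm_mult)
  finally show ?thesis unfolding A_def by simp
qed

text \<open>Pigeonhole: among \<open>N + 1\<close> radii with gaps \<open>2 * d\<close>, each point
  comes closer than \<open>d\<close> to at most one circle, so some circle is avoided by all
  points.\<close>

lemma circle_avoiding_points:
  fixes zs :: "complex list"
  assumes r: "r > 0" and len: "length zs \<le> N"
  obtains s where "r / 2 \<le> s" "s < r"
    "\<And>w z. w \<in> set zs \<Longrightarrow> dist k0 z = s \<Longrightarrow> r / (8 * (real N + 1)) \<le> cmod (z - w)"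
proof -
  \<comment> \<open>With this \<open>d\<close> the radii extend at most \<open>r / 4\<close> beyond
    \<open>r / 2\<close>, hence stay below \<open>r\<close>.\<close>
  define d where "d = r / (8 * (real N + 1))"
  have d: "d > 0" unfolding d_def using r by simp
  define s where "s i = r / 2 + 2 * d * real i" for i :: nat
  have "\<exists>i\<le>N. \<forall>w\<in>set zs. d \<le> \<bar>dist k0 w - s i\<bar>"
  proof (rule ccontr)
    assume "\<not> ?thesis"
    then have "\<forall>i\<in>{..N}. \<exists>w\<in>set zs. \<bar>dist k0 w - s i\<bar> < d" by force
    then obtain f where f: "\<And>i. i \<le> N \<Longrightarrow> f i \<in> set zs \<and> \<bar>dist k0 (f i) - s i\<bar> < d"
      by (metis atMost_iff)
    have "inj_on f {..N}"
    proof (rule inj_onI)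
      fix i j assume ij: "i \<in> {..N}" "j \<in> {..N}" "f i = f j"
      then have "\<bar>s i - s j\<bar> < 2 * d" using f[of i] f[of j] by auto
      then have "2 * d * \<bar>real i - real j\<bar> < 2 * d * 1"
        using d by (simp add: s_def abs_mult flip: right_diff_distrib)
      then have "\<bar>real i - real j\<bar> < 1" using d by simp
      then show "i = j" by linarith
    qed
    then have "card {..N} \<le> card (set zs)"
      using f by (intro card_inj_on_le[of f]) auto
    also have "\<dots> \<le> N" using len card_length[of zs] by linarith
    finally show False by simp
  qed
  then obtain i where i: "i \<le> N" "\<And>w. w \<in> set zs \<Longrightarrow> d \<le> \<bar>dist k0 w - s i\<bar>" by blast
  show ?thesis
  proof
    show "r / 2 \<le> s i" unfolding s_def using d by simp
    have "2 * d * real i \<le> 2 * d * (real N + 1)" using i d by (intro mult_left_mono) auto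
    also have "\<dots> = r / 4" unfolding d_def by (simp add: field_simps)
    finally show "s i < r" unfolding s_def using r by linarith
    fix w z assume "w \<in> set zs" "dist k0 z = s i"
    then have "d \<le> \<bar>dist k0 w - dist k0 z\<bar>" using i by auto
    also have "\<dots> \<le> dist z w"
      using dist_triangle[of k0 w z] dist_triangle[of k0 z w] by (simp add: dist_commute abs_le_iff)
    finally show "r / (8 * (real N + 1)) \<le> cmod (z - w)" by (simp add: d_def dist_norm)
  qed
qed

text \<open>Zeros of \<open>D\<close> in the ball do no harm, because \<open>F\<close> is assumed
  holomorphic there: on a circle avoiding them \<open>F\<close> is the quotient
  \<open>N / D\<close>, and the maximum principle carries the bound inwards. The exponent
  \<open>N0\<close> depends only on \<open>C / c\<close>, so the loss is a fixed power of
  \<open>1 / r\<close>.\<close>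

lemma meromorphic_quotient_bound:
  fixes D N F :: "complex \<Rightarrow> complex"
  assumes D: "D holomorphic_on ball \<kappa> (4 * \<rho>)" and \<rho>: "\<rho> \<ge> 1"
    and bd: "\<And>z. z \<in> ball \<kappa> (4 * \<rho>) \<Longrightarrow> cmod (D z) \<le> C"
    and low: "c \<le> cmod (D \<kappa>)" and c: "c > 0"
    and N0: "C / c < 2 ^ N0"
    and r: "0 < r" "r \<le> 1" and sub: "ball k0 r \<subseteq> cball \<kappa> (\<rho> / 2)"
    and F: "F holomorphic_on ball k0 r"
    and FD: "\<And>z. z \<in> ball k0 r \<Longrightarrow> D z \<noteq> 0 \<Longrightarrow> F z * D z = N z"
    and Nb: "\<And>z. z \<in> ball k0 r \<Longrightarrow> cmod (N z) \<le> B" and B: "B > 0"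
    and z: "z \<in> cball k0 (r / 2)"
  shows "cmod (F z) \<le> B * (8 * (real N0 + 1) / r) ^ N0 * (\<rho> ^ N0 / c) * exp (2 * (ln (C / c) + 1))"
proof -
  have \<rho>0: "\<rho> > 0" using \<rho> by simp
  obtain zs E where E: "E holomorphic_on ball \<kappa> (4 * \<rho>)" "set zs \<subseteq> ball \<kappa> \<rho>"
    "\<And>z. z \<in> ball \<kappa> (4 * \<rho>) \<Longrightarrow> D z = (\<Prod>w\<leftarrow>zs. z - w) * E z"
    "\<And>z. z \<in> ball \<kappa> \<rho> \<Longrightarrow> E z \<noteq> 0"
    by (rule zero_factorization[OF D \<rho>0 bd low c]) (assumption | rule that)+
  define n where "n = length zs"
  note fb = factored_holomorphic_bounds[OF E(1) \<rho>0 bd low c E(2) E(3)]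
  have Cc: "c \<le> C" using low bd[of \<kappa>] \<rho>0 by force
  have "(2::real) ^ n < 2 ^ N0" using fb(3) N0 unfolding n_def by linarith
  then have nN: "n \<le> N0" by simp
  have Elow: "c / \<rho> ^ N0 * exp (- 2 * (ln (C / c) + 1)) \<le> cmod (E y)" if y: "y \<in> cball \<kappa> (\<rho> / 2)" for y
  proof -
    \<comment> \<open>The upper bound \<open>C / (2 * \<rho>) ^ n\<close> is weakened to
      \<open>C / \<rho> ^ n\<close>, so that the quotient of the upper and lower bounds for
      \<open>E\<close> is \<open>C / c\<close> for every \<open>n\<close>.\<close>
    have "c / \<rho> ^ n * exp (- 2 * (ln ((C / \<rho> ^ n) / (c / \<rho> ^ n)) + 1)) \<le> cmod (E y)"
    proof (rule nonvanishing_lower_bound[where \<kappa> = \<kappa> and \<rho> = \<rho> and E = E])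
      show "E holomorphic_on ball \<kappa> \<rho>" by (rule holomorphic_on_subset[OF E(1)]) (use \<rho>0 in auto)
      fix x assume "x \<in> ball \<kappa> \<rho>"
      then have "cmod (E x) \<le> C / (2 * \<rho>) ^ n"
        unfolding n_def by (intro fb(2)) (use \<rho>0 in auto)
      also have "\<dots> \<le> C / \<rho> ^ n" using \<rho>0 Cc c
        by (intro divide_left_mono power_mono) auto
      finally show "cmod (E x) \<le> C / \<rho> ^ n" .
    qed (use E fb \<rho>0 c y in \<open>auto simp: n_def\<close>)
    moreover have "(C / \<rho> ^ n) / (c / \<rho> ^ n) = C / c" using \<rho>0 by simp
    moreover have "c / \<rho> ^ N0 * exp (- 2 * (ln (C / c) + 1)) \<le> c / \<rho> ^ n * exp (- 2 * (ln (C / c) + 1))"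
      using \<rho> c nN by (intro mult_right_mono divide_left_mono power_increasing) auto
    ultimately show ?thesis by (metis order_trans)
  qed
  obtain s where s: "r / 2 \<le> s" "s < r"
    "\<And>w z. w \<in> set zs \<Longrightarrow> dist k0 z = s \<Longrightarrow> r / (8 * (real N0 + 1)) \<le> cmod (z - w)"
    using circle_avoiding_points[OF r(1), of zs N0 k0] nN n_def by blast
  define d where "d = r / (8 * (real N0 + 1))"
  have d: "0 < d" "d \<le> 1" unfolding d_def using r by (auto simp: field_simps)
  define e0 where "e0 = c / \<rho> ^ N0 * exp (- 2 * (ln (C / c) + 1))"
  have e0: "e0 > 0" unfolding e0_def using \<rho>0 c by simp
  have "cmod (F z) \<le> B / (d ^ N0 * e0)"
  proof (rule maximum_modulus_frontier[where S = "cball k0 s" and f = F])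
    have sr: "cball k0 s \<subseteq> ball k0 r" using s by auto
    then have Fs: "F holomorphic_on cball k0 s" by (rule holomorphic_on_subset[OF F])
    then show "F holomorphic_on interior (cball k0 s)"
      by (rule holomorphic_on_subset) (rule interior_subset)
    show "continuous_on (closure (cball k0 s)) F"
      using holomorphic_on_imp_continuous_on[OF Fs] by simp
    fix y assume "y \<in> frontier (cball k0 s)"
    then have ys: "dist k0 y = s" using s r by simp
    then have yb: "y \<in> ball k0 r" using s by simp
    then have yc: "y \<in> cball \<kappa> (\<rho> / 2)" using sub by auto
    have y4: "y \<in> ball \<kappa> (4 * \<rho>)" using yc \<rho> by auto
    \<comment> \<open>Since \<open>d \<le> 1\<close>, passing to the exponent \<open>N0\<close>
      removes the dependence on the number of zeros.\<close>
    have "d ^ N0 \<le> d ^ n" using d nN by (intro power_decreasing) auto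
    also have "\<dots> \<le> cmod (\<Prod>w\<leftarrow>zs. y - w)"
      unfolding n_def by (rule prod_list_norm_ge) (use s(3) ys d in \<open>auto simp: d_def\<close>)
    finally have Dl: "d ^ N0 * e0 \<le> cmod (D y)"
      unfolding E(3)[OF y4] norm_mult e0_def
      by (intro mult_mono Elow[OF yc]) (use \<rho>0 c in auto)
    moreover have "0 < d ^ N0 * e0" using d e0 by simp
    ultimately have "D y \<noteq> 0" by force
    have "cmod (F y) * (d ^ N0 * e0) \<le> cmod (F y) * cmod (D y)" using Dl by (intro mult_left_mono) auto
    also have "\<dots> = cmod (N y)" using FD[OF yb \<open>D y \<noteq> 0\<close>] by (metis norm_mult)
    also have "\<dots> \<le> B" by (rule Nb[OF yb])
    finally show "cmod (F y) \<le> B / (d ^ N0 * e0)" using d e0 by (simp add: field_simps)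
  qed (use z s in auto)
  also have "\<dots> = B * (8 * (real N0 + 1) / r) ^ N0 * (\<rho> ^ N0 / c) * exp (2 * (ln (C / c) + 1))"
    unfolding d_def e0_def exp_minus mult_minus_left using r c \<rho>0 by (simp add: field_simps power_divide)
  finally show ?thesis .
qed

text \<open>The three-lines argument of Tang and Zworski: on the rectangle below, the factor
  \<open>exp (- i \<alpha> w - \<beta> w\<^sup>2)\<close> beats \<open>exp A\<close> on the bottom and on the lateral sides,
  while it costs only a constant on the top side, at height \<open>r / (16 A)\<close>.\<close>

lemma semiclassical_maximum_principle:
  fixes F :: "complex \<Rightarrow> complex"
  assumes r: "r > 0" and A: "A \<ge> 2" and k0: "Im k0 = 0"
    and F: "F holomorphic_on ball k0 r"
    and FA: "\<And>z. z \<in> cball k0 (r / 2) \<Longrightarrow> cmod (F z) \<le> exp A"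
    and Fq: "\<And>z. z \<in> ball k0 r \<Longrightarrow> Im z > 0 \<Longrightarrow> cmod (F z) * Im z \<le> q"
    and q: "16 * exp 2 * A * q < r"
  shows "cmod (F k0) < 1"
proof -
  define \<delta> where "\<delta> = r / (16 * A)"
  define \<alpha> where "\<alpha> = 16 * A / r"
  \<comment> \<open>The factor 42 meets two requirements: \<open>42 / 9 - 42 / 16 > 2\<close> gives
    a decay of about \<open>exp (- 2 * A)\<close> on the lateral sides, and
    \<open>42 / 16 < 3\<close> keeps the Gaussian's growth on the bottom below what
    \<open>exp (- 4 * A)\<close> from the linear factor leaves over after beating
    \<open>exp A\<close>.\<close>
  define \<beta> where "\<beta> = 42 * A / r\<^sup>2"
  have pos: "\<delta> > 0" "\<alpha> > 0" "\<beta> > 0" unfolding \<delta>_def \<alpha>_def \<beta>_def using r A by auto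
  have \<alpha>\<delta>: "\<alpha> * \<delta> = 1" unfolding \<alpha>_def \<delta>_def using r A by simp
  have \<alpha>r: "\<alpha> * r = 16 * A" and \<beta>r: "\<beta> * r\<^sup>2 = 42 * A" unfolding \<alpha>_def \<beta>_def using r by auto
  have \<delta>r: "\<delta> \<le> r / 32" unfolding \<delta>_def using A r by (simp add: field_simps)
  have \<beta>\<delta>: "\<beta> * \<delta>\<^sup>2 \<le> 1"
    unfolding \<beta>_def \<delta>_def using r A by (simp add: field_simps power2_eq_square)
  define S where "S = cbox (Complex (Re k0 - r / 3) (- r / 4)) (Complex (Re k0 + r / 3) \<delta>)"
  have inS: "z \<in> S \<longleftrightarrow> \<bar>Re z - Re k0\<bar> \<le> r / 3 \<and> - r / 4 \<le> Im z \<and> Im z \<le> \<delta>" for z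
    unfolding S_def in_cbox_complex_iff by (simp add: abs_le_iff; argo)
  have Ssub: "S \<subseteq> cball k0 (r / 2)"
  proof
    fix z assume z: "z \<in> S"
    have "\<bar>Re z - Re k0\<bar>\<^sup>2 \<le> (r / 3)\<^sup>2" using z inS r by (intro power_mono) auto
    moreover have "\<bar>Im z\<bar>\<^sup>2 \<le> (r / 4)\<^sup>2" using z inS[of z] r \<delta>r by (intro power_mono) (auto simp: abs_le_iff)
    ultimately have "(cmod (z - k0))\<^sup>2 \<le> (r / 3)\<^sup>2 + (r / 4)\<^sup>2"
      using k0 by (simp add: cmod_power2)
    also have "\<dots> \<le> (r / 2)\<^sup>2" by (simp add: power2_eq_square)
    finally have "cmod (z - k0) \<le> r / 2" using r by (simp add: power2_le_iff_abs_le)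
    then show "z \<in> cball k0 (r / 2)" by (simp add: dist_norm norm_minus_commute)
  qed
  then have Sball: "S \<subseteq> ball k0 r" using r by force
  define G where "G z = F z * exp (- \<i> * of_real \<alpha> * (z - k0) - of_real \<beta> * (z - k0)\<^sup>2)" for z
  have nG: "cmod (G z) = cmod (F z) * exp (\<alpha> * Im z - \<beta> * ((Re z - Re k0)\<^sup>2 - (Im z)\<^sup>2))" for z
    unfolding G_def norm_mult norm_exp_eq_Re using k0 by (simp add: power2_eq_square)
  have G: "G holomorphic_on ball k0 r"
    unfolding G_def by (intro holomorphic_intros F)
  \<comment> \<open>The entries bound \<open>G\<close> on the bottom, the lateral sides and the top.
    \<open>A \<ge> 2\<close> makes the first two less than 1, and the hypothesis \<open>q\<close>
    the third.\<close>
  define b where "b = max (max (exp (- 3 / 8 * A)) (exp (1 - A))) (16 * exp 2 * A * q / r)"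
  have "b < 1" unfolding b_def using A q r by simp
  have "cmod (G k0) \<le> b"
  proof (rule maximum_modulus_frontier[where S = S and f = G])
    show "G holomorphic_on interior S"
      using interior_subset[of S] Sball by (intro holomorphic_on_subset[OF G]) auto
    have "closed S" unfolding S_def by (rule closed_cbox)
    then show "continuous_on (closure S) G"
      using Sball by (auto intro: holomorphic_on_imp_continuous_on holomorphic_on_subset[OF G])
    show "bounded S" unfolding S_def by (rule bounded_cbox)
    show "k0 \<in> S" unfolding inS using r pos k0 by auto
    fix z assume zf: "z \<in> frontier S"
    then have zS: "z \<in> S" using \<open>closed S\<close> by (metis closure_closed frontier_def DiffD1)
    note z = zS[unfolded inS]
    have "z \<notin> box (Complex (Re k0 - r / 3) (- r / 4)) (Complex (Re k0 + r / 3) \<delta>)"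
      using zf unfolding frontier_def S_def interior_cbox by auto
    then have cases: "\<bar>Re z - Re k0\<bar> = r / 3 \<or> Im z = - r / 4 \<or> Im z = \<delta>"
      using z unfolding in_box_complex_iff by (auto simp: abs_if split: if_splits)
    have sq9: "(r / 3)\<^sup>2 = r\<^sup>2 / 9" by (simp add: power_divide)
    have FzA: "cmod (F z) \<le> exp A" using FA Ssub zS by auto
    have Im2: "(Im z)\<^sup>2 \<le> r\<^sup>2 / 16"
    proof -
      have "\<bar>Im z\<bar>\<^sup>2 \<le> (r / 4)\<^sup>2" using z r \<delta>r by (intro power_mono) (auto simp: abs_le_iff)
      then show ?thesis by (simp add: power_divide)
    qed
    then have \<beta>Im: "\<beta> * (Im z)\<^sup>2 \<le> 42 * A / 16"
      using mult_left_mono[OF Im2, of \<beta>] pos \<beta>r by simp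
    have \<beta>Re: "\<beta> * (Re z - Re k0)\<^sup>2 \<ge> 0" using pos by simp
    from cases consider (side) "\<bar>Re z - Re k0\<bar> = r / 3" | (bot) "Im z = - r / 4" | (top) "Im z = \<delta>" by blast
    then show "cmod (G z) \<le> b"
    proof cases
      case side
      then have "(Re z - Re k0)\<^sup>2 = r\<^sup>2 / 9" by (metis power2_abs sq9)
      then have "\<beta> * (Re z - Re k0)\<^sup>2 = 42 * A / 9" using \<beta>r by (metis times_divide_eq_right)
      moreover have "\<alpha> * Im z \<le> 1" using z mult_left_mono[of "Im z" \<delta> \<alpha>] pos \<alpha>\<delta> by simp
      ultimately have "\<alpha> * Im z - \<beta> * ((Re z - Re k0)\<^sup>2 - (Im z)\<^sup>2) \<le> 1 - 2 * A"
        using \<beta>Im A unfolding right_diff_distrib by linarith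
      then have "cmod (G z) \<le> exp A * exp (1 - 2 * A)"
        unfolding nG using FzA by (intro mult_mono) auto
      also have "\<dots> = exp (1 - A)" by (simp flip: exp_add)
      finally show ?thesis unfolding b_def by simp
    next
      case bot
      then have "\<alpha> * Im z = - 4 * A" using \<alpha>r by simp
      then have "\<alpha> * Im z - \<beta> * ((Re z - Re k0)\<^sup>2 - (Im z)\<^sup>2) \<le> - 11 / 8 * A"
        using \<beta>Im \<beta>Re A unfolding right_diff_distrib by linarith
      then have "cmod (G z) \<le> exp A * exp (- 11 / 8 * A)"
        unfolding nG using FzA by (intro mult_mono) auto
      also have "\<dots> = exp (- 3 / 8 * A)" by (simp flip: exp_add)
      finally show ?thesis unfolding b_def by simp
    next
      case top
      have "cmod (F z) * \<delta> \<le> q" using Fq[of z] top zS Sball pos by auto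
      then have "cmod (F z) \<le> q / \<delta>" using pos by (simp add: field_simps)
      moreover have "\<alpha> * Im z - \<beta> * ((Re z - Re k0)\<^sup>2 - (Im z)\<^sup>2) \<le> 2"
        using \<beta>Re \<beta>\<delta> \<alpha>\<delta> top unfolding right_diff_distrib by simp
      ultimately have "cmod (G z) \<le> q / \<delta> * exp 2"
        unfolding nG by (intro mult_mono) (auto intro: order_trans[OF norm_ge_zero])
      also have "\<dots> = 16 * exp 2 * A * q / r" unfolding \<delta>_def using r by simp
      finally show ?thesis unfolding b_def by simp
    qed
  qed
  moreover have "G k0 = F k0" unfolding G_def by simp
  ultimately show ?thesis using \<open>b < 1\<close> by simp
qed

text \<open>The threshold is chosen before \<open>D\<close>, \<open>N\<close>, \<open>F\<close> and
  the centres, from the bounding constants alone. This order of quantifiers is the source of the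
  uniformity in the edge lengths.\<close>

lemma quasimode_threshold:
  fixes C c B \<rho> Q \<gamma> :: real
  assumes "c > 0" "B > 0" "\<rho> \<ge> 1" "0 < \<gamma>" "\<gamma> < 1"
  obtains \<epsilon>0 where "0 < \<epsilon>0" "\<epsilon>0 < 1"
    "\<And>\<epsilon> D N F \<kappa> k0. 0 < \<epsilon> \<Longrightarrow> \<epsilon> < \<epsilon>0 \<Longrightarrow> D holomorphic_on ball \<kappa> (4 * \<rho>) \<Longrightarrow>
      (\<And>z. z \<in> ball \<kappa> (4 * \<rho>) \<Longrightarrow> cmod (D z) \<le> C) \<Longrightarrow> c \<le> cmod (D \<kappa>) \<Longrightarrow>
      ball k0 (\<epsilon> powr \<gamma>) \<subseteq> cball \<kappa> (\<rho> / 2) \<Longrightarrow> Im k0 = 0 \<Longrightarrow>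
      F holomorphic_on ball k0 (\<epsilon> powr \<gamma>) \<Longrightarrow>
      (\<And>z. z \<in> ball k0 (\<epsilon> powr \<gamma>) \<Longrightarrow> D z \<noteq> 0 \<Longrightarrow> F z * D z = N z) \<Longrightarrow>
      (\<And>z. z \<in> ball k0 (\<epsilon> powr \<gamma>) \<Longrightarrow> cmod (N z) \<le> B) \<Longrightarrow>
      (\<And>z. z \<in> ball k0 (\<epsilon> powr \<gamma>) \<Longrightarrow> Im z > 0 \<Longrightarrow> cmod (F z) * Im z \<le> Q * \<epsilon>) \<Longrightarrow>
      cmod (F k0) < 1"
proof -
  obtain N0 :: nat where N0: "C / c < 2 ^ N0" using real_arch_pow[of 2 "C / c"] by auto
  define B' where "B' = B * (8 * (real N0 + 1)) ^ N0 * (\<rho> ^ N0 / c) * exp (2 * (ln (C / c) + 1))"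
  have B': "B' > 0" unfolding B'_def using assms by simp
  \<comment> \<open>The value 2 is the lower bound on \<open>A\<close> that the interpolation
    demands; subtracting a nonnegative multiple of \<open>ln \<epsilon> \<le> 0\<close> preserves
    it.\<close>
  define A0 where "A0 = max 2 (ln B')"
  define A where "A \<epsilon> = A0 - real N0 * \<gamma> * ln \<epsilon>" for \<epsilon>
  \<comment> \<open>The positive power \<open>1 - \<gamma>\<close> of \<open>\<epsilon>\<close>
    beats its logarithm.\<close>
  have "((\<lambda>\<epsilon>. 16 * exp 2 * (A0 - real N0 * \<gamma> * ln \<epsilon>) * Q * \<epsilon> powr (1 - \<gamma>)) \<longlongrightarrow> 0) (at_right 0)"
    using assms by real_asymp
  then have "\<forall>\<^sub>F \<epsilon> in at_right 0. 16 * exp 2 * A \<epsilon> * Q * \<epsilon> powr (1 - \<gamma>) < 1"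
    unfolding A_def by (rule order_tendstoD) simp
  then obtain e where e: "e > 0" "\<And>\<epsilon>. 0 < \<epsilon> \<Longrightarrow> \<epsilon> < e \<Longrightarrow> 16 * exp 2 * A \<epsilon> * Q * \<epsilon> powr (1 - \<gamma>) < 1"
    unfolding eventually_at_right_field by auto
  show ?thesis
  proof
    show "0 < min e (1 / 2)" "min e (1 / 2) < 1" using e by auto
    fix \<epsilon> D N F \<kappa> k0
    let ?r = "\<epsilon> powr \<gamma>"
    assume \<epsilon>: "0 < \<epsilon>" "\<epsilon> < min e (1 / 2)" and D: "D holomorphic_on ball \<kappa> (4 * \<rho>)"
      and bd: "\<And>z. z \<in> ball \<kappa> (4 * \<rho>) \<Longrightarrow> cmod (D z) \<le> C" and low: "c \<le> cmod (D \<kappa>)"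
      and sub: "ball k0 ?r \<subseteq> cball \<kappa> (\<rho> / 2)" and k0: "Im k0 = 0"
      and F: "F holomorphic_on ball k0 ?r"
      and FD: "\<And>z. z \<in> ball k0 ?r \<Longrightarrow> D z \<noteq> 0 \<Longrightarrow> F z * D z = N z"
      and Nb: "\<And>z. z \<in> ball k0 ?r \<Longrightarrow> cmod (N z) \<le> B"
      and Fq: "\<And>z. z \<in> ball k0 ?r \<Longrightarrow> Im z > 0 \<Longrightarrow> cmod (F z) * Im z \<le> Q * \<epsilon>"
    have r: "0 < ?r" "?r \<le> 1" using \<epsilon> assms by (auto simp: powr_le1)
    have ln\<epsilon>: "ln \<epsilon> \<le> 0" using \<epsilon> by simp
    then have "real N0 * \<gamma> * ln \<epsilon> \<le> 0" using assms by (simp add: mult_nonneg_nonpos)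
    then have A2: "A \<epsilon> \<ge> 2" unfolding A_def A0_def by linarith
    show "cmod (F k0) < 1"
    proof (rule semiclassical_maximum_principle[OF r(1) A2 k0 F _ Fq])
      fix z assume z: "z \<in> cball k0 (?r / 2)"
      have "cmod (F z) \<le> B * (8 * (real N0 + 1) / ?r) ^ N0 * (\<rho> ^ N0 / c) * exp (2 * (ln (C / c) + 1))"
        by (rule meromorphic_quotient_bound[OF D assms(3) bd low assms(1) N0 r sub F FD Nb assms(2) z])
      also have "\<dots> = B' * (1 / ?r) ^ N0" unfolding B'_def by (simp add: power_divide)
      also have "\<dots> = exp (ln B' - real N0 * (\<gamma> * ln \<epsilon>))"
      proof -
        have "1 / ?r = exp (- (\<gamma> * ln \<epsilon>))"
          using \<epsilon> by (simp add: powr_def exp_minus field_simps)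
        then have "(1 / ?r) ^ N0 = exp (- (real N0 * (\<gamma> * ln \<epsilon>)))"
          by (simp flip: exp_of_nat_mult)
        then show ?thesis using B' by (simp add: exp_diff exp_minus field_simps)
      qed
      also have "\<dots> \<le> exp (A \<epsilon>)" unfolding A_def A0_def by (simp add: mult.assoc)
      finally show "cmod (F z) \<le> exp (A \<epsilon>)" .
    next
      have "16 * exp 2 * A \<epsilon> * Q * \<epsilon> powr (1 - \<gamma>) < 1" using e \<epsilon> by simp
      then have "16 * exp 2 * A \<epsilon> * Q * \<epsilon> powr (1 - \<gamma>) * ?r < 1 * ?r"
        by (rule mult_strict_right_mono) (rule r)
      moreover have "\<epsilon> powr (1 - \<gamma>) * ?r = \<epsilon>" using \<epsilon> by (simp flip: powr_add)
      ultimately show "16 * exp 2 * A \<epsilon> * (Q * \<epsilon>) < ?r" by (simp add: mult.assoc)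
    qed
  qed
qed

section \<open>Integration\<close>

text \<open>Cauchy's inequality turns the bound \<open>w\<close> on the integrand into a Lipschitz
  bound \<open>w / d\<close> in \<open>k\<close>. This dominates the difference quotients, so the
  limit may be taken under the integral.\<close>

lemma holomorphic_integral:
  fixes H :: "complex \<Rightarrow> 'a \<Rightarrow> complex"
  assumes U: "open U"
    and hol: "\<And>x. x \<in> space M \<Longrightarrow> (\<lambda>k. H k x) holomorphic_on U"
    and meas: "\<And>k. k \<in> U \<Longrightarrow> H k \<in> borel_measurable M"
    and bd: "\<And>k x. k \<in> U \<Longrightarrow> x \<in> space M \<Longrightarrow> cmod (H k x) \<le> w x"
    and w: "integrable M w"
  shows "(\<lambda>k. \<integral>x. H k x \<partial>M) holomorphic_on U"
  unfolding holomorphic_on_open[OF U]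
proof
  fix k assume k: "k \<in> U"
  then obtain e where e: "e > 0" "cball k e \<subseteq> U" using U open_contains_cball by blast
  \<comment> \<open>Half the radius, so that discs of radius \<open>d\<close> about points of
    \<open>ball k d\<close> stay inside \<open>U\<close>.\<close>
  define d where "d = e / 2"
  have d: "d > 0" unfolding d_def using e by simp
  have int: "integrable M (H y)" if "y \<in> U" for y
    using that by (intro Bochner_Integration.integrable_bound[OF w meas]) (auto intro!: AE_I2 order_trans[OF bd])
  have lip: "cmod (H y x - H k x) \<le> w x / d * cmod (y - k)" if y: "y \<in> ball k d" and x: "x \<in> space M" for y x
  proof (rule field_differentiable_bound[where S = "ball k d" and f' = "deriv (\<lambda>k. H k x)"])
    fix z assume z: "z \<in> ball k d"
    have sub: "cball z d \<subseteq> U"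
    proof
      fix y assume "y \<in> cball z d"
      then have "dist k y \<le> e" using z dist_triangle[of k y z] unfolding d_def by auto
      then show "y \<in> U" using e by auto
    qed
    then have zU: "z \<in> U" using d by auto
    show "((\<lambda>k. H k x) has_field_derivative deriv (\<lambda>k. H k x) z) (at z within ball k d)"
      using holomorphic_derivI[OF hol[OF x] U zU] has_field_derivative_at_within by blast
    have "cmod ((deriv ^^ 1) (\<lambda>k. H k x) z) \<le> fact 1 * w x / d ^ 1"
    proof (rule Cauchy_inequality[OF _ _ d])
      show "(\<lambda>k. H k x) holomorphic_on ball z d"
        by (rule holomorphic_on_subset[OF hol[OF x]]) (use sub ball_subset_cball in blast)
      show "continuous_on (cball z d) (\<lambda>k. H k x)"
        by (rule holomorphic_on_imp_continuous_on[OF holomorphic_on_subset[OF hol[OF x] sub]])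
      fix y assume "cmod (z - y) = d"
      then have "y \<in> U" using sub by (auto simp: dist_norm)
      then show "cmod (H y x) \<le> w x" by (rule bd[OF _ x])
    qed
    then show "cmod (deriv (\<lambda>k. H k x) z) \<le> w x / d" by simp
  qed (use y d in auto)
  have dU: "ball k d \<subseteq> U" using e unfolding d_def by auto
  have "((\<lambda>y. ((\<integral>x. H y x \<partial>M) - (\<integral>x. H k x \<partial>M)) / (y - k)) \<longlongrightarrow> (\<integral>x. deriv (\<lambda>k. H k x) k \<partial>M)) (at k within ball k d)"
    unfolding tendsto_at_iff_sequentially o_def
  proof safe
    fix X :: "nat \<Rightarrow> complex" assume X: "\<forall>i. X i \<in> ball k d - {k}" "X \<longlonglongrightarrow> k"
    have XU: "X i \<in> U" for i using X dU by blast
    have "(\<lambda>i. \<integral>x. (H (X i) x - H k x) / (X i - k) \<partial>M) \<longlonglongrightarrow> (\<integral>x. deriv (\<lambda>k. H k x) k \<partial>M)"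
    proof (rule integral_dominated_convergence[where w = "\<lambda>x. w x / d"])
      have conv: "(\<lambda>i. (H (X i) x - H k x) / (X i - k)) \<longlonglongrightarrow> deriv (\<lambda>k. H k x) k" if x: "x \<in> space M" for x
      proof -
        have "((\<lambda>k. H k x) has_field_derivative deriv (\<lambda>k. H k x) k) (at k within ball k d)"
          using holomorphic_derivI[OF hol[OF x] U k] has_field_derivative_at_within by blast
        then show ?thesis
          using X unfolding has_field_derivative_iff tendsto_at_iff_sequentially o_def by blast
      qed
      show m: "(\<lambda>x. (H (X i) x - H k x) / (X i - k)) \<in> borel_measurable M" for i
        by (intro borel_measurable_divide borel_measurable_diff meas XU k borel_measurable_const)
      show "AE x in M. (\<lambda>i. (H (X i) x - H k x) / (X i - k)) \<longlonglongrightarrow> deriv (\<lambda>k. H k x) k"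
        using conv by (rule AE_I2)
      show "(\<lambda>x. deriv (\<lambda>k. H k x) k) \<in> borel_measurable M"
        by (rule borel_measurable_LIMSEQ_metric[OF m conv])
      show "integrable M (\<lambda>x. w x / d)" using w by simp
      show "AE x in M. cmod ((H (X i) x - H k x) / (X i - k)) \<le> w x / d" for i
      proof (rule AE_I2)
        fix x assume x: "x \<in> space M"
        have "X i \<noteq> k" "X i \<in> ball k d" using X by auto
        then show "cmod ((H (X i) x - H k x) / (X i - k)) \<le> w x / d"
          using lip[of "X i" x] x by (simp add: norm_divide pos_divide_le_eq)
      qed
    qed
    moreover have "(\<integral>x. (H (X i) x - H k x) / (X i - k) \<partial>M) = ((\<integral>x. H (X i) x \<partial>M) - (\<integral>x. H k x \<partial>M)) / (X i - k)" for i
      using Bochner_Integration.integral_diff[OF int[OF XU, of i] int[OF k]] by simp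
    ultimately show "(\<lambda>i. ((\<integral>x. H (X i) x \<partial>M) - (\<integral>x. H k x \<partial>M)) / (X i - k)) \<longlonglongrightarrow> (\<integral>x. deriv (\<lambda>k. H k x) k \<partial>M)"
      by (simp only:)
  qed
  then have "((\<lambda>k. \<integral>x. H k x \<partial>M) has_field_derivative (\<integral>x. deriv (\<lambda>k. H k x) k \<partial>M)) (at k within ball k d)"
    unfolding has_field_derivative_iff .
  then show "\<exists>f'. ((\<lambda>k. \<integral>x. H k x \<partial>M) has_field_derivative f') (at k)"
    using d by (auto simp: at_within_open[of k "ball k d"])
qed

text \<open>The dominating function may grow with the radius of the disc: holomorphy is local, and
  discs exhaust the plane.\<close>

lemma entire_integral:
  fixes H :: "complex \<Rightarrow> 'a \<Rightarrow> complex"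
  assumes hol: "\<And>x. x \<in> space M \<Longrightarrow> (\<lambda>k. H k x) holomorphic_on UNIV"
    and meas: "\<And>k. H k \<in> borel_measurable M"
    and bd: "\<And>r k x. cmod k < r \<Longrightarrow> x \<in> space M \<Longrightarrow> cmod (H k x) \<le> w r x"
    and w: "\<And>r. integrable M (w r)"
  shows "(\<lambda>k. \<integral>x. H k x \<partial>M) holomorphic_on UNIV"
proof -
  have "(\<lambda>k. \<integral>x. H k x \<partial>M) holomorphic_on ball 0 r" for r
    by (rule holomorphic_integral[where w = "w r"])
       (use assms in \<open>auto intro: holomorphic_on_subset\<close>)
  then have "(\<lambda>k. \<integral>x. H k x \<partial>M) holomorphic_on (\<Union>r. ball 0 r)"
    by (intro holomorphic_on_UN_open) auto
  moreover have "(\<Union>r. ball (0::complex) r) = UNIV"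
    using gt_ex by force
  ultimately show ?thesis by simp
qed

section \<open>Indefinite integrals and integration by parts\<close>

abbreviation L1_on :: "real set \<Rightarrow> (real \<Rightarrow> 'a::{banach, second_countable_topology}) \<Rightarrow> bool" where
  "L1_on \<equiv> set_integrable lborel"

lemma continuous_on_set_integral_Icc:
  fixes g :: "real \<Rightarrow> complex"
  assumes "L1_on {0..L} g"
  shows "continuous_on {0..L} (\<lambda>x. LBINT t:{0..x}. g t)"
proof -
  have "continuous_on {0..L} (\<lambda>x. integral {0..x} g)"
    by (intro indefinite_integral_continuous_1 set_borel_integral_eq_integral assms)
  moreover have "integral {0..x} g = (LBINT t:{0..x}. g t)" if "x \<in> {0..L}" for x
    by (intro set_borel_integral_eq_integral(2)[symmetric] set_integrable_subset[OF assms]) (use that in auto)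
  ultimately show ?thesis by (rule continuous_on_eq)
qed

lemma set_integral_Icc_FTC:
  fixes \<phi> \<phi>' :: "real \<Rightarrow> complex"
  assumes "a \<le> b" "\<And>x. x \<in> {a..b} \<Longrightarrow> (\<phi> has_vector_derivative \<phi>' x) (at x within {a..b})"
    and "continuous_on {a..b} \<phi>'"
  shows "(LBINT x:{a..b}. \<phi>' x) = \<phi> b - \<phi> a"
  using integral_FTC_Icc[of a b \<phi> \<phi>'] assms by (simp add: set_lebesgue_integral_def)

lemma continuous_on_Icc_norm_bound:
  fixes f :: "real \<Rightarrow> 'a::real_normed_vector"
  assumes "continuous_on {a..b} f"
  shows "\<exists>B. \<forall>x\<in>{a..b}. norm (f x) \<le> B"
  using compact_imp_bounded[OF compact_continuous_image[OF assms compact_Icc]]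
  by (simp add: bounded_iff)

lemma set_integrable_mult_continuous:
  fixes g \<phi> :: "real \<Rightarrow> complex"
  assumes g: "L1_on {a..b} g" and \<phi>: "continuous_on {a..b} \<phi>"
  shows "L1_on {a..b} (\<lambda>x. g x * \<phi> x)"
proof -
  obtain B where B: "\<And>x. x \<in> {a..b} \<Longrightarrow> cmod (\<phi> x) \<le> B"
    using continuous_on_Icc_norm_bound[OF \<phi>] by blast
  have m: "(\<lambda>x. indicator {a..b} x *\<^sub>R \<phi> x) \<in> borel_measurable lborel"
    using borel_measurable_continuous_on_indicator[OF _ \<phi>] by simp
  have "integrable lborel (\<lambda>x. B * cmod (indicator {a..b} x *\<^sub>R g x))"
    using g unfolding set_integrable_def by (intro integrable_mult_right integrable_norm)
  then show ?thesis
    unfolding set_integrable_def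
  proof (rule Bochner_Integration.integrable_bound)
    have "(\<lambda>x. (indicator {a..b} x *\<^sub>R g x) * (indicator {a..b} x *\<^sub>R \<phi> x)) \<in> borel_measurable lborel"
      using g m unfolding set_integrable_def by (intro borel_measurable_times) auto
    also have "(\<lambda>x. (indicator {a..b} x *\<^sub>R g x) * (indicator {a..b} x *\<^sub>R \<phi> x)) = (\<lambda>x. indicator {a..b} x *\<^sub>R (g x * \<phi> x))"
      by (auto simp: indicator_def)
    finally show "(\<lambda>x. indicator {a..b} x *\<^sub>R (g x * \<phi> x)) \<in> borel_measurable lborel" .
    have "cmod (indicator {a..b} x *\<^sub>R (g x * \<phi> x)) \<le> norm (B * cmod (indicator {a..b} x *\<^sub>R g x))" for x
    proof (cases "x \<in> {a..b}")
      case True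
      have "cmod (g x) * cmod (\<phi> x) \<le> cmod (g x) * \<bar>B\<bar>"
        using B[OF True] by (intro mult_left_mono) auto
      then show ?thesis using True by (simp add: norm_mult abs_mult mult.commute)
    qed auto
    then show "AE x in lborel. cmod (indicator {a..b} x *\<^sub>R (g x * \<phi> x)) \<le> norm (B * cmod (indicator {a..b} x *\<^sub>R g x))"
      by (intro AE_I2)
  qed
qed

text \<open>Fubini on the triangle \<open>t \<le> s\<close>; the inner integral over
  \<open>s\<close> is then evaluated by the fundamental theorem of calculus.\<close>

lemma set_integral_Icc_swap:
  fixes g \<phi> \<phi>' :: "real \<Rightarrow> complex"
  assumes g: "L1_on {0..L} g"
    and \<phi>: "\<And>x. x \<in> {0..L} \<Longrightarrow> (\<phi> has_vector_derivative \<phi>' x) (at x within {0..L})"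
    and c: "continuous_on {0..L} \<phi>'"
  shows "(LBINT s:{0..L}. \<phi>' s * (LBINT t:{0..s}. g t)) = (LBINT t:{0..L}. g t * (\<phi> L - \<phi> t))"
proof -
  define g0 where "g0 = (\<lambda>t. indicator {0..L} t *\<^sub>R g t)"
  define \<psi> where "\<psi> = (\<lambda>s. indicator {0..L} s *\<^sub>R \<phi>' s)"
  have g0: "integrable lborel g0" using g unfolding g0_def set_integrable_def .
  have \<psi>: "integrable lborel \<psi>" unfolding \<psi>_def
    using borel_integrable_compact[OF _ c] by simp
  define F where "F = (\<lambda>s t. indicator {z::real \<times> real. snd z \<le> fst z} (s, t) *\<^sub>R (\<psi> s * g0 t))"
  have [measurable]: "g0 \<in> borel_measurable lborel" "\<psi> \<in> borel_measurable lborel"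
    using g0 \<psi> by auto
  have "integrable (lborel \<Otimes>\<^sub>M lborel) (\<lambda>z. \<psi> (fst z) * g0 (snd z))"
  proof (rule lborel_pair.Fubini_integrable)
    have "integrable lborel (\<lambda>x. cmod (\<psi> x) * (\<integral>y. cmod (g0 y) \<partial>lborel))"
      using \<psi> by (intro integrable_mult_left integrable_norm)
    then show "integrable lborel (\<lambda>x. LINT y|lborel. cmod (\<psi> (fst (x, y)) * g0 (snd (x, y))))"
      by (simp add: norm_mult)
    show "AE x in lborel. integrable lborel (\<lambda>y. \<psi> (fst (x, y)) * g0 (snd (x, y)))"
      using g0 by simp
  qed measurable
  moreover have "{z::real \<times> real. snd z \<le> fst z} \<in> sets (lborel \<Otimes>\<^sub>M lborel)"
    unfolding lborel_prod by (auto intro!: borel_closed closed_Collect_le continuous_intros)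
  ultimately have "integrable (lborel \<Otimes>\<^sub>M lborel) (\<lambda>z. indicator {z::real \<times> real. snd z \<le> fst z} z *\<^sub>R (\<psi> (fst z) * g0 (snd z)))"
    by (intro integrable_mult_indicator)
  then have "integrable (lborel \<Otimes>\<^sub>M lborel) (case_prod F)"
    unfolding F_def by (simp add: case_prod_unfold)
  then have fub: "(\<integral>t. (\<integral>s. F s t \<partial>lborel) \<partial>lborel) = (\<integral>s. (\<integral>t. F s t \<partial>lborel) \<partial>lborel)"
    by (rule lborel_pair.Fubini_integral)
  have 1: "(\<integral>t. F s t \<partial>lborel) = indicator {0..L} s *\<^sub>R (\<phi>' s * (LBINT t:{0..s}. g t))" for s
  proof (cases "s \<in> {0..L}")
    case True
    have "F s t = \<phi>' s * (indicator {0..s} t *\<^sub>R g t)" for t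
      using True by (auto simp: F_def \<psi>_def g0_def indicator_def)
    then have "(\<integral>t. F s t \<partial>lborel) = \<phi>' s * (\<integral>t. indicator {0..s} t *\<^sub>R g t \<partial>lborel)"
      by (simp only: integral_mult_right_zero)
    then show ?thesis using True by (simp add: set_lebesgue_integral_def)
  qed (simp add: F_def \<psi>_def)
  have 2: "(\<integral>s. F s t \<partial>lborel) = indicator {0..L} t *\<^sub>R (g t * (\<phi> L - \<phi> t))" for t
  proof (cases "t \<in> {0..L}")
    case True
    have "F s t = g t * (indicator {t..L} s *\<^sub>R \<phi>' s)" for s
      using True by (auto simp: F_def \<psi>_def g0_def indicator_def)
    moreover have "(LBINT s:{t..L}. \<phi>' s) = \<phi> L - \<phi> t"
      by (intro set_integral_Icc_FTC has_vector_derivative_within_subset[OF \<phi>] continuous_on_subset[OF c])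
         (use True in auto)
    moreover have "(\<integral>s. g t * (indicator {t..L} s *\<^sub>R \<phi>' s) \<partial>lborel) = g t * (\<integral>s. indicator {t..L} s *\<^sub>R \<phi>' s \<partial>lborel)"
      by (rule integral_mult_right_zero)
    ultimately show ?thesis using True by (simp only: set_lebesgue_integral_def) simp
  qed (simp add: F_def g0_def)
  show ?thesis using fub unfolding 1 2 by (simp add: set_lebesgue_integral_def)
qed

text \<open>The function \<open>G\<close> is only absolutely continuous, like the derivative of an
  element of the operator domain, so the product rule cannot be applied pointwise. Writing
  \<open>G\<close> as an indefinite integral reduces the claim to exchanging a double
  integral.\<close>

lemma AC_integration_by_parts:
  fixes G g \<phi> \<phi>' :: "real \<Rightarrow> complex"
  assumes L: "0 \<le> L" and g: "L1_on {0..L} g"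
    and G: "\<And>x. x \<in> {0..L} \<Longrightarrow> G x = G 0 + (LBINT t:{0..x}. g t)"
    and \<phi>: "\<And>x. x \<in> {0..L} \<Longrightarrow> (\<phi> has_vector_derivative \<phi>' x) (at x within {0..L})"
    and c: "continuous_on {0..L} \<phi>'"
  shows "G L * \<phi> L = G 0 * \<phi> 0 + (LBINT x:{0..L}. G x * \<phi>' x + g x * \<phi> x)"
proof -
  let ?A = "\<lambda>x. LBINT t:{0..x}. g t"
  have \<phi>c: "continuous_on {0..L} \<phi>"
    using \<phi> has_vector_derivative_continuous continuous_on_eq_continuous_within by blast
  have ci: "L1_on {0..L} f" if "continuous_on {0..L} f" for f :: "real \<Rightarrow> complex"
    unfolding set_integrable_def using borel_integrable_compact[OF _ that] by simp
  have Ac: "continuous_on {0..L} ?A" by (rule continuous_on_set_integral_Icc[OF g])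
  note i1 = ci[OF c] and i2 = ci[OF continuous_on_mult[OF c Ac]]
    and i3 = set_integrable_mult_continuous[OF g \<phi>c]
  have "(LBINT x:{0..L}. G x * \<phi>' x + g x * \<phi> x) = (LBINT x:{0..L}. (G 0 * \<phi>' x + \<phi>' x * ?A x) + g x * \<phi> x)"
  proof (rule set_lebesgue_integral_cong)
    show "\<forall>x. x \<in> {0..L} \<longrightarrow> G x * \<phi>' x + g x * \<phi> x = (G 0 * \<phi>' x + \<phi>' x * ?A x) + g x * \<phi> x"
    proof safe
      fix x assume "x \<in> {0..L}"
      from G[OF this] show "G x * \<phi>' x + g x * \<phi> x = (G 0 * \<phi>' x + \<phi>' x * ?A x) + g x * \<phi> x"
        by (simp only: distrib_right mult.commute[of "?A x"])
    qed
  qed simp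
  also have "\<dots> = G 0 * (LBINT x:{0..L}. \<phi>' x) + (LBINT x:{0..L}. \<phi>' x * ?A x) + (LBINT x:{0..L}. g x * \<phi> x)"
    using i1 i2 i3 by (simp add: set_integral_add)
  also have "(LBINT x:{0..L}. \<phi>' x) = \<phi> L - \<phi> 0"
    by (rule set_integral_Icc_FTC[OF L \<phi> c])
  also have "(LBINT x:{0..L}. \<phi>' x * ?A x) = (LBINT t:{0..L}. g t * \<phi> L - g t * \<phi> t)"
    using set_integral_Icc_swap[OF g, of \<phi> \<phi>'] \<phi> c by (simp add: right_diff_distrib)
  also have "\<dots> = ?A L * \<phi> L - (LBINT x:{0..L}. g x * \<phi> x)"
    using i3 g by (simp add: set_integral_diff)
  finally have "(LBINT x:{0..L}. G x * \<phi>' x + g x * \<phi> x) = (G 0 + ?A L) * \<phi> L - G 0 * \<phi> 0"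
    by (simp add: algebra_simps)
  moreover have "G L = G 0 + ?A L" using G[of L] L by simp
  ultimately show ?thesis by simp
qed

section \<open>Square-integrable functions on a set\<close>

lemma L2_on_measurable: "L2_on S f \<Longrightarrow> (\<lambda>x. indicator S x *\<^sub>R f x) \<in> borel_measurable lborel"
  by (simp add: L2_on_def)

lemma L2_on_square_integrable: "L2_on S f \<Longrightarrow> L1_on S (\<lambda>x. (cmod (f x))\<^sup>2)"
  by (simp add: L2_on_def set_integrable_def)

lemma set_integrable_complex_bound:
  fixes h :: "real \<Rightarrow> complex" and w :: "real \<Rightarrow> real"
  assumes "L1_on S w" "(\<lambda>x. indicator S x *\<^sub>R h x) \<in> borel_measurable lborel"
    and "\<And>x. x \<in> S \<Longrightarrow> cmod (h x) \<le> w x"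
  shows "L1_on S h"
  using assms(1) unfolding set_integrable_def
  by (rule Bochner_Integration.integrable_bound)
     (use assms(2,3) in \<open>auto simp: indicator_def intro!: AE_I2 order_trans[OF assms(3)]\<close>)

lemma L2_on_mult_measurable:
  assumes "L2_on S f" "L2_on S g"
  shows "(\<lambda>x. indicator S x *\<^sub>R (f x * g x)) \<in> borel_measurable lborel"
proof -
  have "(\<lambda>x. (indicator S x *\<^sub>R f x) * (indicator S x *\<^sub>R g x)) \<in> borel_measurable lborel"
    by (intro borel_measurable_times L2_on_measurable assms)
  also have "(\<lambda>x. (indicator S x *\<^sub>R f x) * (indicator S x *\<^sub>R g x)) = (\<lambda>x. indicator S x *\<^sub>R (f x * g x))"
    by (auto simp: indicator_def)
  finally show ?thesis .
qed

text \<open>The weight is left free: \<open>s = 1\<close> yields integrability of products,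
  optimising over \<open>s\<close> yields Cauchy-Schwarz.\<close>

lemma norm_mult_le_weighted:
  fixes a b :: complex
  assumes "s > 0"
  shows "cmod (a * b) \<le> (s * (cmod a)\<^sup>2 + (cmod b)\<^sup>2 / s) / 2"
proof -
  have "0 \<le> (s * cmod a - cmod b)\<^sup>2 / s" using assms by simp
  also have "\<dots> = s * (cmod a)\<^sup>2 + (cmod b)\<^sup>2 / s - 2 * (cmod a * cmod b)"
    using assms by (simp add: power2_diff field_simps power2_eq_square)
  finally show ?thesis by (simp add: norm_mult)
qed

lemma L2_on_mult_integrable:
  assumes "L2_on S f" "L2_on S g"
  shows "L1_on S (\<lambda>x. f x * g x)"
proof (rule set_integrable_complex_bound)
  show "L1_on S (\<lambda>x. (1 * (cmod (f x))\<^sup>2 + (cmod (g x))\<^sup>2 / 1) / 2)"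
    using assms[THEN L2_on_square_integrable] by (intro set_integrable_divide set_integral_add(1)) auto
qed (use assms L2_on_mult_measurable norm_mult_le_weighted[of 1] in auto)

lemma L2_on_cnj: "L2_on S f \<Longrightarrow> L2_on S (\<lambda>x. cnj (f x))"
proof -
  assume f: "L2_on S f"
  have "(\<lambda>x. cnj (indicator S x *\<^sub>R f x)) \<in> borel_measurable lborel"
    using L2_on_measurable[OF f] by (rule measurable_compose) (intro borel_measurable_continuous_onI continuous_intros)
  then show ?thesis using f by (simp add: L2_on_def)
qed

lemma L2_on_cmult: "L2_on S f \<Longrightarrow> L2_on S (\<lambda>x. c * f x)"
proof -
  assume f: "L2_on S f"
  have "(\<lambda>x. c * (indicator S x *\<^sub>R f x)) \<in> borel_measurable lborel"
    using L2_on_measurable[OF f] by (intro borel_measurable_times) auto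
  moreover have "integrable lborel (\<lambda>x. (cmod c)\<^sup>2 * (indicator S x * (cmod (f x))\<^sup>2))"
    using f unfolding L2_on_def by (intro integrable_mult_right) auto
  ultimately show ?thesis by (simp add: L2_on_def norm_mult power_mult_distrib algebra_simps)
qed

lemma L2_on_add:
  assumes f: "L2_on S f" and g: "L2_on S g"
  shows "L2_on S (\<lambda>x. f x + g x)"
proof -
  have m: "(\<lambda>x. indicator S x *\<^sub>R (f x + g x)) \<in> borel_measurable lborel"
    using L2_on_measurable[OF f] L2_on_measurable[OF g]
    by (simp add: scaleR_add_right borel_measurable_add)
  have "integrable lborel (\<lambda>x. 2 * (indicator S x * (cmod (f x))\<^sup>2) + 2 * (indicator S x * (cmod (g x))\<^sup>2))"
    using f g unfolding L2_on_def by (intro Bochner_Integration.integrable_add integrable_mult_right) auto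
  then have "integrable lborel (\<lambda>x. (cmod (indicator S x *\<^sub>R (f x + g x)))\<^sup>2)"
  proof (rule Bochner_Integration.integrable_bound)
    show "(\<lambda>x. (cmod (indicator S x *\<^sub>R (f x + g x)))\<^sup>2) \<in> borel_measurable lborel"
      by (intro borel_measurable_power measurable_compose[OF m borel_measurable_norm])
    have "(cmod (f x + g x))\<^sup>2 \<le> 2 * (cmod (f x))\<^sup>2 + 2 * (cmod (g x))\<^sup>2" for x
    proof -
      have "(cmod (f x + g x))\<^sup>2 \<le> (cmod (f x) + cmod (g x))\<^sup>2"
        by (intro power_mono norm_triangle_ineq) auto
      also have "\<dots> \<le> 2 * (cmod (f x))\<^sup>2 + 2 * (cmod (g x))\<^sup>2"
        using zero_le_power2[of "cmod (f x) - cmod (g x)"] unfolding power2_diff power2_sum by linarith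
      finally show ?thesis .
    qed
    then show "AE x in lborel. norm ((cmod (indicator S x *\<^sub>R (f x + g x)))\<^sup>2) \<le> norm (2 * (indicator S x * (cmod (f x))\<^sup>2) + 2 * (indicator S x * (cmod (g x))\<^sup>2))"
      by (intro AE_I2) (auto simp: indicator_def)
  qed
  moreover have "(\<lambda>x. (cmod (indicator S x *\<^sub>R (f x + g x)))\<^sup>2) = (\<lambda>x. indicator S x * (cmod (f x + g x))\<^sup>2)"
    by (auto simp: indicator_def)
  ultimately show ?thesis using m by (simp add: L2_on_def)
qed

lemma L2_on_diff: "L2_on S f \<Longrightarrow> L2_on S g \<Longrightarrow> L2_on S (\<lambda>x. f x - g x)"
  using L2_on_add[of S f "\<lambda>x. - 1 * g x"] L2_on_cmult[of S g "- 1"] by simp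

lemma L2_on_subset:
  assumes f: "L2_on S f" and T: "T \<in> sets lborel" "T \<subseteq> S"
  shows "L2_on T f"
proof -
  have "(\<lambda>x. indicator T x *\<^sub>R (indicator S x *\<^sub>R f x)) \<in> borel_measurable lborel"
    by (rule borel_measurable_scaleR[OF borel_measurable_indicator[OF T(1)] L2_on_measurable[OF f]])
  moreover have "(\<lambda>x. indicator T x *\<^sub>R (indicator S x *\<^sub>R f x)) = (\<lambda>x. indicator T x *\<^sub>R f x)"
    using T by (auto simp: indicator_def fun_eq_iff)
  moreover have "L1_on T (\<lambda>x. (cmod (f x))\<^sup>2)"
    using set_integrable_subset[OF L2_on_square_integrable[OF f] T] .
  ultimately show ?thesis by (simp add: L2_on_def set_integrable_def)
qed

lemma L2_on_continuous_Icc: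
  fixes f :: "real \<Rightarrow> complex"
  assumes f: "continuous_on {a..b} f"
  shows "L2_on {a..b} f"
proof -
  have "integrable lborel (\<lambda>x. indicator {a..b} x *\<^sub>R (cmod (f x))\<^sup>2)"
    by (intro borel_integrable_compact continuous_intros f) simp
  then show ?thesis
    using borel_measurable_continuous_on_indicator[OF _ f] by (simp add: L2_on_def)
qed

lemma L2_on_Icc_integrable:
  assumes "L2_on {a..b} f"
  shows "L1_on {a..b} f"
  using L2_on_mult_integrable[OF assms L2_on_continuous_Icc[of a b "\<lambda>_. 1"]] by simp

text \<open>A substitute for Cauchy-Schwarz without square roots, sufficient because it will be
  applied to functions of norm at most 1.\<close>

lemma L2_on_Icc_L1_bound:
  assumes f: "L2_on {a..b} f" and "a \<le> b"
  shows "(LBINT x:{a..b}. cmod (f x)) \<le> ((b - a) + (LBINT x:{a..b}. (cmod (f x))\<^sup>2)) / 2"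
proof -
  have i1: "L1_on {a..b} (\<lambda>x. 1::real)"
    using L2_on_square_integrable[OF L2_on_continuous_Icc[of a b "\<lambda>_. 1"]] by simp
  note i2 = L2_on_square_integrable[OF f]
  have "(LBINT x:{a..b}. cmod (f x)) \<le> (LBINT x:{a..b}. (1 + (cmod (f x))\<^sup>2) / 2)"
  proof (rule set_integral_mono)
    show "L1_on {a..b} (\<lambda>x. cmod (f x))"
      using L2_on_Icc_integrable[OF f] unfolding set_integrable_def
      by (auto dest: integrable_norm)
    show "L1_on {a..b} (\<lambda>x. (1 + (cmod (f x))\<^sup>2) / 2)"
      using i1 i2 by (intro set_integrable_divide set_integral_add(1)) auto
    show "cmod (f x) \<le> (1 + (cmod (f x))\<^sup>2) / 2" for x
      using norm_mult_le_weighted[of 1 1 "f x"] by simp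
  qed
  also have "\<dots> = ((LBINT x:{a..b}. 1) + (LBINT x:{a..b}. (cmod (f x))\<^sup>2)) / 2"
    using i1 i2 by (simp add: set_integral_add(2))
  also have "(LBINT x:{a..b}. 1) = b - a"
    using assms by (simp add: set_lebesgue_integral_def)
  finally show ?thesis .
qed

text \<open>Multiplied by \<open>exp (a * x)\<close>, the squared modulus is constant beyond
  \<open>R\<close> and continuous before it, so one constant dominates everywhere.\<close>

lemma L2_on_atLeast_exponential:
  fixes w :: "real \<Rightarrow> complex"
  assumes w: "continuous_on {0..} w" and R: "\<And>x. x \<ge> R \<Longrightarrow> w x = C * exp (\<i> * k * x)"
    and k: "Im k > 0"
  shows "L2_on {0..} w"
proof -
  define a where "a = 2 * Im k"
  have a: "a > 0" unfolding a_def using k by simp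
  have m: "(\<lambda>x. indicator {0..} x *\<^sub>R w x) \<in> borel_measurable lborel"
    using borel_measurable_continuous_on_indicator[OF _ w] by simp
  have "continuous_on {0..R} (\<lambda>x. (cmod (w x))\<^sup>2 * exp (a * x))"
    by (intro continuous_intros continuous_on_subset[OF w]) auto
  then obtain B where B: "\<And>x. x \<in> {0..R} \<Longrightarrow> norm ((cmod (w x))\<^sup>2 * exp (a * x)) \<le> B"
    using continuous_on_Icc_norm_bound by blast
  define B' where "B' = max B ((cmod C)\<^sup>2)"
  have bd: "(cmod (w x))\<^sup>2 \<le> B' * exp (- (a * x))" if x: "x \<ge> 0" for x
  proof (cases "x \<le> R")
    case True
    then have "(cmod (w x))\<^sup>2 * exp (a * x) \<le> B'" using B[of x] x unfolding B'_def by auto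
    then show ?thesis by (simp add: exp_minus field_simps)
  next
    case False
    then have "(cmod (w x))\<^sup>2 = (cmod C)\<^sup>2 * exp (- (a * x))"
      using R[of x] by (simp add: norm_mult power_mult_distrib a_def exp_double[symmetric] algebra_simps power2_eq_square flip: exp_add)
    then show ?thesis unfolding B'_def by (simp add: mult_right_mono)
  qed
  have "L1_on {0..} (\<lambda>x. exp (- (a * x)))"
  proof -
    have "((\<lambda>x. exp (- a * x)) has_integral exp (- a * 0) / a) {0..}"
      using has_integral_exp_minus_to_infinity[OF a] .
    then have "(\<lambda>x. exp (- a * x)) absolutely_integrable_on {0..}"
      by (intro nonnegative_absolutely_integrable_1) (auto simp: has_integral_integrable)
    then have "integrable lebesgue (\<lambda>x. indicator {0..} x *\<^sub>R exp (- a * x))"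
      unfolding set_integrable_def .
    moreover have "(\<lambda>x::real. indicator {0..} x *\<^sub>R exp (- a * x)) \<in> borel_measurable lborel" by measurable
    ultimately show ?thesis unfolding set_integrable_def
      by (subst integrable_completion[symmetric]) simp_all
  qed
  then have "integrable lborel (\<lambda>x. B' * (indicator {0..} x * exp (- (a * x))))"
    unfolding set_integrable_def by (intro integrable_mult_right) simp
  then have "integrable lborel (\<lambda>x. (cmod (indicator {0..} x *\<^sub>R w x))\<^sup>2)"
  proof (rule Bochner_Integration.integrable_bound)
    show "(\<lambda>x. (cmod (indicator {0..} x *\<^sub>R w x))\<^sup>2) \<in> borel_measurable lborel"
      by (intro borel_measurable_power measurable_compose[OF m borel_measurable_norm])
    show "AE x in lborel. norm ((cmod (indicator {0..} x *\<^sub>R w x))\<^sup>2) \<le> norm (B' * (indicator {0..} x * exp (- (a * x))))"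
      using bd by (intro AE_I2) (auto simp: indicator_def intro: order_trans[OF _ abs_ge_self])
  qed
  moreover have "(\<lambda>x. (cmod (indicator {0..} x *\<^sub>R w x))\<^sup>2) = (\<lambda>x. indicator {0..} x * (cmod (w x))\<^sup>2)"
    by (auto simp: indicator_def)
  ultimately show ?thesis using m by (simp add: L2_on_def)
qed

section \<open>Energy identity\<close>

text \<open>This removes the boundary term at infinity on a lead: \<open>du y * cnj (u y)\<close>
  has a limit by the energy identity on \<open>{0..y}\<close> and is integrable as a product of
  square-integrable functions.\<close>

lemma set_integrable_atLeast_limit_eq_0:
  fixes p :: "real \<Rightarrow> complex"
  assumes p: "L1_on {0..} p" and lim: "(p \<longlongrightarrow> c) at_top"
  shows "c = 0"
proof (rule ccontr)
  assume "c \<noteq> 0"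
  then have c: "cmod c > 0" by simp
  have "((\<lambda>x. cmod (p x)) \<longlongrightarrow> cmod c) at_top" using lim by (rule tendsto_norm)
  then have "\<forall>\<^sub>F x in at_top. cmod c / 2 < cmod (p x)" by (rule order_tendstoD) (use c in simp)
  then obtain X0 where X0: "\<And>x. x \<ge> X0 \<Longrightarrow> cmod c / 2 < cmod (p x)"
    unfolding eventually_at_top_linorder by blast
  define X where "X = max X0 0"
  have np: "L1_on {0..} (\<lambda>x. cmod (p x))"
    using p unfolding set_integrable_def by (auto dest: integrable_norm)
  have "n * (cmod c / 2) \<le> (LBINT x:{0..}. cmod (p x))" if n: "n \<ge> 0" for n
  proof -
    have i: "integrable lborel (\<lambda>x. indicator {X..X+n} x *\<^sub>R (cmod c / 2))"
      by (rule borel_integrable_compact) auto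
    have "n * (cmod c / 2) = (\<integral>x. indicator {X..X+n} x *\<^sub>R (cmod c / 2) \<partial>lborel)"
      using n by simp
    also have "\<dots> \<le> (\<integral>x. indicator {0..} x *\<^sub>R cmod (p x) \<partial>lborel)"
      by (intro integral_mono i np[unfolded set_integrable_def])
         (use less_imp_le[OF X0] in \<open>force simp: indicator_def X_def\<close>)
    finally show ?thesis by (simp add: set_lebesgue_integral_def)
  qed
  note b = this
  define I where "I = (LBINT x:{0..}. cmod (p x))"
  have "I \<ge> 0" using b[of 0] unfolding I_def by simp
  \<comment> \<open>An interval of this length would contribute at least \<open>I + 1\<close> to the
    integral \<open>I\<close>.\<close>
  then have "(2 * (I + 1) / cmod c) * (cmod c / 2) \<le> I" unfolding I_def
    by (intro b) (use c in auto)
  then show False using c by simp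
qed

text \<open>The clause of \<open>opP\<close> for a single edge, with \<open>f\<close> standing for
  minus the second derivative of \<open>u\<close>.\<close>

definition H2_edge :: "real set \<Rightarrow> (real \<Rightarrow> complex) \<Rightarrow> (real \<Rightarrow> complex) \<Rightarrow> (real \<Rightarrow> complex) \<Rightarrow> bool" where
  "H2_edge S u du f \<longleftrightarrow> L2_on S u \<and> L2_on S du \<and> L2_on S f \<and>
     (\<forall>x\<in>S. (u has_vector_derivative du x) (at x within S)) \<and>
     (\<forall>x\<in>S. du x = du 0 - (LBINT t:{0..x}. f t))"

lemma H2_edgeD:
  assumes "H2_edge S u du f"
  shows "L2_on S u" "L2_on S du" "L2_on S f"
    and "x \<in> S \<Longrightarrow> (u has_vector_derivative du x) (at x within S)"
    and "x \<in> S \<Longrightarrow> du x = du 0 - (LBINT t:{0..x}. f t)"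
  using assms unfolding H2_edge_def by blast+

lemma H2_edge_subset:
  assumes "H2_edge S u du f" "T \<subseteq> S" "T \<in> sets lborel"
  shows "H2_edge T u du f"
  using assms unfolding H2_edge_def
  by (auto intro: L2_on_subset has_vector_derivative_within_subset)

lemma H2_edge_continuous:
  assumes "H2_edge S u du f" shows "continuous_on S u"
  using assms has_vector_derivative_continuous continuous_on_eq_continuous_within
  unfolding H2_edge_def by blast

lemma H2_edge_deriv_continuous:
  assumes "H2_edge {0..L} u du f" shows "continuous_on {0..L} du"
proof -
  have f: "L1_on {0..L} f"
    using assms L2_on_Icc_integrable unfolding H2_edge_def by blast
  have "continuous_on {0..L} (\<lambda>x. du 0 - (LBINT t:{0..x}. f t))"
    by (intro continuous_intros continuous_on_set_integral_Icc f)
  then show ?thesis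
    by (rule continuous_on_eq) (use assms in \<open>unfold H2_edge_def, metis\<close>)
qed

lemma H2_edge_energy_integrable:
  assumes "H2_edge S u du f"
  shows "L1_on S (\<lambda>x. of_real ((cmod (du x))\<^sup>2) - f x * cnj (u x))"
proof -
  have L: "L2_on S u" "L2_on S du" "L2_on S f" using assms unfolding H2_edge_def by auto
  have "L1_on S (\<lambda>x. du x * cnj (du x) - f x * cnj (u x))"
    by (intro set_integral_diff(1) L2_on_mult_integrable L2_on_cnj L)
  then show ?thesis by (simp add: complex_norm_square[symmetric])
qed

lemma H2_edge_Icc_energy:
  assumes L: "L \<ge> 0" and u: "H2_edge {0..L} u du f"
  shows "(LBINT x:{0..L}. of_real ((cmod (du x))\<^sup>2) - f x * cnj (u x)) = du L * cnj (u L) - du 0 * cnj (u 0)"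
proof -
  have f: "L1_on {0..L} f"
    using u L2_on_Icc_integrable unfolding H2_edge_def by blast
  have "du L * cnj (u L) = du 0 * cnj (u 0) + (LBINT x:{0..L}. du x * cnj (du x) + - f x * cnj (u x))"
  proof (rule AC_integration_by_parts[OF L])
    show "L1_on {0..L} (\<lambda>x. - f x)"
      using set_integrable_mult_right[of "- 1" lborel "{0..L}" f] f by simp
    fix x assume x: "x \<in> {0..L}"
    have "L1_on {0..x} f" by (rule set_integrable_subset[OF f]) (use x in auto)
    then have "(LBINT t:{0..x}. - f t) = - (LBINT t:{0..x}. f t)"
      by (rule set_integral_uminus)
    moreover have "du x = du 0 - (LBINT t:{0..x}. f t)"
      using u x unfolding H2_edge_def by blast
    ultimately show "du x = du 0 + (LBINT t:{0..x}. - f t)" by simp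
    show "((\<lambda>x. cnj (u x)) has_vector_derivative cnj (du x)) (at x within {0..L})"
      using u x unfolding H2_edge_def by (blast intro: has_vector_derivative_cnj)
  next
    show "continuous_on {0..L} (\<lambda>x. cnj (du x))"
      by (intro continuous_intros H2_edge_deriv_continuous[OF u])
  qed
  then show ?thesis by (simp add: complex_norm_square[symmetric])
qed

lemma H2_edge_atLeast_energy:
  assumes u: "H2_edge {0..} u du f"
  shows "(LBINT x:{0..}. of_real ((cmod (du x))\<^sup>2) - f x * cnj (u x)) = - du 0 * cnj (u 0)"
proof -
  let ?q = "\<lambda>x. of_real ((cmod (du x))\<^sup>2) - f x * cnj (u x)"
  have q: "L1_on {0..} ?q" by (rule H2_edge_energy_integrable[OF u])
  have "((\<lambda>y. LBINT x:{0..y}. ?q x) \<longlongrightarrow> (LBINT x:{0..}. ?q x)) at_top"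
    by (rule tendsto_set_lebesgue_integral_at_top[OF _ q]) auto
  then have "((\<lambda>y. du 0 * cnj (u 0) + (LBINT x:{0..y}. ?q x)) \<longlongrightarrow> du 0 * cnj (u 0) + (LBINT x:{0..}. ?q x)) at_top"
    by (intro tendsto_intros)
  moreover have "\<forall>\<^sub>F y in at_top. du 0 * cnj (u 0) + (LBINT x:{0..y}. ?q x) = du y * cnj (u y)"
    using eventually_ge_at_top[of 0]
  proof eventually_elim
    case (elim y)
    have "H2_edge {0..y} u du f" by (rule H2_edge_subset[OF u]) auto
    from H2_edge_Icc_energy[OF elim this] show ?case by simp
  qed
  ultimately have lim: "((\<lambda>y. du y * cnj (u y)) \<longlongrightarrow> du 0 * cnj (u 0) + (LBINT x:{0..}. ?q x)) at_top"
    using tendsto_cong by force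
  have "L1_on {0..} (\<lambda>y. du y * cnj (u y))"
    using u unfolding H2_edge_def by (intro L2_on_mult_integrable L2_on_cnj) auto
  from set_integrable_atLeast_limit_eq_0[OF this lim] show ?thesis
    by (simp add: add_eq_0_iff2 add_eq_0_iff)
qed

text \<open>Every edge, lead or finite, has a vertex at \<open>x = 0\<close>; one map for this end
  merges the first two vertex sums of \<open>opP\<close>.\<close>

definition edge_source :: "nat \<Rightarrow> (nat \<Rightarrow> nat) \<Rightarrow> (nat \<Rightarrow> nat) \<Rightarrow> nat \<Rightarrow> nat" where
  "edge_source K lv iv m = (if m < K then lv m else iv m)"

section \<open>The operator and its vertex conditions\<close>

locale quantum_graph =
  fixes J K M :: nat and lv iv tv :: "nat \<Rightarrow> nat" and l :: "nat \<Rightarrow> real"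
  assumes graph: "qgraph J K M lv iv tv"
    and l_pos: "\<And>m. K \<le> m \<Longrightarrow> m < K + M \<Longrightarrow> l m > 0"
begin

abbreviation "N \<equiv> K + M"
abbreviation "src \<equiv> edge_source K lv iv"
abbreviation "ed \<equiv> edom K l"
abbreviation "opG \<equiv> opP J K M lv iv tv l"
abbreviation "pair \<equiv> gpair K M l"
abbreviation "norm2 \<equiv> gnorm2 K M l"

lemma src_less: "m < N \<Longrightarrow> src m < J"
  using graph unfolding qgraph_def edge_source_def by auto

lemma tv_less: "K \<le> m \<Longrightarrow> m < N \<Longrightarrow> tv m < J"
  using graph unfolding qgraph_def by auto

lemma ed_sets [simp]: "ed m \<in> sets lborel" "ed m \<in> sets borel"
  by (auto simp: edom_def)

text \<open>Continuity is expressed by a function \<open>\<phi>\<close> of vertex values instead of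
  pairwise equality, and the Kirchhoff sums run over all edges with a condition inside. In this form
  they can be weighted with \<open>\<phi>\<close> and exchanged with a sum over the
  vertices.\<close>

definition vertex_conditions :: "(nat \<Rightarrow> complex) \<Rightarrow> (nat \<Rightarrow> real \<Rightarrow> complex) \<Rightarrow> (nat \<Rightarrow> real \<Rightarrow> complex) \<Rightarrow> bool" where
  "vertex_conditions \<phi> u du \<longleftrightarrow>
     (\<forall>m<N. u m 0 = \<phi> (src m)) \<and> (\<forall>m. K \<le> m \<and> m < N \<longrightarrow> u m (l m) = \<phi> (tv m)) \<and>
     (\<forall>v<J. (\<Sum>m<N. if src m = v then - du m 0 else 0) + (\<Sum>m<N. if K \<le> m \<and> tv m = v then du m (l m) else 0) = 0)"

lemma opP_iff:
  "opG u f \<longleftrightarrow>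
     (\<exists>du \<phi>. (\<forall>m<N. H2_edge (ed m) (u m) (du m) (f m)) \<and> vertex_conditions \<phi> u du)"
proof -
  define E where "E v = {(m, 0) | m. m < K \<and> lv m = v} \<union>
      {(m, 0) | m. K \<le> m \<and> m < K + M \<and> iv m = v} \<union>
      {(m, l m) | m. K \<le> m \<and> m < K + M \<and> tv m = v}" for v
  have E1: "(m, 0) \<in> E (src m)" if "m < N" for m
    using that unfolding E_def edge_source_def by auto
  have E2: "(m, l m) \<in> E (tv m)" if "K \<le> m" "m < N" for m
    using that unfolding E_def by auto
  have E3: "(m < N \<and> src m = v \<and> x = 0) \<or> (K \<le> m \<and> m < N \<and> tv m = v \<and> x = l m)" if "(m, x) \<in> E v" for m x v
    using that unfolding E_def edge_source_def by auto
  have cont: "(\<forall>v<J. \<forall>(m, x)\<in>E v. \<forall>(m', x')\<in>E v. u m x = u m' x') \<longleftrightarrow>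
     (\<exists>\<phi>. (\<forall>m<N. u m 0 = \<phi> (src m)) \<and> (\<forall>m. K \<le> m \<and> m < N \<longrightarrow> u m (l m) = \<phi> (tv m)))" (is "?L \<longleftrightarrow> ?R")
  proof
    assume ?L
    then have "\<forall>v. \<exists>y. v < J \<longrightarrow> (\<forall>(m, x)\<in>E v. u m x = y)" 
    proof (intro allI)
      fix v show "\<exists>y. v < J \<longrightarrow> (\<forall>(m, x)\<in>E v. u m x = y)"
      \<comment> \<open>A vertex without incident edges imposes nothing, so any value serves
        there.\<close>
      proof (cases "v < J \<and> E v \<noteq> {}")
        case True
        then obtain m x where "(m, x) \<in> E v" by auto
        with \<open>?L\<close> True have "\<forall>(m', x')\<in>E v. u m' x' = u m x" by fastforce
        then show ?thesis by blast
      qed auto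
    qed
    then obtain \<phi> where "\<forall>v<J. \<forall>(m, x)\<in>E v. u m x = \<phi> v" by metis
    then have \<phi>: "\<And>v m x. v < J \<Longrightarrow> (m, x) \<in> E v \<Longrightarrow> u m x = \<phi> v" by blast
    then show ?R using E1 E2 src_less tv_less by blast
  next
    assume ?R
    then obtain \<phi> where "\<forall>m<N. u m 0 = \<phi> (src m)" "\<forall>m. K \<le> m \<and> m < N \<longrightarrow> u m (l m) = \<phi> (tv m)" by blast
    then have "\<And>v m x. (m, x) \<in> E v \<Longrightarrow> u m x = \<phi> v" using E3 by metis
    then show ?L by fastforce
  qed
  have kir: "(\<Sum>m\<in>{m. m < K \<and> lv m = v}. - du m 0) +
         (\<Sum>m\<in>{m. K \<le> m \<and> m < K + M \<and> iv m = v}. - du m 0) +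
         (\<Sum>m\<in>{m. K \<le> m \<and> m < K + M \<and> tv m = v}. du m (l m)) =
       (\<Sum>m<N. if src m = v then - du m 0 else 0) + (\<Sum>m<N. if K \<le> m \<and> tv m = v then du m (l m) else 0)"
    for v and du :: "nat \<Rightarrow> real \<Rightarrow> complex"
  proof -
    have "(\<Sum>m<N. if src m = v then - du m 0 else 0) = (\<Sum>m\<in>{m\<in>{..<N}. src m = v}. - du m 0)"
      by (rule sum.inter_filter[symmetric]) simp
    also have "{m\<in>{..<N}. src m = v} = {m. m < K \<and> lv m = v} \<union> {m. K \<le> m \<and> m < K + M \<and> iv m = v}"
      by (auto simp: edge_source_def)
    also have "(\<Sum>m\<in>\<dots>. - du m 0) = (\<Sum>m\<in>{m. m < K \<and> lv m = v}. - du m 0) + (\<Sum>m\<in>{m. K \<le> m \<and> m < K + M \<and> iv m = v}. - du m 0)"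
      by (rule sum.union_disjoint) auto
    finally have 1: "(\<Sum>m<N. if src m = v then - du m 0 else 0) = \<dots>" .
    have "(\<Sum>m<N. if K \<le> m \<and> tv m = v then du m (l m) else 0) = (\<Sum>m\<in>{m\<in>{..<N}. K \<le> m \<and> tv m = v}. du m (l m))"
      by (rule sum.inter_filter[symmetric]) simp
    also have "{m\<in>{..<N}. K \<le> m \<and> tv m = v} = {m. K \<le> m \<and> m < K + M \<and> tv m = v}" by auto
    finally show ?thesis unfolding 1 by simp
  qed
  have "opG u f \<longleftrightarrow> (\<exists>du. (\<forall>m<N. H2_edge (ed m) (u m) (du m) (f m)) \<and>
     (\<forall>v<J. \<forall>(m, x)\<in>E v. \<forall>(m', x')\<in>E v. u m x = u m' x') \<and>
     (\<forall>v<J. (\<Sum>m<N. if src m = v then - du m 0 else 0) + (\<Sum>m<N. if K \<le> m \<and> tv m = v then du m (l m) else 0) = 0))"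
    unfolding opP_def Let_def E_def[symmetric] kir H2_edge_def imp_conjR all_conj_distrib ..
  then show ?thesis
    unfolding cont vertex_conditions_def by (simp only: ex_simps[symmetric] conj_ac)
qed

text \<open>Each Kirchhoff condition is weighted with the conjugate vertex value and summed over the
  vertices; after exchanging sums, these are exactly the boundary terms of partial integration on
  all edges.\<close>

lemma kirchhoff_pairing:
  assumes "vertex_conditions \<phi> u du"
  shows "(\<Sum>m<N. (if K \<le> m then du m (l m) * cnj (u m (l m)) else 0) - du m 0 * cnj (u m 0)) = 0"
proof -
  note vc = assms[unfolded vertex_conditions_def]
  have 1: "(\<Sum>v<J. cnj (\<phi> v) * (\<Sum>m<N. if src m = v then - du m 0 else 0)) = (\<Sum>m<N. - du m 0 * cnj (u m 0))"
  proof -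
    have "(\<Sum>v<J. cnj (\<phi> v) * (\<Sum>m<N. if src m = v then - du m 0 else 0)) = (\<Sum>v<J. \<Sum>m<N. if src m = v then - du m 0 * cnj (\<phi> v) else 0)"
      unfolding sum_distrib_left by (intro sum.cong) auto
    also have "\<dots> = (\<Sum>m<N. \<Sum>v<J. if src m = v then - du m 0 * cnj (\<phi> v) else 0)" by (rule sum.swap)
    also have "\<dots> = (\<Sum>m<N. - du m 0 * cnj (u m 0))"
      using vc src_less by (intro sum.cong) auto
    finally show ?thesis .
  qed
  have 2: "(\<Sum>v<J. cnj (\<phi> v) * (\<Sum>m<N. if K \<le> m \<and> tv m = v then du m (l m) else 0)) = (\<Sum>m<N. if K \<le> m then du m (l m) * cnj (u m (l m)) else 0)"
  proof -
    have "(\<Sum>v<J. cnj (\<phi> v) * (\<Sum>m<N. if K \<le> m \<and> tv m = v then du m (l m) else 0)) = (\<Sum>v<J. \<Sum>m<N. if tv m = v then (if K \<le> m then du m (l m) * cnj (\<phi> v) else 0) else 0)"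
      unfolding sum_distrib_left by (intro sum.cong) auto
    also have "\<dots> = (\<Sum>m<N. \<Sum>v<J. if tv m = v then (if K \<le> m then du m (l m) * cnj (\<phi> v) else 0) else 0)" by (rule sum.swap)
    also have "\<dots> = (\<Sum>m<N. if K \<le> m then du m (l m) * cnj (u m (l m)) else 0)"
      using vc tv_less by (intro sum.cong) auto
    finally show ?thesis .
  qed
  have "0 = (\<Sum>v<J. cnj (\<phi> v) * ((\<Sum>m<N. if src m = v then - du m 0 else 0) + (\<Sum>m<N. if K \<le> m \<and> tv m = v then du m (l m) else 0)))"
    using vc by (intro sum.neutral[symmetric]) auto
  also have "\<dots> = (\<Sum>m<N. - du m 0 * cnj (u m 0)) + (\<Sum>m<N. if K \<le> m then du m (l m) * cnj (u m (l m)) else 0)"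
    unfolding distrib_left sum.distrib 1 2 by simp
  also have "\<dots> = (\<Sum>m<N. (if K \<le> m then du m (l m) * cnj (u m (l m)) else 0) - du m 0 * cnj (u m 0))"
    unfolding sum.distrib[symmetric] by (intro sum.cong) auto
  finally show ?thesis by simp
qed

text \<open>\<open>T\<close> is the Dirichlet integral of \<open>u\<close>. That it is real gives
  the resolvent bound; that it is nonnegative also excludes solutions for \<open>k\<close> on the
  positive imaginary axis.\<close>

lemma energy_identity:
  assumes "opG u f"
  obtains T where "T \<ge> 0" "pair f u = complex_of_real T"
proof -
  obtain du \<phi> where H: "\<And>m. m < N \<Longrightarrow> H2_edge (ed m) (u m) (du m) (f m)" and vc: "vertex_conditions \<phi> u du"
    using assms unfolding opP_iff by blast
  define T where "T = (\<Sum>m<N. LBINT x:ed m. (cmod (du m x))\<^sup>2)"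
  have "T \<ge> 0" unfolding T_def
    by (intro sum_nonneg) (auto simp: set_lebesgue_integral_def intro!: integral_nonneg_AE)
  have "(LBINT x:ed m. of_real ((cmod (du m x))\<^sup>2)) - (LBINT x:ed m. f m x * cnj (u m x)) =
     (if K \<le> m then du m (l m) * cnj (u m (l m)) else 0) - du m 0 * cnj (u m 0)" if m: "m < N" for m
  proof -
    have L: "L2_on (ed m) (u m)" "L2_on (ed m) (du m)" "L2_on (ed m) (f m)"
      using H[OF m] unfolding H2_edge_def by auto
    have "(LBINT x:ed m. of_real ((cmod (du m x))\<^sup>2)) - (LBINT x:ed m. f m x * cnj (u m x)) =
      (LBINT x:ed m. du m x * cnj (du m x)) - (LBINT x:ed m. f m x * cnj (u m x))"
      by (simp add: complex_norm_square[symmetric])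
    also have "\<dots> = (LBINT x:ed m. du m x * cnj (du m x) - f m x * cnj (u m x))"
      by (intro set_integral_diff(2)[symmetric] L2_on_mult_integrable L2_on_cnj L)
    also have "\<dots> = (LBINT x:ed m. of_real ((cmod (du m x))\<^sup>2) - f m x * cnj (u m x))"
      by (simp add: complex_norm_square[symmetric])
    also have "\<dots> = (if K \<le> m then du m (l m) * cnj (u m (l m)) else 0) - du m 0 * cnj (u m 0)"
    proof (cases "K \<le> m")
      case True
      then have "ed m = {0..l m}" by (simp add: edom_def)
      then show ?thesis
        using H2_edge_Icc_energy[of "l m" "u m" "du m" "f m"] H[OF m] l_pos[OF True m] True by simp
    next
      case False
      then have "ed m = {0..}" by (simp add: edom_def)
      then show ?thesis
        using H2_edge_atLeast_energy[of "u m" "du m" "f m"] H[OF m] False by simp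
    qed
    finally show ?thesis .
  qed
  then have "(\<Sum>m<N. (LBINT x:ed m. of_real ((cmod (du m x))\<^sup>2)) - (LBINT x:ed m. f m x * cnj (u m x))) = 0"
    using kirchhoff_pairing[OF vc] by simp
  then have "pair f u = (\<Sum>m<N. LBINT x:ed m. of_real ((cmod (du m x))\<^sup>2))"
    unfolding gpair_def sum_subtractf by simp
  also have "\<dots> = complex_of_real T"
    unfolding T_def of_real_sum by (intro sum.cong refl set_integral_complex_of_real)
  finally show ?thesis using that \<open>T \<ge> 0\<close> by blast
qed

end

text \<open>For positive \<open>A\<close> and \<open>B\<close> the right-hand side is smallest at
  \<open>s = sqrt B / sqrt A\<close>, where it equals \<open>2 * sqrt (A * B)\<close>. If one of
  them vanishes, no minimum need exist, and a suitable weight shows \<open>X = 0\<close>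
  directly.\<close>

lemma le_weighted_imp_square_le:
  fixes X A B :: real
  assumes "A \<ge> 0" "B \<ge> 0" "X \<ge> 0" and le: "\<And>s. s > 0 \<Longrightarrow> 2 * X \<le> s * A + B / s"
  shows "X\<^sup>2 \<le> A * B"
proof (cases "A = 0 \<or> B = 0")
  case False
  then have AB: "A > 0" "B > 0" using assms by auto
  define s where "s = sqrt B / sqrt A"
  have "s * A = sqrt B * sqrt A" unfolding s_def using AB
    by (metis less_imp_le real_div_sqrt times_divide_eq_left times_divide_eq_right)
  moreover have "B / s = sqrt B * sqrt A" unfolding s_def using AB
    by (metis divide_divide_eq_right less_imp_le real_div_sqrt times_divide_eq_left)
  moreover have "s > 0" unfolding s_def using AB by simp
  ultimately have "X \<le> sqrt B * sqrt A" using le[of s] by linarith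
  then have "X\<^sup>2 \<le> (sqrt B * sqrt A)\<^sup>2" using assms by (intro power_mono) auto
  also have "\<dots> = A * B" using AB by (simp add: power_mult_distrib)
  finally show ?thesis .
next
  case True
  have "X = 0"
  proof (rule ccontr)
    assume "X \<noteq> 0"
    then have X: "X > 0" using assms by simp
    show False
    proof (cases "A = 0")
      case True
      \<comment> \<open>This weight makes the second term smaller than \<open>X\<close>; the added 1
        keeps it positive when \<open>B = 0\<close>.\<close>
      have "2 * X \<le> B / ((B + 1) / X)" using le[of "(B + 1) / X"] True X assms by simp
      also have "\<dots> = X * (B / (B + 1))" by simp
      also have "\<dots> \<le> X * 1" using X assms by (intro mult_left_mono) (auto simp: field_simps)
      finally show False using X by simp
    next
      case False
      then have B: "B = 0" using \<open>A = 0 \<or> B = 0\<close> by simp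
      have "2 * X \<le> X / A * A" using le[of "X / A"] B False X assms by simp
      then show False using X False by simp
    qed
  qed
  then show ?thesis using True by auto
qed

section \<open>The resolvent equation: a priori bound and uniqueness\<close>

context quantum_graph
begin

definition graph_L2 :: "(nat \<Rightarrow> real \<Rightarrow> complex) \<Rightarrow> bool" where
  "graph_L2 u \<longleftrightarrow> (\<forall>m<N. L2_on (ed m) (u m))"

lemma opP_graph_L2: "opG u f \<Longrightarrow> graph_L2 u" "opG u f \<Longrightarrow> graph_L2 f"
  unfolding opP_iff H2_edge_def graph_L2_def by auto

lemma gnorm2_nonneg: "norm2 u \<ge> 0"
  unfolding gnorm2_def
  by (intro sum_nonneg) (auto simp: set_lebesgue_integral_def intro!: integral_nonneg_AE)

lemma gpair_self: "pair u u = of_real (norm2 u)"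
  unfolding gpair_def gnorm2_def of_real_sum
  by (intro sum.cong refl) (simp add: complex_norm_square[symmetric] set_integral_complex_of_real[symmetric])

lemma gpair_add_cmult:
  assumes "graph_L2 u" "graph_L2 v" "graph_L2 g"
  shows "pair (\<lambda>m x. u m x + c * v m x) g = pair u g + c * pair v g"
proof -
  have "(LBINT x:ed m. (u m x + c * v m x) * cnj (g m x)) =
     (LBINT x:ed m. u m x * cnj (g m x)) + c * (LBINT x:ed m. v m x * cnj (g m x))" if m: "m < N" for m
  proof -
    have i: "L1_on (ed m) (\<lambda>x. u m x * cnj (g m x))" "L1_on (ed m) (\<lambda>x. v m x * cnj (g m x))"
      using assms m unfolding graph_L2_def by (auto intro!: L2_on_mult_integrable L2_on_cnj)
    have "(LBINT x:ed m. (u m x + c * v m x) * cnj (g m x)) = (LBINT x:ed m. u m x * cnj (g m x) + c * (v m x * cnj (g m x)))"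
      by (simp add: algebra_simps)
    also have "\<dots> = (LBINT x:ed m. u m x * cnj (g m x)) + (LBINT x:ed m. c * (v m x * cnj (g m x)))"
      using i by (intro set_integral_add(2)) auto
    finally show ?thesis by simp
  qed
  then show ?thesis unfolding gpair_def by (simp add: sum.distrib sum_distrib_left)
qed

text \<open>A common weight \<open>s\<close> on all edges makes the edgewise estimates additive; it
  is optimised only after summation.\<close>

lemma gpair_cauchy_schwarz:
  assumes u: "graph_L2 u" and g: "graph_L2 g"
  shows "(cmod (pair u g))\<^sup>2 \<le> norm2 u * norm2 g"
proof (rule le_weighted_imp_square_le)
  fix s :: real assume s: "s > 0"
  have "cmod (LBINT x:ed m. u m x * cnj (g m x)) \<le>
     (s * (LBINT x:ed m. (cmod (u m x))\<^sup>2) + (LBINT x:ed m. (cmod (g m x))\<^sup>2) / s) / 2" if m: "m < N" for m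
  proof -
    have L: "L2_on (ed m) (u m)" "L2_on (ed m) (g m)" using u g m unfolding graph_L2_def by auto
    note i = L[THEN L2_on_square_integrable]
    have int: "L1_on (ed m) (\<lambda>x. u m x * cnj (g m x))"
      by (intro L2_on_mult_integrable L2_on_cnj L)
    have "cmod (LBINT x:ed m. u m x * cnj (g m x)) \<le> (LBINT x:ed m. cmod (u m x * cnj (g m x)))"
      using integral_norm_bound[of lborel "\<lambda>x. indicator (ed m) x *\<^sub>R (u m x * cnj (g m x))"]
      by (simp add: set_lebesgue_integral_def)
    also have "\<dots> \<le> (LBINT x:ed m. (s * (cmod (u m x))\<^sup>2 + (cmod (g m x))\<^sup>2 / s) / 2)"
    proof (rule set_integral_mono)
      show "L1_on (ed m) (\<lambda>x. cmod (u m x * cnj (g m x)))"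
        using int unfolding set_integrable_def by (auto dest: integrable_norm)
      show "L1_on (ed m) (\<lambda>x. (s * (cmod (u m x))\<^sup>2 + (cmod (g m x))\<^sup>2 / s) / 2)"
        using i by (intro set_integrable_divide set_integral_add(1) set_integrable_mult_right) auto
      show "cmod (u m x * cnj (g m x)) \<le> (s * (cmod (u m x))\<^sup>2 + (cmod (g m x))\<^sup>2 / s) / 2" for x
        using norm_mult_le_weighted[OF s, of "u m x" "cnj (g m x)"] by simp
    qed
    also have "\<dots> = ((LBINT x:ed m. s * (cmod (u m x))\<^sup>2) + (LBINT x:ed m. (cmod (g m x))\<^sup>2 / s)) / 2"
      using i by (simp add: set_integral_add(2) set_integrable_mult_right set_integrable_divide)
    finally show ?thesis by simp
  qed
  then have "cmod (pair u g) \<le> (\<Sum>m<N. (s * (LBINT x:ed m. (cmod (u m x))\<^sup>2) + (LBINT x:ed m. (cmod (g m x))\<^sup>2) / s) / 2)"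
    unfolding gpair_def by (intro sum_norm_le) auto
  also have "\<dots> = (s * norm2 u + norm2 g / s) / 2"
    unfolding gnorm2_def by (simp add: sum.distrib sum_distrib_left sum_divide_distrib add_divide_distrib)
  finally show "2 * cmod (pair u g) \<le> s * norm2 u + norm2 g / s" by simp
qed (auto simp: gnorm2_nonneg)

text \<open>The condition inside the definite description of \<open>res_elem\<close>, isolated as a
  linear relation between \<open>f\<close> and \<open>u\<close>.\<close>

definition resolves :: "complex \<Rightarrow> (nat \<Rightarrow> real \<Rightarrow> complex) \<Rightarrow> (nat \<Rightarrow> real \<Rightarrow> complex) \<Rightarrow> bool" where
  "resolves k f u \<longleftrightarrow> (\<exists>h. opG u h \<and>
     (\<forall>m<N. AE x in lborel. x \<in> ed m \<longrightarrow> h m x - k\<^sup>2 * u m x = f m x))"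

lemma H2_edge_add_cmult:
  assumes u: "H2_edge (ed m) u du f" and v: "H2_edge (ed m) v dv g"
  shows "H2_edge (ed m) (\<lambda>x. u x + c * v x) (\<lambda>x. du x + c * dv x) (\<lambda>x. f x + c * g x)"
proof -
  note U = u[unfolded H2_edge_def] and V = v[unfolded H2_edge_def]
  have "du x + c * dv x = (du 0 + c * dv 0) - (LBINT t:{0..x}. f t + c * g t)" if x: "x \<in> ed m" for x
  proof -
    have "{0..x} \<subseteq> ed m" using x by (auto simp: edom_def split: if_splits)
    then have L: "L2_on {0..x} f" "L2_on {0..x} g"
      using U V by (auto intro: L2_on_subset)
    then have "(LBINT t:{0..x}. f t + c * g t) = (LBINT t:{0..x}. f t) + c * (LBINT t:{0..x}. g t)"
      by (simp add: L2_on_Icc_integrable set_integral_add(2))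
    moreover have "du x = du 0 - (LBINT t:{0..x}. f t)" "dv x = dv 0 - (LBINT t:{0..x}. g t)"
      using U V x by blast+
    ultimately show ?thesis by (simp only: ring_distribs) (simp only: add_ac diff_conv_add_uminus minus_add_distrib)
  qed
  moreover have "((\<lambda>x. u x + c * v x) has_vector_derivative du x + c * dv x) (at x within ed m)" if x: "x \<in> ed m" for x
    using U V x by (intro has_vector_derivative_add has_vector_derivative_mult_right) blast+
  moreover have "L2_on (ed m) (\<lambda>x. u x + c * v x)" "L2_on (ed m) (\<lambda>x. du x + c * dv x)" "L2_on (ed m) (\<lambda>x. f x + c * g x)"
    using U V by (intro L2_on_add L2_on_cmult; blast)+
  ultimately show ?thesis
    unfolding H2_edge_def by (intro conjI ballI)
qed

lemma opP_add_cmult: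
  assumes "opG u f" "opG v g"
  shows "opG (\<lambda>m x. u m x + c * v m x) (\<lambda>m x. f m x + c * g m x)"
proof -
  obtain du \<phi> where u: "\<forall>m<N. H2_edge (ed m) (u m) (du m) (f m)" "vertex_conditions \<phi> u du"
    using assms(1) unfolding opP_iff by blast
  obtain dv \<psi> where v: "\<forall>m<N. H2_edge (ed m) (v m) (dv m) (g m)" "vertex_conditions \<psi> v dv"
    using assms(2) unfolding opP_iff by blast
  have "vertex_conditions (\<lambda>w. \<phi> w + c * \<psi> w) (\<lambda>m x. u m x + c * v m x) (\<lambda>m x. du m x + c * dv m x)"
    unfolding vertex_conditions_def
  proof (intro conjI allI impI)
    fix w assume w: "w < J"
    let ?S = "\<lambda>du. (\<Sum>m<N. if src m = w then - du m 0 else 0) + (\<Sum>m<N. if K \<le> m \<and> tv m = w then du m (l m) else 0)"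
    have "?S (\<lambda>m x. du m x + c * dv m x) = ?S du + c * ?S dv"
    proof -
      have "(\<Sum>m<N. if src m = w then - (du m 0 + c * dv m 0) else 0) = (\<Sum>m<N. (if src m = w then - du m 0 else 0) + c * (if src m = w then - dv m 0 else 0))"
        by (intro sum.cong) auto
      moreover have "(\<Sum>m<N. if K \<le> m \<and> tv m = w then du m (l m) + c * dv m (l m) else 0) = (\<Sum>m<N. (if K \<le> m \<and> tv m = w then du m (l m) else 0) + c * (if K \<le> m \<and> tv m = w then dv m (l m) else 0))"
        by (intro sum.cong) auto
      ultimately show ?thesis by (simp add: sum.distrib sum_distrib_left algebra_simps)
    qed
    also have "\<dots> = 0" using u(2) v(2) w unfolding vertex_conditions_def by simp
    finally show "?S (\<lambda>m x. du m x + c * dv m x) = 0" .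
  qed (use u(2) v(2) in \<open>auto simp: vertex_conditions_def\<close>)
  moreover have "\<forall>m<N. H2_edge (ed m) (\<lambda>x. u m x + c * v m x) (\<lambda>x. du m x + c * dv m x) (\<lambda>x. f m x + c * g m x)"
    using u(1) v(1) H2_edge_add_cmult by blast
  ultimately show ?thesis unfolding opP_iff by (intro exI conjI)
qed

lemma resolves_add_cmult:
  assumes "resolves k f u" "resolves k g v"
  shows "resolves k (\<lambda>m x. f m x + c * g m x) (\<lambda>m x. u m x + c * v m x)"
proof -
  obtain h where h: "opG u h" "\<And>m. m < N \<Longrightarrow> AE x in lborel. x \<in> ed m \<longrightarrow> h m x - k\<^sup>2 * u m x = f m x"
    using assms(1) unfolding resolves_def by blast
  obtain h' where h': "opG v h'" "\<And>m. m < N \<Longrightarrow> AE x in lborel. x \<in> ed m \<longrightarrow> h' m x - k\<^sup>2 * v m x = g m x"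
    using assms(2) unfolding resolves_def by blast
  have "AE x in lborel. x \<in> ed m \<longrightarrow> (h m x + c * h' m x) - k\<^sup>2 * (u m x + c * v m x) = f m x + c * g m x" if "m < N" for m
    using h(2)[OF that] h'(2)[OF that]
  proof eventually_elim
    case (elim x)
    show ?case
    proof
      assume "x \<in> ed m"
      with elim have "f m x = h m x - k\<^sup>2 * u m x" "g m x = h' m x - k\<^sup>2 * v m x" by auto
      then show "(h m x + c * h' m x) - k\<^sup>2 * (u m x + c * v m x) = f m x + c * g m x"
        by (simp only:) (simp add: algebra_simps)
    qed
  qed
  then show ?thesis using opP_add_cmult[OF h(1) h'(1), of c] unfolding resolves_def by blast
qed

lemma resolves_energy:
  assumes "resolves k f u" and f: "graph_L2 f"
  obtains T where "T \<ge> 0" "pair f u + k\<^sup>2 * of_real (norm2 u) = complex_of_real T"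
proof -
  obtain h where h: "opG u h" "\<And>m. m < N \<Longrightarrow> AE x in lborel. x \<in> ed m \<longrightarrow> h m x - k\<^sup>2 * u m x = f m x"
    using assms(1) unfolding resolves_def by blast
  obtain T where T: "T \<ge> 0" "pair h u = complex_of_real T"
    using energy_identity[OF h(1)] by blast
  have u: "graph_L2 u" and hL: "graph_L2 h" using opP_graph_L2 h(1) by auto
  have "pair h u = pair (\<lambda>m x. f m x + k\<^sup>2 * u m x) u"
    unfolding gpair_def
  proof (rule sum.cong[OF refl])
    fix m assume "m \<in> {..<N}"
    then have m: "m < N" by simp
    have L: "L2_on (ed m) (f m)" "L2_on (ed m) (u m)" "L2_on (ed m) (h m)"
      using f u hL m unfolding graph_L2_def by auto
    show "(LBINT x:ed m. h m x * cnj (u m x)) = (LBINT x:ed m. (f m x + k\<^sup>2 * u m x) * cnj (u m x))"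
      unfolding set_lebesgue_integral_def
    proof (rule integral_cong_AE)
      show "(\<lambda>x. indicator (ed m) x *\<^sub>R (h m x * cnj (u m x))) \<in> borel_measurable lborel"
        "(\<lambda>x. indicator (ed m) x *\<^sub>R ((f m x + k\<^sup>2 * u m x) * cnj (u m x))) \<in> borel_measurable lborel"
        by (intro L2_on_mult_measurable L2_on_cnj L2_on_add L2_on_cmult L)+
      show "AE x in lborel. indicator (ed m) x *\<^sub>R (h m x * cnj (u m x)) = indicator (ed m) x *\<^sub>R ((f m x + k\<^sup>2 * u m x) * cnj (u m x))"
        using h(2)[OF m] by eventually_elim (auto simp: indicator_def algebra_simps)
    qed
  qed
  also have "\<dots> = pair f u + k\<^sup>2 * pair u u"
    by (rule gpair_add_cmult[OF f u u])
  finally show ?thesis using that[OF T(1)] T(2) by (simp add: gpair_self)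
qed

text \<open>The imaginary part of the energy identity reads
  \<open>Im (pair f u) = - Im (k\<^sup>2) * norm2 u\<close>. Cauchy-Schwarz on the left bounds
  \<open>u\<close> by \<open>f\<close>, and a second application bounds the pairing with
  \<open>g\<close>. Everything is kept squared to avoid roots of \<open>norm2\<close>.\<close>

lemma resolves_bound:
  assumes r: "resolves k f u" and f: "graph_L2 f" and g: "graph_L2 g"
  shows "(Im (k\<^sup>2))\<^sup>2 * (cmod (pair u g))\<^sup>2 \<le> norm2 f * norm2 g"
proof -
  have u: "graph_L2 u" using r opP_graph_L2 unfolding resolves_def by blast
  obtain T where T: "T \<ge> 0" "pair f u + k\<^sup>2 * of_real (norm2 u) = complex_of_real T"
    using resolves_energy[OF r f] .
  define X where "X = norm2 u"
  have X: "X \<ge> 0" unfolding X_def by (rule gnorm2_nonneg)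
  have "Im (pair f u + k\<^sup>2 * of_real X) = 0" using T(2) by (simp add: X_def)
  then have "Im (pair f u) = - (Im (k\<^sup>2) * X)" by simp
  then have "(Im (k\<^sup>2) * X)\<^sup>2 \<le> (cmod (pair f u))\<^sup>2"
    using power_mono[OF abs_Im_le_cmod[of "pair f u"], of 2] by simp
  also have "\<dots> \<le> norm2 f * X" unfolding X_def by (rule gpair_cauchy_schwarz[OF f u])
  finally have "(Im (k\<^sup>2))\<^sup>2 * X * X \<le> norm2 f * X" by (simp add: power2_eq_square algebra_simps)
  \<comment> \<open>One factor \<open>X\<close> is cancelled; for \<open>X = 0\<close> the claim is
    the nonnegativity of \<open>norm2 f\<close>.\<close>
  then have 1: "(Im (k\<^sup>2))\<^sup>2 * X \<le> norm2 f"
    using X gnorm2_nonneg[of f] by (cases "X = 0") (auto simp: mult_le_cancel_right)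
  have "(Im (k\<^sup>2))\<^sup>2 * (cmod (pair u g))\<^sup>2 \<le> (Im (k\<^sup>2))\<^sup>2 * (X * norm2 g)"
    unfolding X_def by (intro mult_left_mono gpair_cauchy_schwarz u g) auto
  also have "\<dots> \<le> norm2 f * norm2 g"
    using mult_right_mono[OF 1 gnorm2_nonneg[of g]] by (simp add: mult.assoc)
  finally show ?thesis .
qed

text \<open>For zero data and a solution of positive norm the energy identity makes
  \<open>k\<^sup>2\<close> a nonnegative real number, impossible in the upper half-plane. Unlike
  \<open>resolves_bound\<close>, this also covers the imaginary axis, hence the reference point
  \<open>\<i>\<close>.\<close>

lemma resolves_zero_imp_gnorm2_0:
  assumes r: "resolves k (\<lambda>m x. 0) u" and k: "Im k > 0"
  shows "norm2 u = 0"
proof (rule ccontr)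
  define X where "X = norm2 u"
  assume "norm2 u \<noteq> 0"
  then have X: "X > 0" using gnorm2_nonneg[of u] unfolding X_def by simp
  have "graph_L2 (\<lambda>m x. 0)" by (simp add: graph_L2_def L2_on_def)
  then obtain T where T: "T \<ge> 0" "pair (\<lambda>m x. 0) u + k\<^sup>2 * of_real X = complex_of_real T"
    unfolding X_def using resolves_energy[OF r] by blast
  have "pair (\<lambda>m x. 0) u = 0" by (simp add: gpair_def)
  then have kk: "k\<^sup>2 = of_real (T / X)" using T X by (simp add: field_simps)
  then have "Im (k\<^sup>2) = 0" "Re (k\<^sup>2) \<ge> 0" using T X by (simp_all only: Im_complex_of_real Re_complex_of_real) simp
  then have "Re k = 0" "(Re k)\<^sup>2 - (Im k)\<^sup>2 \<ge> 0" using k by (auto simp: power2_eq_square)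
  then show False using k by simp
qed

lemma resolves_graph_L2: "resolves k f u \<Longrightarrow> graph_L2 u"
  using opP_graph_L2 unfolding resolves_def by blast

text \<open>Only the norm of the difference of two solutions is shown to vanish; pairings see no
  more than that, so \<open>res_elem\<close> is well defined.\<close>

lemma resolves_gpair_unique:
  assumes "resolves k f u" "resolves k f v" "Im k > 0" "graph_L2 g"
  shows "pair u g = pair v g"
proof -
  have uv: "graph_L2 u" "graph_L2 v" using assms resolves_graph_L2 by auto
  let ?w = "\<lambda>m x. u m x + (- 1) * v m x"
  have "resolves k (\<lambda>m x. f m x + (- 1) * f m x) ?w" by (rule resolves_add_cmult[OF assms(1,2)])
  then have w: "resolves k (\<lambda>m x. 0) ?w" by simp
  have "(cmod (pair ?w g))\<^sup>2 \<le> norm2 ?w * norm2 g"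
    by (rule gpair_cauchy_schwarz[OF resolves_graph_L2[OF w] assms(4)])
  also have "\<dots> = 0" using resolves_zero_imp_gnorm2_0[OF w assms(3)] by simp
  finally have "pair ?w g = 0" by simp
  then show ?thesis using gpair_add_cmult[OF uv assms(4), of "- 1"] by simp
qed

lemma res_elem_eq:
  assumes "resolves k f u" "Im k > 0" "graph_L2 g"
  shows "res_elem J K M lv iv tv l k f g = pair u g"
  unfolding res_elem_def
proof (rule the_equality)
  show "\<exists>u' h. opG u' h \<and>
        (\<forall>m<K+M. AE x in lborel. x \<in> edom K l m \<longrightarrow> h m x - k\<^sup>2 * u' m x = f m x) \<and>
        pair u g = pair u' g"
    using assms(1) unfolding resolves_def by blast
  fix w assume "\<exists>u' h. opG u' h \<and>
        (\<forall>m<K+M. AE x in lborel. x \<in> edom K l m \<longrightarrow> h m x - k\<^sup>2 * u' m x = f m x) \<and>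
        w = pair u' g"
  then obtain u' where "resolves k f u'" "w = pair u' g" unfolding resolves_def by blast
  then show "w = pair u g" using resolves_gpair_unique[OF _ assms] by simp
qed

end

section \<open>Solutions on edges and on the graph\<close>

text \<open>Variation of constants.  The factor \<open>i / (2 k)\<close> is pulled out of the solution so that
  the amplitudes solve a linear system whose coefficients and data are entire in \<open>k\<close>.\<close>

abbreviation "wave k x \<equiv> exp (\<i> * k * complex_of_real x)"
abbreviation "wave' k x \<equiv> exp (- \<i> * k * complex_of_real x)"

definition expint :: "complex \<Rightarrow> (real \<Rightarrow> complex) \<Rightarrow> real \<Rightarrow> complex" where
  "expint k f x = (LBINT t:{0..x}. wave k t * f t)"

text \<open>Convolutions of \<open>f\<close> over \<open>{0..x}\<close> with
  \<open>exp (i k x)\<close> and \<open>exp (- i k x)\<close>.\<close>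

abbreviation "inc k f x \<equiv> expint (- k) f x * wave k x"
abbreviation "out k f x \<equiv> expint k f x * wave' k x"

definition edge_sol :: "complex \<Rightarrow> complex \<Rightarrow> complex \<Rightarrow> (real \<Rightarrow> complex) \<Rightarrow> real \<Rightarrow> complex" where
  "edge_sol k a b f x = \<i> / (2 * k) * ((a + expint (- k) f x) * wave k x +
     (b - expint k f x) * wave' k x)"

text \<open>The formal derivative of \<open>edge_sol\<close>: the contributions \<open>f\<close> and
  \<open>- f\<close> from differentiating the two integrals cancel, and
  \<open>\<i> / (2 * k)\<close> times \<open>\<i> * k\<close> is \<open>- 1 / 2\<close>.\<close>

definition edge_dsol :: "complex \<Rightarrow> complex \<Rightarrow> complex \<Rightarrow> (real \<Rightarrow> complex) \<Rightarrow> real \<Rightarrow> complex" where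
  "edge_dsol k a b f x = - 1 / 2 * ((a + expint (- k) f x) * wave k x -
     (b - expint k f x) * wave' k x)"

lemma expint_0 [simp]: "expint k f 0 = 0"
  by (simp add: expint_def set_lebesgue_integral_def)
     (rule integral_eq_zero_AE, use AE_lborel_singleton[of "0::real"] in eventually_elim, auto)

lemma expint_zero_fun [simp]: "expint k (\<lambda>x. 0) x = 0"
  by (simp add: expint_def)

lemma expint_integrable:
  assumes "L1_on {0..L} f"
  shows "L1_on {0..L} (\<lambda>t. wave k t * f t)"
  using set_integrable_mult_continuous[OF assms, of "\<lambda>t. wave k t"]
  by (simp add: mult.commute continuous_intros)

lemma continuous_on_expint:
  assumes "L1_on {0..L} f"
  shows "continuous_on {0..L} (expint k f)"
  unfolding expint_def by (intro continuous_on_set_integral_Icc expint_integrable assms)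

text \<open>As \<open>f\<close> is merely integrable, the first-order equation for each wave is
  stated in integrated form. The parameter \<open>s\<close> covers both waves: \<open>s = 1\<close>
  with \<open>k\<close>, and \<open>s = - 1\<close> with \<open>- k\<close>.\<close>

lemma expint_by_parts:
  assumes L: "L \<ge> 0" and f: "L1_on {0..L} f"
  shows "(a + s * expint (- k) f L) * wave k L =
     a + (LBINT x:{0..L}. (a + s * expint (- k) f x) * (\<i> * k * wave k x) + s * f x)"
proof -
  have "(a + s * expint (- k) f L) * wave k L = (a + s * expint (- k) f 0) * wave k 0 +
    (LBINT x:{0..L}. (a + s * expint (- k) f x) * (\<i> * k * wave k x) +
       (s * (exp (\<i> * - k * of_real x) * f x)) * wave k x)"
  proof (rule AC_integration_by_parts[OF L])
    show "L1_on {0..L} (\<lambda>x. s * (exp (\<i> * - k * of_real x) * f x))"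
      by (intro set_integrable_mult_right expint_integrable f)
    show "a + s * expint (- k) f x = a + s * expint (- k) f 0 + (LBINT t:{0..x}. s * (exp (\<i> * - k * of_real t) * f t))" for x
      unfolding expint_0 by (simp add: expint_def)
    show "((\<lambda>x. wave k x) has_vector_derivative \<i> * k * wave k x) (at x within {0..L})" for x
    proof -
      have "((\<lambda>z. exp (\<i> * k * z)) has_field_derivative \<i> * k * wave k x) (at (of_real x))"
        by (auto intro!: derivative_eq_intros)
      from has_vector_derivative_real_field[OF this] show ?thesis
        by (rule has_vector_derivative_at_within)
    qed
    show "continuous_on {0..L} (\<lambda>x. \<i> * k * wave k x)"
      by (intro continuous_intros)
  qed
  moreover have "(s * (exp (\<i> * - k * of_real x) * f x)) * wave k x = s * f x" for x
    by (simp add: exp_minus field_simps)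
  ultimately show ?thesis by (simp only: expint_0) simp
qed

text \<open>The summands satisfy \<open>P' = i k P + f\<close> and \<open>Q' = - i k Q - f\<close>
  in integrated form. The source cancels in the sum, which is the solution, and adds up in the
  difference, which is its derivative.\<close>

lemma edge_sol_integral:
  assumes k: "k \<noteq> 0" and L: "L \<ge> 0" and f: "L1_on {0..L} f"
  shows "edge_sol k a b f L = edge_sol k a b f 0 + (LBINT x:{0..L}. edge_dsol k a b f x)"
    and "edge_dsol k a b f L = edge_dsol k a b f 0 - (LBINT x:{0..L}. f x + k\<^sup>2 * edge_sol k a b f x)"
proof -
  define P where "P x = (a + expint (- k) f x) * wave k x" for x :: real
  define Q where "Q x = (b - expint k f x) * wave' k x" for x :: real
  have ci: "L1_on {0..L} f" if "continuous_on {0..L} f" for f :: "real \<Rightarrow> complex"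
    unfolding set_integrable_def using borel_integrable_compact[OF _ that] by simp
  have PQ: "L1_on {0..L} P" "L1_on {0..L} Q"
    unfolding P_def Q_def by (intro ci continuous_intros continuous_on_expint f)+
  have iP: "L1_on {0..L} (\<lambda>x. \<i> * k * P x)" "L1_on {0..L} (\<lambda>x. - (\<i> * k) * Q x)"
    by (intro set_integrable_mult_right PQ)+
  have "P L = a + (LBINT x:{0..L}. (a + 1 * expint (- k) f x) * (\<i> * k * wave k x) + 1 * f x)"
    using expint_by_parts[OF L f, of a 1 k] by (simp add: P_def)
  also have "\<dots> = a + (LBINT x:{0..L}. \<i> * k * P x + f x)"
    by (simp add: P_def algebra_simps)
  also have "\<dots> = a + (\<i> * k * (LBINT x:{0..L}. P x) + (LBINT x:{0..L}. f x))"
    using set_integral_add(2)[OF iP(1) f] by simp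
  finally have PL: "P L = a + (\<i> * k * (LBINT x:{0..L}. P x) + (LBINT x:{0..L}. f x))" .
  have "Q L = b + (LBINT x:{0..L}. (b + (- 1) * expint (- (- k)) f x) * (\<i> * (- k) * exp (\<i> * (- k) * of_real x)) + (- 1) * f x)"
    using expint_by_parts[OF L f, of b "- 1" "- k"] by (simp add: Q_def)
  also have "\<dots> = b + (LBINT x:{0..L}. - (\<i> * k) * Q x - f x)"
    by (simp add: Q_def algebra_simps)
  also have "\<dots> = b + (- (\<i> * k) * (LBINT x:{0..L}. Q x) - (LBINT x:{0..L}. f x))"
    using set_integral_diff(2)[OF iP(2) f] by (simp only: set_integral_mult_right)
  finally have QL: "Q L = b + (- (\<i> * k) * (LBINT x:{0..L}. Q x) - (LBINT x:{0..L}. f x))" .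
  have sol: "edge_sol k a b f = (\<lambda>x. \<i> / (2 * k) * P x + \<i> / (2 * k) * Q x)"
    and dsol: "edge_dsol k a b f = (\<lambda>x. 1 / 2 * Q x - 1 / 2 * P x)"
    unfolding edge_sol_def edge_dsol_def P_def Q_def by (auto simp: fun_eq_iff algebra_simps)
  have P0: "P 0 = a" "Q 0 = b" by (simp_all add: P_def Q_def)
  have D: "(LBINT x:{0..L}. edge_dsol k a b f x) = 1 / 2 * (LBINT x:{0..L}. Q x) - 1 / 2 * (LBINT x:{0..L}. P x)"
    unfolding dsol using PQ by (subst set_integral_diff(2)) auto
  show "edge_sol k a b f L = edge_sol k a b f 0 + (LBINT x:{0..L}. edge_dsol k a b f x)"
    unfolding D unfolding sol P0 PL QL using k by (simp add: field_simps)
  have isol: "L1_on {0..L} (\<lambda>x. k\<^sup>2 * edge_sol k a b f x)"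
    unfolding sol using PQ by (intro set_integrable_mult_right set_integral_add(1)) auto
  have "(LBINT x:{0..L}. edge_sol k a b f x) = \<i> / (2 * k) * (LBINT x:{0..L}. P x) + \<i> / (2 * k) * (LBINT x:{0..L}. Q x)"
    unfolding sol using PQ by (subst set_integral_add(2)) auto
  then have S: "(LBINT x:{0..L}. f x + k\<^sup>2 * edge_sol k a b f x) = (LBINT x:{0..L}. f x) +
     k\<^sup>2 * (\<i> / (2 * k) * (LBINT x:{0..L}. P x) + \<i> / (2 * k) * (LBINT x:{0..L}. Q x))"
    using set_integral_add(2)[OF f isol] by simp
  show "edge_dsol k a b f L = edge_dsol k a b f 0 - (LBINT x:{0..L}. f x + k\<^sup>2 * edge_sol k a b f x)"
    unfolding S unfolding dsol P0 PL QL using k by (simp add: field_simps power2_eq_square)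
qed

lemma continuous_on_edge_sol:
  assumes "L1_on {0..L} f"
  shows "continuous_on {0..L} (edge_sol k a b f)" "continuous_on {0..L} (edge_dsol k a b f)"
  unfolding edge_sol_def edge_dsol_def by (intro continuous_intros continuous_on_expint assms)+

lemma edge_sol_derivative:
  assumes k: "k \<noteq> 0" and f: "L1_on {0..L} f" and x: "x \<in> {0..L}"
  shows "(edge_sol k a b f has_vector_derivative edge_dsol k a b f x) (at x within {0..L})"
proof -
  note c = continuous_on_edge_sol(2)[OF f, of k a b]
  have d: "((\<lambda>y. edge_sol k a b f 0 + integral {0..y} (edge_dsol k a b f)) has_vector_derivative 0 + edge_dsol k a b f x) (at x within {0..L})"
    by (intro has_vector_derivative_add has_vector_derivative_const integral_has_vector_derivative c x)
  have e: "edge_sol k a b f y = edge_sol k a b f 0 + integral {0..y} (edge_dsol k a b f)" if y: "y \<in> {0..L}" for y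
  proof -
    have fy: "L1_on {0..y} f" by (rule set_integrable_subset[OF f]) (use y in auto)
    have "L1_on {0..y} (edge_dsol k a b f)"
      unfolding set_integrable_def
      using borel_integrable_compact[OF _ continuous_on_edge_sol(2)[OF fy, of k a b]] by simp
    then have "(LBINT x:{0..y}. edge_dsol k a b f x) = integral {0..y} (edge_dsol k a b f)"
      by (rule set_borel_integral_eq_integral)
    then show ?thesis using edge_sol_integral(1)[OF k _ fy, of a b] y by simp
  qed
  show ?thesis
    using has_vector_derivative_transform[OF x e d] by simp
qed

lemma edge_sol_H2_Icc:
  assumes k: "k \<noteq> 0" and L: "L \<ge> 0" and f: "L2_on {0..L} f"
  shows "H2_edge {0..L} (edge_sol k a b f) (edge_dsol k a b f) (\<lambda>x. f x + k\<^sup>2 * edge_sol k a b f x)"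
proof -
  note fi = L2_on_Icc_integrable[OF f]
  have u: "L2_on {0..L} (edge_sol k a b f)" "L2_on {0..L} (edge_dsol k a b f)"
    by (intro L2_on_continuous_Icc continuous_on_edge_sol fi)+
  have "edge_dsol k a b f x = edge_dsol k a b f 0 - (LBINT x:{0..x}. f x + k\<^sup>2 * edge_sol k a b f x)" if x: "x \<in> {0..L}" for x
    by (rule edge_sol_integral(2)[OF k]) (use x set_integrable_subset[OF fi, of "{0..x}"] in auto)
  then show ?thesis unfolding H2_edge_def
    using u f edge_sol_derivative[OF k fi] by (intro conjI ballI L2_on_add L2_on_cmult)
qed

lemma expint_support:
  assumes "R \<ge> 0" "\<And>t. t > R \<Longrightarrow> f t = 0" "x \<ge> R"
  shows "expint k f x = expint k f R"
  unfolding expint_def set_lebesgue_integral_def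
  by (rule Bochner_Integration.integral_cong) (use assms in \<open>auto simp: indicator_def not_le\<close>)

text \<open>The prescribed \<open>b\<close> cancels the growing wave \<open>exp (- i k x)\<close>
  beyond the support of \<open>f\<close>; the other wave decays because
  \<open>Im k > 0\<close>.\<close>

lemma edge_sol_H2_atLeast:
  assumes k: "Im k > 0" and f: "L2_on {0..} f" and R: "R \<ge> 0" "\<And>t. t > R \<Longrightarrow> f t = 0"
    and b: "b = expint k f R"
  shows "H2_edge {0..} (edge_sol k a b f) (edge_dsol k a b f) (\<lambda>x. f x + k\<^sup>2 * edge_sol k a b f x)"
proof -
  have k0: "k \<noteq> 0" using k by auto
  have fL: "L2_on {0..L} f" for L by (rule L2_on_subset[OF f]) auto
  note H = edge_sol_H2_Icc[OF k0 _ fL, of _ a b]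
  \<comment> \<open>Derivatives are local, so a bounded interval reaching past \<open>x\<close>
    gives them on the half-line.\<close>
  have at: "at x within {0..} = at x within {0..x + 1}" if "x \<ge> 0" for x :: real
    by (rule at_within_nhd[where S = "{..<x + 1}"]) auto
  have der: "(edge_sol k a b f has_vector_derivative edge_dsol k a b f x) (at x within {0..})" if x: "x \<in> {0..}" for x
    unfolding at[OF x[unfolded atLeast_iff]]
    by (rule edge_sol_derivative[OF k0 L2_on_Icc_integrable[OF fL]]) (use x in auto)
  have cs: "continuous_on {0..} (edge_sol k a b f)"
    unfolding continuous_on_eq_continuous_within by (intro ballI has_vector_derivative_continuous[OF der])
  have cd: "continuous_on {0..} (edge_dsol k a b f)"
    unfolding continuous_on_eq_continuous_within
  proof
    fix x :: real assume "x \<in> {0..}"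
    then have x: "x \<ge> 0" by simp
    have "continuous (at x within {0..x + 1}) (edge_dsol k a b f)"
      using continuous_on_edge_sol(2)[OF L2_on_Icc_integrable[OF fL], of "x + 1" k a b] x
      unfolding continuous_on_eq_continuous_within by auto
    then show "continuous (at x within {0..}) (edge_dsol k a b f)"
      unfolding continuous_within at[OF x] .
  qed
  have out: "edge_sol k a b f x = (\<i> / (2 * k) * (a + expint (- k) f R)) * exp (\<i> * k * x)"
    "edge_dsol k a b f x = (- 1 / 2 * (a + expint (- k) f R)) * exp (\<i> * k * x)" if "x \<ge> R" for x
  proof -
    have "expint j f x = expint j f R" for j
      using expint_support[OF R(1) _ that] R(2) by blast
    then show "edge_sol k a b f x = (\<i> / (2 * k) * (a + expint (- k) f R)) * exp (\<i> * k * x)"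
      "edge_dsol k a b f x = (- 1 / 2 * (a + expint (- k) f R)) * exp (\<i> * k * x)"
      unfolding edge_sol_def edge_dsol_def b by simp_all
  qed
  have u: "L2_on {0..} (edge_sol k a b f)"
    by (rule L2_on_atLeast_exponential[OF cs out(1) k])
  have du: "L2_on {0..} (edge_dsol k a b f)"
    by (rule L2_on_atLeast_exponential[OF cd out(2) k])
  have "edge_dsol k a b f x = edge_dsol k a b f 0 - (LBINT x:{0..x}. f x + k\<^sup>2 * edge_sol k a b f x)" if x: "x \<in> {0..}" for x
    by (rule edge_sol_integral(2)[OF k0]) (use x L2_on_Icc_integrable[OF fL] in auto)
  then show ?thesis unfolding H2_edge_def
    using u du f der by (intro conjI ballI L2_on_add L2_on_cmult)
qed

lemma continuous_square_integral_0:
  fixes u :: "real \<Rightarrow> complex"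
  assumes u: "continuous_on {a..b} u" and ab: "a < b"
    and 0: "(LBINT x:{a..b}. (cmod (u x))\<^sup>2) = 0" and x: "x \<in> {a..b}"
  shows "u x = 0"
proof -
  have c: "continuous_on {a..b} (\<lambda>x. (cmod (u x))\<^sup>2)" by (intro continuous_intros u)
  have "L1_on {a..b} (\<lambda>x. (cmod (u x))\<^sup>2)"
    by (rule L2_on_square_integrable[OF L2_on_continuous_Icc[OF u]])
  from set_borel_integral_eq_integral(2)[OF this] 0
  have "integral {a..b} (\<lambda>x. (cmod (u x))\<^sup>2) = 0" by simp
  then have "(cmod (u x))\<^sup>2 = 0" using integral_eq_0_iff[OF c ab] x by simp
  then show ?thesis by simp
qed

text \<open>The linear system for the coefficients of the solution on the graph: with \<open>N = K + M\<close>,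
  \<open>c m\<close> and \<open>c (N + m)\<close> are the amplitudes of \<open>exp (i k x)\<close> and \<open>exp (- i k x)\<close> on
  edge \<open>m\<close>, and \<open>c (2 N + v)\<close> is the value at vertex \<open>v\<close>.  The rows express continuity at the
  initial vertex, the outgoing condition on a lead or continuity at the terminal vertex, and
  Kirchhoff's condition; the last summand removes the free value at an isolated vertex.\<close>

definition vrow :: "nat \<Rightarrow> nat \<Rightarrow> (nat \<Rightarrow> nat) \<Rightarrow> (nat \<Rightarrow> nat) \<Rightarrow> complex \<Rightarrow> (nat \<Rightarrow> real) \<Rightarrow> nat \<Rightarrow> (nat \<Rightarrow> complex) \<Rightarrow> complex" where
  "vrow K N s tv k l i c =
    (if i < N then c i + c (N + i) - c (2 * N + s i)
     else if i < N + K then c i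
     else if i < 2 * N then c (i - N) * wave k (l (i - N)) + c i * wave' k (l (i - N)) - c (2 * N + tv (i - N))
     else (\<Sum>m<N. if s m = i - 2 * N then c (N + m) - c m else 0) +
       (\<Sum>m<N. if K \<le> m \<and> tv m = i - 2 * N then c m * wave k (l m) - c (N + m) * wave' k (l m) else 0) +
       (if \<forall>m<N. s m \<noteq> i - 2 * N \<and> (K \<le> m \<longrightarrow> tv m \<noteq> i - 2 * N) then c i else 0))"

text \<open>Row by row, the part of the solution at the terminal end that does not involve the
  amplitudes, moved to the other side; for a lead, the amplitude demanded by the outgoing
  condition.\<close>

definition vrhs :: "nat \<Rightarrow> nat \<Rightarrow> (nat \<Rightarrow> nat) \<Rightarrow> real \<Rightarrow> (nat \<Rightarrow> real) \<Rightarrow> (nat \<Rightarrow> real \<Rightarrow> complex) \<Rightarrow> nat \<Rightarrow> complex \<Rightarrow> complex" where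
  "vrhs K N tv R l f i k =
    (if i < N then 0
     else if i < N + K then expint k (f (i - N)) R
     else if i < 2 * N then out k (f (i - N)) (l (i - N)) - inc k (f (i - N)) (l (i - N))
     else - (\<Sum>m<N. if K \<le> m \<and> tv m = i - 2 * N then inc k (f m) (l m) + out k (f m) (l m) else 0))"

context quantum_graph
begin

abbreviation "nn \<equiv> 2 * N + J"
abbreviation "srow k \<equiv> vrow K N src tv k l"
abbreviation "srhs R \<equiv> vrhs K N tv R l"

definition graph_sol :: "complex \<Rightarrow> (nat \<Rightarrow> complex) \<Rightarrow> (nat \<Rightarrow> real \<Rightarrow> complex) \<Rightarrow> nat \<Rightarrow> real \<Rightarrow> complex" where
  "graph_sol k c f m = edge_sol k (c m) (c (N + m)) (f m)"

lemma system_resolves: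
  assumes k: "Im k > 0" and f: "graph_L2 f" and R: "R \<ge> 0" "\<And>m x. m < K \<Longrightarrow> x > R \<Longrightarrow> f m x = 0"
    and sys: "\<And>i. i < nn \<Longrightarrow> srow k i c = srhs R f i k"
  shows "resolves k f (graph_sol k c f)"
proof -
  have k0: "k \<noteq> 0" using k by auto
  define du where "du m = edge_dsol k (c m) (c (N + m)) (f m)" for m
  define h where "h m x = f m x + k\<^sup>2 * graph_sol k c f m x" for m x
  \<comment> \<open>The unknown vertex values carry the same factor \<open>\<i> / (2 * k)\<close> as
    the amplitudes.\<close>
  define \<phi> where "\<phi> v = \<i> / (2 * k) * c (2 * N + v)" for v
  have H: "H2_edge (ed m) (graph_sol k c f m) (du m) (h m)" if m: "m < N" for m
  proof (cases "m < K")
    case True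
    have "srow k (N + m) c = srhs R f (N + m) k" using sys m by auto
    then have b: "c (N + m) = expint k (f m) R" using True by (simp add: vrow_def vrhs_def)
    have "H2_edge {0..} (edge_sol k (c m) (c (N + m)) (f m)) (edge_dsol k (c m) (c (N + m)) (f m)) (\<lambda>x. f m x + k\<^sup>2 * edge_sol k (c m) (c (N + m)) (f m) x)"
    proof (rule edge_sol_H2_atLeast[OF k _ R(1) R(2)[OF True] b])
      have "ed m = {0..}" using True by (simp add: edom_def)
      then show "L2_on {0..} (f m)" using f m unfolding graph_L2_def by metis
    qed
    then show ?thesis using True unfolding graph_sol_def du_def h_def by (simp add: edom_def)
  next
    case False
    have "H2_edge {0..l m} (edge_sol k (c m) (c (N + m)) (f m)) (edge_dsol k (c m) (c (N + m)) (f m)) (\<lambda>x. f m x + k\<^sup>2 * edge_sol k (c m) (c (N + m)) (f m) x)"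
    proof (rule edge_sol_H2_Icc[OF k0])
      have "ed m = {0..l m}" using False by (simp add: edom_def)
      then show "L2_on {0..l m} (f m)" using f m unfolding graph_L2_def by metis
      show "0 \<le> l m" using l_pos[of m] False m by simp
    qed
    then show ?thesis using False unfolding graph_sol_def du_def h_def by (simp add: edom_def)
  qed
  have "vertex_conditions \<phi> (graph_sol k c f) du"
    unfolding vertex_conditions_def
  proof (intro conjI allI impI)
    fix m assume m: "m < N"
    have "srow k m c = srhs R f m k" using sys m by auto
    then have "c m + c (N + m) = c (2 * N + src m)" using m by (simp add: vrow_def vrhs_def)
    then show "graph_sol k c f m 0 = \<phi> (src m)" unfolding graph_sol_def \<phi>_def edge_sol_def by simp
  next
    fix m assume m: "K \<le> m \<and> m < N"
    have "srow k (N + m) c = srhs R f (N + m) k" using sys m by auto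
    then have "(c m + expint (- k) (f m) (l m)) * wave k (l m) + (c (N + m) - expint k (f m) (l m)) * wave' k (l m) = c (2 * N + tv m)"
      using m by (simp add: vrow_def vrhs_def algebra_simps)
    then show "graph_sol k c f m (l m) = \<phi> (tv m)" unfolding graph_sol_def \<phi>_def edge_sol_def by simp
  next
    fix v assume v: "v < J"
    let ?a = "\<lambda>m. if src m = v then c (N + m) - c m else 0"
    let ?b = "\<lambda>m. if K \<le> m \<and> tv m = v then c m * wave k (l m) - c (N + m) * wave' k (l m) else 0"
    let ?d = "\<lambda>m. if K \<le> m \<and> tv m = v then inc k (f m) (l m) + out k (f m) (l m) else 0"
    have eq: "srow k (2 * N + v) c = srhs R f (2 * N + v) k" using sys v by auto
    have e1: "(\<Sum>m<N. ?a m) + (\<Sum>m<N. ?b m) = - (\<Sum>m<N. ?d m)"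
    \<comment> \<open>At an isolated vertex all three sums are empty; at any other vertex the extra
      summand of the row is absent.\<close>
    proof (cases "\<forall>m<N. src m \<noteq> v \<and> (K \<le> m \<longrightarrow> tv m \<noteq> v)")
      case True
      then have "?a m = 0" "?b m = 0" "?d m = 0" if "m < N" for m using that by auto
      then show ?thesis by simp
    next
      case False
      then show ?thesis using eq by (simp add: vrow_def vrhs_def del: not_all)
    qed
    have e2: "(\<Sum>m<N. if src m = v then - du m 0 else 0) = - 1 / 2 * (\<Sum>m<N. ?a m)"
      unfolding sum_distrib_left by (intro sum.cong) (auto simp: du_def edge_dsol_def field_simps)
    have e3: "(\<Sum>m<N. if K \<le> m \<and> tv m = v then du m (l m) else 0) = - 1 / 2 * (\<Sum>m<N. ?b m) - 1 / 2 * (\<Sum>m<N. ?d m)"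
      unfolding sum_distrib_left sum_subtractf[symmetric]
      by (intro sum.cong) (auto simp: du_def edge_dsol_def field_simps)
    have half: "- 1 / 2 * A + (- 1 / 2 * B - 1 / 2 * D) = 0" if "A + B = - D" for A B D :: complex
    proof -
      have "- 1 / 2 * A + (- 1 / 2 * B - 1 / 2 * D) = - 1 / 2 * ((A + B) + D)" by (simp add: algebra_simps)
      then show ?thesis using that by simp
    qed
    show "(\<Sum>m<N. if src m = v then - du m 0 else 0) + (\<Sum>m<N. if K \<le> m \<and> tv m = v then du m (l m) else 0) = 0"
      unfolding e2 e3 by (rule half[OF e1])
  qed
  moreover have "\<forall>m<N. H2_edge (ed m) (graph_sol k c f m) (du m) (h m)" using H by (intro allI impI)
  ultimately have "opG (graph_sol k c f) h"
    unfolding opP_iff by (intro exI conjI)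
  moreover have "h m x - k\<^sup>2 * graph_sol k c f m x = f m x" for m x by (simp add: h_def)
  ultimately show ?thesis unfolding resolves_def by (intro exI[of _ h]) simp
qed

lemma edge_norm_le_gnorm2:
  assumes "graph_L2 u" "m < N" "{0..L} \<subseteq> ed m"
  shows "(LBINT x:{0..L}. (cmod (u m x))\<^sup>2) \<le> norm2 u"
proof -
  have i: "L1_on (ed m) (\<lambda>x. (cmod (u m x))\<^sup>2)"
    using assms(1,2) L2_on_square_integrable unfolding graph_L2_def by blast
  have "(LBINT x:{0..L}. (cmod (u m x))\<^sup>2) \<le> (LBINT x:ed m. (cmod (u m x))\<^sup>2)"
    unfolding set_lebesgue_integral_def
    using set_integrable_subset[OF i _ assms(3)] i assms(3)
    by (intro integral_mono) (auto simp: set_integrable_def indicator_def)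
  also have "\<dots> \<le> norm2 u"
    unfolding gnorm2_def using assms(2)
    by (intro member_le_sum) (auto simp: set_lebesgue_integral_def intro!: integral_nonneg_AE)
  finally show ?thesis .
qed

lemma gnorm2_0_imp_edge_0:
  assumes "graph_L2 u" "norm2 u = 0" "m < N" "L > 0" "{0..L} \<subseteq> ed m" "continuous_on {0..L} (u m)" "x \<in> {0..L}"
  shows "u m x = 0"
proof (rule continuous_square_integral_0[OF assms(6) assms(4) _ assms(7)])
  have "(LBINT x:{0..L}. (cmod (u m x))\<^sup>2) \<ge> 0"
    by (auto simp: set_lebesgue_integral_def intro!: integral_nonneg_AE)
  then show "(LBINT x:{0..L}. (cmod (u m x))\<^sup>2) = 0"
    using edge_norm_le_gnorm2[OF assms(1,3,5)] assms(2) by simp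
qed

text \<open>A kernel vector yields a solution with zero data, which vanishes by the energy identity.
  Its values at the two ends of an interval force \<open>a + b = 0\<close> and equality of two waves
  times \<open>a\<close>; as these have different moduli for \<open>Im k > 0\<close>, both
  amplitudes vanish. The vertex values are then read off from the rows.\<close>

lemma system_injective:
  assumes k: "Im k > 0" and sys: "\<And>i. i < nn \<Longrightarrow> srow k i c = 0" and j: "j < nn"
  shows "c j = 0"
proof -
  let ?f = "\<lambda>m x. 0 :: complex"
  have k0: "k \<noteq> 0" using k by auto
  have f: "graph_L2 ?f" by (simp add: graph_L2_def L2_on_def)
  have rhs: "vrhs K N tv 0 l ?f i k = 0" for i
    by (simp add: vrhs_def sum.neutral)
  have r: "resolves k ?f (graph_sol k c ?f)"
    by (rule system_resolves[OF k f, of 0]) (use sys rhs in auto)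
  have g0: "norm2 (graph_sol k c ?f) = 0" by (rule resolves_zero_imp_gnorm2_0[OF r k])
  have ab: "c m = 0 \<and> c (N + m) = 0" if m: "m < N" for m
  proof -
    \<comment> \<open>On a lead any positive length separates the two waves.\<close>
    define L where "L = (if m < K then 1 else l m)"
    have L: "L > 0" "{0..L} \<subseteq> ed m" using l_pos[of m] m by (auto simp: L_def edom_def)
    have "L1_on {0..L} (\<lambda>x. 0 :: complex)" by (simp add: set_integrable_def)
    then have cont: "continuous_on {0..L} (graph_sol k c ?f m)"
      unfolding graph_sol_def by (rule continuous_on_edge_sol)
    have z: "graph_sol k c ?f m x = 0" if "x \<in> {0..L}" for x
      by (rule gnorm2_0_imp_edge_0[OF resolves_graph_L2[OF r] g0 m L cont that])
    have "c m + c (N + m) = 0" using z[of 0] L k0 by (simp add: graph_sol_def edge_sol_def)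
    then have ba: "c (N + m) = - c m" by (simp add: add_eq_0_iff)
    have "c m * wave k L + c (N + m) * wave' k L = 0"
      using z[of L] L k0 by (simp add: graph_sol_def edge_sol_def)
    then have eq: "c m * wave k L = c m * wave' k L" unfolding ba by simp
    have "c m = 0"
    proof (rule ccontr)
      assume "c m \<noteq> 0"
      with eq have "wave k L = wave' k L" by simp
      then have "cmod (wave k L) = cmod (wave' k L)" by simp
      then have "- (Im k * L) = Im k * L" by simp
      then show False using k L by simp
    qed
    then show ?thesis using ba by simp
  qed
  have src0: "c (2 * N + src m) = 0" if m: "m < N" for m
  proof -
    have "srow k m c = 0" using sys m by auto
    then show ?thesis using ab[OF m] m by (simp add: vrow_def)
  qed
  have tv0: "c (2 * N + tv m) = 0" if m: "K \<le> m" "m < N" for m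
  proof -
    have "srow k (N + m) c = 0" using sys m by auto
    then show ?thesis using ab[OF m(2)] m by (simp add: vrow_def)
  qed
  have vert: "c (2 * N + v) = 0" if v: "v < J" for v
  proof (cases "\<forall>m<N. src m \<noteq> v \<and> (K \<le> m \<longrightarrow> tv m \<noteq> v)")
    case True
    have "srow k (2 * N + v) c = 0" using sys v by auto
    moreover have "(\<Sum>m<N. if src m = v then c (N + m) - c m else 0) = 0"
      "(\<Sum>m<N. if K \<le> m \<and> tv m = v then c m * wave k (l m) - c (N + m) * wave' k (l m) else 0) = 0"
      using True by (auto intro!: sum.neutral)
    ultimately show ?thesis using True by (simp add: vrow_def)
  next
    case False
    then show ?thesis using src0 tv0 by blast
  qed
  consider "j < N" | "N \<le> j" "j < 2 * N" | "2 * N \<le> j" by linarith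
  then show ?thesis
  proof cases
    case 1 then show ?thesis using ab by simp
  next
    case 2 then show ?thesis using ab[of "j - N"] by simp
  next
    case 3 then show ?thesis using vert[of "j - 2 * N"] j by simp
  qed
qed

end

section \<open>Cramer's rule\<close>

text \<open>Matrices are represented by entry functions, so that continuity and holomorphy in
  parameters follow entrywise from the Leibniz formula. The shifted indices in \<open>fcof\<close>
  keep minors in the same form.\<close>

definition fdet :: "nat \<Rightarrow> (nat \<Rightarrow> nat \<Rightarrow> complex) \<Rightarrow> complex" where
  "fdet n A = Determinant.det (Matrix.mat n n (\<lambda>(i, j). A i j))"

definition fcof :: "nat \<Rightarrow> (nat \<Rightarrow> nat \<Rightarrow> complex) \<Rightarrow> nat \<Rightarrow> nat \<Rightarrow> complex" where
  "fcof n A i j = (- 1) ^ (i + j) * fdet (n - 1) (\<lambda>a b. A (if a < i then a else Suc a) (if b < j then b else Suc b))"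

lemma fdet_leibniz: "fdet n A = (\<Sum>p | p permutes {0..<n}. signof p * (\<Prod>i = 0..<n. A i (p i)))"
proof -
  have "(\<Prod>i = 0..<n. Matrix.mat n n (\<lambda>(i, j). A i j) $$ (i, p i)) = (\<Prod>i = 0..<n. A i (p i))" if "p permutes {0..<n}" for p
    using permutes_in_image[OF that] by (intro prod.cong) auto
  then show ?thesis unfolding fdet_def by (subst det_def'[of _ n]) auto
qed

lemma fcof_eq_cofactor:
  assumes "i < n" "j < n"
  shows "cofactor (Matrix.mat n n (\<lambda>(i, j). A i j)) i j = fcof n A i j"
proof -
  have "mat_delete (Matrix.mat n n (\<lambda>(i, j). A i j)) i j =
     Matrix.mat (n - 1) (n - 1) (\<lambda>(a, b). A (if a < i then a else Suc a) (if b < j then b else Suc b))"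
    using assms by (intro eq_matI) (auto simp: mat_delete_def)
  then show ?thesis unfolding cofactor_def fcof_def fdet_def by simp
qed

text \<open>Cramer's rule before division by the determinant, hence valid also where it vanishes.
  The cofactors occur with indices \<open>r j\<close> because the adjugate is the transposed
  cofactor matrix.\<close>

lemma fcof_expansion:
  assumes i: "i < n"
  shows "(\<Sum>j<n. A i j * (\<Sum>r<n. fcof n A r j * d r)) = fdet n A * d i"
proof -
  let ?A = "Matrix.mat n n (\<lambda>(i, j). A i j)"
  have A: "?A \<in> carrier_mat n n" by simp
  have eq: "(\<Sum>j<n. A i j * fcof n A r j) = (if i = r then fdet n A else 0)" if r: "r < n" for r
  proof -
    have "(\<Sum>j<n. A i j * fcof n A r j) = (?A * adj_mat ?A) $$ (i, r)"
      using i r adj_mat(1)[OF A]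
      by (auto simp: times_mat_def scalar_prod_def adj_mat_def fcof_eq_cofactor lessThan_atLeast0 intro!: sum.cong)
    also have "\<dots> = (fdet n A \<cdot>\<^sub>m 1\<^sub>m n) $$ (i, r)" unfolding adj_mat(2)[OF A] fdet_def ..
    finally show ?thesis using i r by simp
  qed
  have "(\<Sum>j<n. A i j * (\<Sum>r<n. fcof n A r j * d r)) = (\<Sum>j<n. \<Sum>r<n. A i j * fcof n A r j * d r)"
    by (simp add: sum_distrib_left mult.assoc)
  also have "\<dots> = (\<Sum>r<n. \<Sum>j<n. A i j * fcof n A r j * d r)" by (rule sum.swap)
  also have "\<dots> = (\<Sum>r<n. (if i = r then fdet n A else 0) * d r)"
    by (intro sum.cong refl) (simp add: eq flip: sum_distrib_right)
  also have "\<dots> = (\<Sum>r<n. if i = r then fdet n A * d r else 0)" by (intro sum.cong) auto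
  also have "\<dots> = fdet n A * d i" using i by simp
  finally show ?thesis .
qed

lemma fdet_nonzero:
  assumes inj: "\<And>c j. (\<And>i. i < n \<Longrightarrow> (\<Sum>j<n. A i j * c j) = 0) \<Longrightarrow> j < n \<Longrightarrow> c j = 0"
  shows "fdet n A \<noteq> 0"
proof
  let ?A = "Matrix.mat n n (\<lambda>(i, j). A i j)"
  assume "fdet n A = 0"
  then obtain v where v: "v \<in> carrier_vec n" "v \<noteq> 0\<^sub>v n" "?A *\<^sub>v v = 0\<^sub>v n"
    using det_0_iff_vec_prod_zero_field[of ?A n] unfolding fdet_def by auto
  have "(\<Sum>j<n. A i j * vec_index v j) = 0" if i: "i < n" for i
  proof -
    have "vec_index (?A *\<^sub>v v) i = 0" using v(3) i by simp
    then show ?thesis using i v(1) by (simp add: scalar_prod_def lessThan_atLeast0)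
  qed
  then have "vec_index v j = 0" if "j < n" for j using inj that by blast
  then have "v = 0\<^sub>v n" using v(1) by (intro eq_vecI) auto
  then show False using v(2) by simp
qed

section \<open>The system as a matrix depending on the wave number and the lengths\<close>

lemma continuous_on_fdet:
  assumes "\<And>i j. continuous_on S (\<lambda>p. A p i j)"
  shows "continuous_on S (\<lambda>p. fdet n (A p))"
  unfolding fdet_leibniz by (intro continuous_intros assms)

lemma continuous_on_fcof:
  assumes "\<And>i j. continuous_on S (\<lambda>p. A p i j)"
  shows "continuous_on S (\<lambda>p. fcof n (A p) i j)"
  unfolding fcof_def by (intro continuous_intros continuous_on_fdet assms)

lemma holomorphic_on_fdet:
  assumes "\<And>i j. (\<lambda>p. A p i j) holomorphic_on S"
  shows "(\<lambda>p. fdet n (A p)) holomorphic_on S"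
  unfolding fdet_leibniz by (intro holomorphic_intros assms)

lemma holomorphic_on_fcof:
  assumes "\<And>i j. (\<lambda>p. A p i j) holomorphic_on S"
  shows "(\<lambda>p. fcof n (A p) i j) holomorphic_on S"
  unfolding fcof_def by (intro holomorphic_intros holomorphic_on_fdet assms)

text \<open>Turns a row given as a linear functional of the coefficient sequence into a row of a
  matrix; coordinates are added one at a time.\<close>

lemma functional_expand:
  fixes L :: "(nat \<Rightarrow> complex) \<Rightarrow> complex"
  assumes lin: "\<And>c d a. L (\<lambda>j. c j + a * d j) = L c + a * L d"
    and dep: "\<And>c d. (\<And>j. j < n \<Longrightarrow> c j = d j) \<Longrightarrow> L c = L d"
  shows "L c = (\<Sum>j<n. L (\<lambda>i. if i = j then 1 else 0) * c j)"
proof -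
  have "L (\<lambda>i. 0 + (- 1) * 0) = L (\<lambda>i. 0) + (- 1) * L (\<lambda>i. 0)" by (rule lin)
  then have L0: "L (\<lambda>i. 0) = 0" by simp
  have "L (\<lambda>i. if i < r then c i else 0) = (\<Sum>j<r. L (\<lambda>i. if i = j then 1 else 0) * c j)" for r
  proof (induction r)
    case (Suc r)
    have "(\<lambda>i. if i < Suc r then c i else 0) = (\<lambda>i. (if i < r then c i else 0) + c r * (if i = r then 1 else 0))"
      by (auto simp: less_Suc_eq)
    then have "L (\<lambda>i. if i < Suc r then c i else 0) = L (\<lambda>i. (if i < r then c i else 0) + c r * (if i = r then 1 else 0))"
      by (rule arg_cong)
    then show ?case unfolding lin using Suc by simp
  qed (simp add: L0)
  moreover have "L c = L (\<lambda>i. if i < n then c i else 0)" by (rule dep) simp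
  ultimately show ?thesis by simp
qed

definition vmat :: "nat \<Rightarrow> nat \<Rightarrow> (nat \<Rightarrow> nat) \<Rightarrow> (nat \<Rightarrow> nat) \<Rightarrow> complex \<Rightarrow> (nat \<Rightarrow> real) \<Rightarrow> nat \<Rightarrow> nat \<Rightarrow> complex" where
  "vmat K N s tv k l i j = vrow K N s tv k l i (\<lambda>r. if r = j then 1 else 0)"

lemma vrow_linear:
  "vrow K N s tv k l i (\<lambda>j. c j + a * d j) = vrow K N s tv k l i c + a * vrow K N s tv k l i d"
proof -
  have 1: "(\<Sum>m<N. if P m then X m c - Y m c else 0) + a * (\<Sum>m<N. if P m then X m d - Y m d else 0) =
      (\<Sum>m<N. if P m then X m (\<lambda>j. c j + a * d j) - Y m (\<lambda>j. c j + a * d j) else 0)"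
    if "\<And>m. X m (\<lambda>j. c j + a * d j) = X m c + a * X m d" "\<And>m. Y m (\<lambda>j. c j + a * d j) = Y m c + a * Y m d"
    for P and X Y :: "nat \<Rightarrow> (nat \<Rightarrow> complex) \<Rightarrow> complex"
    unfolding sum_distrib_left sum.distrib[symmetric] by (intro sum.cong) (auto simp: that algebra_simps)
  have 2: "(\<Sum>m<N. if s m = v then (c (N + m) + a * d (N + m)) - (c m + a * d m) else 0) =
     (\<Sum>m<N. if s m = v then c (N + m) - c m else 0) + a * (\<Sum>m<N. if s m = v then d (N + m) - d m else 0)" for v
    by (rule 1[symmetric, where X = "\<lambda>m c. c (N + m)" and Y = "\<lambda>m c. c m"]) auto
  have 3: "(\<Sum>m<N. if K \<le> m \<and> tv m = v then (c m + a * d m) * E m - (c (N + m) + a * d (N + m)) * E' m else 0) =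
     (\<Sum>m<N. if K \<le> m \<and> tv m = v then c m * E m - c (N + m) * E' m else 0) + a * (\<Sum>m<N. if K \<le> m \<and> tv m = v then d m * E m - d (N + m) * E' m else 0)" for v E E'
    by (rule 1[symmetric, where X = "\<lambda>m c. c m * E m" and Y = "\<lambda>m c. c (N + m) * E' m"]) (auto simp: algebra_simps)
  show ?thesis unfolding vrow_def 2 3 by (auto simp: algebra_simps)
qed

lemma holomorphic_on_vmat: "(\<lambda>k. vmat K N s tv k l i j) holomorphic_on S"
proof -
  have h: "(\<lambda>k. if P then f k else 0) holomorphic_on S" if "f holomorphic_on S" for P and f :: "complex \<Rightarrow> complex"
    using that by (cases P) auto
  show ?thesis unfolding vmat_def vrow_def
    by (cases "i < N"; cases "i < N + K"; cases "i < 2 * N")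
       (simp_all only: if_True if_False, (intro holomorphic_intros h)+)
qed

lemma continuous_on_vmat: "continuous_on S (\<lambda>p. vmat K N s tv (fst p) (snd p) i j)"
proof -
  have h: "continuous_on S (\<lambda>k. if P then f k else 0)" if "continuous_on S f" for P and f :: "complex \<times> (nat \<Rightarrow> real) \<Rightarrow> complex"
    using that by (cases P) auto
  have l: "continuous_on S (\<lambda>p. snd p m)" for m and S :: "(complex \<times> (nat \<Rightarrow> real)) set"
    by (rule continuous_on_compose2[OF continuous_on_product_coordinates[of m] continuous_on_snd]) (auto intro: continuous_intros)
  show ?thesis unfolding vmat_def vrow_def
    by (cases "i < N"; cases "i < N + K"; cases "i < 2 * N")
       (simp_all only: if_True if_False, (intro continuous_intros h l)+)
qed

text \<open>Tychonoff for length functions on all of \<open>nat\<close>. Coordinates that do not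
  belong to a finite edge are fixed at 1; by \<open>vmat_cong\<close> they do not influence the
  matrix.\<close>

lemma compact_lengths:
  assumes "compact \<L>"
  shows "compact {l :: nat \<Rightarrow> real. \<forall>m. l m \<in> (if K \<le> m \<and> m < N then \<L> else {1})}"
proof -
  have "compactin (product_topology (\<lambda>i. euclidean) UNIV) (PiE UNIV (\<lambda>m. if K \<le> m \<and> m < N then \<L> else {1 :: real}))"
    unfolding compactin_PiE using assms by auto
  then show ?thesis unfolding euclidean_product_topology
    by (simp add: PiE_UNIV_domain Pi_def)
qed

lemma vmat_cong:
  assumes "\<And>m. K \<le> m \<Longrightarrow> m < N \<Longrightarrow> l m = l' m"
  shows "vmat K N s tv k l = vmat K N s tv k l'"
proof (intro ext)
  fix i j
  have "(\<Sum>m<N. if K \<le> m \<and> tv m = v then c m * wave k (l m) - c (N + m) * wave' k (l m) else 0) =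
    (\<Sum>m<N. if K \<le> m \<and> tv m = v then c m * wave k (l' m) - c (N + m) * wave' k (l' m) else 0)" for v and c :: "nat \<Rightarrow> complex"
    using assms by (intro sum.cong) auto
  moreover have "l (i - N) = l' (i - N)" if "\<not> i < N" "\<not> i < N + K" "i < 2 * N"
    using that by (intro assms) auto
  ultimately show "vmat K N s tv k l i j = vmat K N s tv k l' i j"
    unfolding vmat_def vrow_def by auto
qed

context quantum_graph
begin

abbreviation "V \<equiv> vmat K N src tv"

lemma vrow_expand:
  assumes i: "i < nn"
  shows "srow k i c = (\<Sum>j<nn. V k l i j * c j)"
  unfolding vmat_def
proof (rule functional_expand)
  fix c d :: "nat \<Rightarrow> complex" assume cd: "\<And>j. j < nn \<Longrightarrow> c j = d j"
  have a: "c (2 * N + src m) = d (2 * N + src m)" if "m < N" for m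
    using cd src_less[OF that] by auto
  have b: "c (2 * N + tv m) = d (2 * N + tv m)" if "K \<le> m" "m < N" for m
    using cd tv_less[OF that] by auto
  have e: "c m = d m" "c (N + m) = d (N + m)" if "m < N" for m using cd that by auto
  have s1: "(\<Sum>m<N. if src m = v then c (N + m) - c m else 0) = (\<Sum>m<N. if src m = v then d (N + m) - d m else 0)" for v
    using e by (intro sum.cong) auto
  have s2: "(\<Sum>m<N. if K \<le> m \<and> tv m = v then c m * wave k (l m) - c (N + m) * wave' k (l m) else 0) =
    (\<Sum>m<N. if K \<le> m \<and> tv m = v then d m * wave k (l m) - d (N + m) * wave' k (l m) else 0)" for v
    using e by (intro sum.cong) auto
  have t: "c (2 * N + tv (i - N)) = d (2 * N + tv (i - N))" "c (i - N) = d (i - N)" if "\<not> i < N" "\<not> i < N + K" "i < 2 * N"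
    using that b[of "i - N"] e(1)[of "i - N"] by auto
  show "srow k i c = srow k i d"
    unfolding vrow_def s1 s2 using a[of i] e[of i] cd[OF i] t by auto
qed (rule vrow_linear)

lemma det_nonzero:
  assumes "Im k > 0"
  shows "fdet nn (V k l) \<noteq> 0"
proof (rule fdet_nonzero)
  fix c j assume "\<And>i. i < nn \<Longrightarrow> (\<Sum>j<nn. V k l i j * c j) = 0" "j < nn"
  then show "c j = 0" using system_injective[OF assms, of c j] by (simp add: vrow_expand)
qed

end

section \<open>Matrix elements of the resolvent\<close>

lemma norm_exp_i_le:
  assumes "\<bar>t\<bar> \<le> L" "cmod k \<le> r"
  shows "cmod (wave k t) \<le> exp (r * L)"
proof -
  have "- (Im k * t) \<le> \<bar>Im k\<bar> * \<bar>t\<bar>" by (metis abs_ge_minus_self abs_mult)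
  also have "\<dots> \<le> r * L"
    using assms abs_Im_le_cmod[of k] by (intro mult_mono) auto
  finally show ?thesis by simp
qed

lemma set_integrable_norm_L1:
  fixes f :: "real \<Rightarrow> complex"
  assumes "L1_on S f" shows "L1_on S (\<lambda>x. cmod (f x))"
  using assms unfolding set_integrable_def by (auto dest: integrable_norm)

lemma expint_norm_le:
  assumes f: "L1_on {0..L} f" and x: "x \<le> L" "0 \<le> L" and r: "cmod k \<le> r"
  shows "cmod (expint k f x) \<le> exp (r * L) * (LBINT t:{0..L}. cmod (f t))"
proof -
  have "cmod (expint k f x) \<le> (LINT t|lborel. cmod (indicator {0..x} t *\<^sub>R (wave k t * f t)))"
    unfolding expint_def set_lebesgue_integral_def by (rule integral_norm_bound)
  also have "\<dots> \<le> (LINT t|lborel. exp (r * L) * (indicator {0..L} t *\<^sub>R cmod (f t)))"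
  proof (rule integral_mono)
    have "L1_on {0..x} f" by (rule set_integrable_subset[OF f]) (use x in auto)
    then show "integrable lborel (\<lambda>t. cmod (indicator {0..x} t *\<^sub>R (wave k t * f t)))"
      using expint_integrable unfolding set_integrable_def by (intro integrable_norm) blast
    show "integrable lborel (\<lambda>t. exp (r * L) * (indicator {0..L} t *\<^sub>R cmod (f t)))"
      using set_integrable_norm_L1[OF f] unfolding set_integrable_def by (rule integrable_mult_right)
    fix t :: real
    show "cmod (indicator {0..x} t *\<^sub>R (wave k t * f t)) \<le> exp (r * L) * (indicator {0..L} t *\<^sub>R cmod (f t))"
    proof (cases "t \<in> {0..x}")
      case True
      then have "cmod (wave k t) * cmod (f t) \<le> exp (r * L) * cmod (f t)"
        using x r by (intro mult_right_mono norm_exp_i_le) auto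
      then show ?thesis using True x by (simp add: norm_mult)
    qed (auto simp: indicator_def)
  qed
  finally show ?thesis by (simp add: set_lebesgue_integral_def)
qed

lemma norm_indicator_mult_le:
  fixes a b :: complex
  assumes "t \<in> S \<Longrightarrow> cmod a \<le> c"
  shows "cmod (indicator S t *\<^sub>R (a * b)) \<le> c * cmod (indicator S t *\<^sub>R b)"
  using assms by (cases "t \<in> S") (auto simp: norm_mult mult_right_mono)

lemma holomorphic_expint:
  assumes "L1_on {0..x} f"
  shows "(\<lambda>k. expint k f x) holomorphic_on UNIV"
proof (cases "x \<ge> 0")
  case x: True
  show ?thesis
    unfolding expint_def set_lebesgue_integral_def
  proof (rule entire_integral[where w = "\<lambda>r t. exp (r * x) * cmod (indicator {0..x} t *\<^sub>R f t)"])
    show "(\<lambda>k. indicator {0..x} t *\<^sub>R (wave k t * f t)) holomorphic_on UNIV" for t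
      unfolding scaleR_conv_of_real by (intro holomorphic_intros)
    show "(\<lambda>t. indicator {0..x} t *\<^sub>R (wave k t * f t)) \<in> borel_measurable lborel" for k
      using expint_integrable[OF assms, of k] unfolding set_integrable_def by auto
    show "integrable lborel (\<lambda>t. exp (r * x) * cmod (indicator {0..x} t *\<^sub>R f t))" for r
      using assms unfolding set_integrable_def by (intro integrable_mult_right integrable_norm)
    fix r k t assume k: "cmod k < r"
    show "cmod (indicator {0..x} t *\<^sub>R (wave k t * f t)) \<le> exp (r * x) * cmod (indicator {0..x} t *\<^sub>R f t)"
      using k by (intro norm_indicator_mult_le norm_exp_i_le) auto
  qed
qed (simp add: expint_def set_lebesgue_integral_def)

lemma holomorphic_expint_minus:
  assumes "L1_on {0..x} f"
  shows "(\<lambda>k. expint (- k) f x) holomorphic_on UNIV"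
proof -
  have "(\<lambda>k. expint k f x) \<circ> (\<lambda>k. - k) holomorphic_on UNIV"
    by (intro holomorphic_on_compose_gen[OF _ holomorphic_expint[OF assms]] holomorphic_intros) auto
  then show ?thesis by (simp add: o_def)
qed

text \<open>The convolution of \<open>f\<close> with \<open>2 i sin (k x)\<close>: the part of
  \<open>edge_sol\<close> that is free of amplitudes, up to the factor
  \<open>\<i> / (2 * k)\<close>.\<close>

definition Wker :: "complex \<Rightarrow> (real \<Rightarrow> complex) \<Rightarrow> real \<Rightarrow> complex" where
  "Wker k f x = inc k f x - out k f x"

definition Wint :: "complex \<Rightarrow> (real \<Rightarrow> complex) \<Rightarrow> (real \<Rightarrow> complex) \<Rightarrow> real \<Rightarrow> complex" where
  "Wint k f g L = (LBINT x:{0..L}. Wker k f x * g x)"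

lemma Wker_norm_le:
  assumes f: "L1_on {0..L} f" and x: "x \<in> {0..L}" and r: "cmod k \<le> r"
  shows "cmod (Wker k f x) \<le> 2 * exp (r * L) ^ 2 * (LBINT t:{0..L}. cmod (f t))"
proof -
  have L: "0 \<le> L" using x by auto
  let ?I = "LBINT t:{0..L}. cmod (f t)"
  have e1: "cmod (expint (- k) f x) \<le> exp (r * L) * ?I" "cmod (expint k f x) \<le> exp (r * L) * ?I"
    using x r L by (auto intro!: expint_norm_le[OF f])
  have e2: "cmod (wave k x) \<le> exp (r * L)" "cmod (wave' k x) \<le> exp (r * L)"
    using norm_exp_i_le[of x L k r] norm_exp_i_le[of x L "- k" r] x r by auto
  have I: "?I \<ge> 0" by (auto simp: set_lebesgue_integral_def intro!: integral_nonneg_AE)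
  have "cmod (Wker k f x) \<le> cmod (expint (- k) f x) * cmod (wave k x) + cmod (expint k f x) * cmod (wave' k x)"
    unfolding Wker_def by (metis norm_mult norm_triangle_ineq4)
  also have "\<dots> \<le> (exp (r * L) * ?I) * exp (r * L) + (exp (r * L) * ?I) * exp (r * L)"
    by (intro add_mono mult_mono e1 e2) (use I in auto)
  also have "\<dots> = 2 * exp (r * L) ^ 2 * ?I" by (simp add: power2_eq_square)
  finally show ?thesis .
qed

lemma continuous_on_Wker:
  assumes "L1_on {0..L} f"
  shows "continuous_on {0..L} (Wker k f)"
  unfolding Wker_def by (intro continuous_intros continuous_on_expint assms)

lemma Wker_integrable:
  assumes "L1_on {0..L} f" "L1_on {0..L} g"
  shows "L1_on {0..L} (\<lambda>x. Wker k f x * g x)"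
  using set_integrable_mult_continuous[OF assms(2) continuous_on_Wker[OF assms(1)], of k] by (simp add: mult.commute)

lemma holomorphic_Wker:
  assumes "L1_on {0..L} f" "x \<le> L"
  shows "(\<lambda>k. Wker k f x) holomorphic_on UNIV"
proof -
  have "L1_on {0..x} f" by (rule set_integrable_subset[OF assms(1)]) (use assms in auto)
  then show ?thesis unfolding Wker_def
    by (intro holomorphic_intros holomorphic_expint holomorphic_expint_minus)
qed

lemma Wint_norm_le:
  assumes f: "L1_on {0..L} f" and g: "L1_on {0..L} g" and r: "cmod k \<le> r"
  shows "cmod (Wint k f g L) \<le> 2 * exp (r * L) ^ 2 * (LBINT t:{0..L}. cmod (f t)) * (LBINT t:{0..L}. cmod (g t))"
proof -
  let ?C = "2 * exp (r * L) ^ 2 * (LBINT t:{0..L}. cmod (f t))"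
  have "cmod (Wint k f g L) \<le> (LINT t|lborel. cmod (indicator {0..L} t *\<^sub>R (Wker k f t * g t)))"
    unfolding Wint_def set_lebesgue_integral_def by (rule integral_norm_bound)
  also have "\<dots> \<le> (LINT t|lborel. ?C * (indicator {0..L} t *\<^sub>R cmod (g t)))"
  proof (rule integral_mono)
    show "integrable lborel (\<lambda>t. cmod (indicator {0..L} t *\<^sub>R (Wker k f t * g t)))"
      using Wker_integrable[OF f g] unfolding set_integrable_def by (intro integrable_norm)
    show "integrable lborel (\<lambda>t. ?C * (indicator {0..L} t *\<^sub>R cmod (g t)))"
      using set_integrable_norm_L1[OF g] unfolding set_integrable_def by (rule integrable_mult_right)
    fix t :: real
    show "cmod (indicator {0..L} t *\<^sub>R (Wker k f t * g t)) \<le> ?C * (indicator {0..L} t *\<^sub>R cmod (g t))"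
      using norm_indicator_mult_le[of t "{0..L}" "Wker k f t" ?C "g t"] Wker_norm_le[OF f _ r] by simp
  qed
  also have "\<dots> = ?C * (LBINT t:{0..L}. cmod (g t))"
    unfolding set_lebesgue_integral_def by (rule integral_mult_right_zero)
  finally show ?thesis .
qed

lemma holomorphic_Wint:
  assumes f: "L1_on {0..L} f" and g: "L1_on {0..L} g"
  shows "(\<lambda>k. Wint k f g L) holomorphic_on UNIV"
  unfolding Wint_def set_lebesgue_integral_def
proof (rule entire_integral[where w = "\<lambda>r t. 2 * exp (r * L) ^ 2 * (LBINT t:{0..L}. cmod (f t)) * cmod (indicator {0..L} t *\<^sub>R g t)"])
  show "(\<lambda>k. indicator {0..L} t *\<^sub>R (Wker k f t * g t)) holomorphic_on UNIV" for t
    by (cases "t \<in> {0..L}") (auto intro!: holomorphic_intros holomorphic_Wker[OF f])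
  show "(\<lambda>t. indicator {0..L} t *\<^sub>R (Wker k f t * g t)) \<in> borel_measurable lborel" for k
    using Wker_integrable[OF f g, of k] unfolding set_integrable_def by auto
  show "integrable lborel (\<lambda>t. 2 * exp (r * L) ^ 2 * (LBINT t:{0..L}. cmod (f t)) * cmod (indicator {0..L} t *\<^sub>R g t))" for r
    using g unfolding set_integrable_def by (intro integrable_mult_right integrable_norm)
  fix r k t assume k: "cmod k < r"
  show "cmod (indicator {0..L} t *\<^sub>R (Wker k f t * g t)) \<le> 2 * exp (r * L) ^ 2 * (LBINT t:{0..L}. cmod (f t)) * cmod (indicator {0..L} t *\<^sub>R g t)"
    using k by (intro norm_indicator_mult_le Wker_norm_le[OF f]) auto
qed

lemma edge_sol_pairing:
  assumes k: "k \<noteq> 0" and f: "L1_on {0..L} f" and g: "L1_on {0..L} g"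
  shows "(LBINT x:{0..L}. edge_sol k a b f x * g x) = (a * expint k g L + b * expint (- k) g L + Wint k f g L) / (- 2 * \<i> * k)"
proof -
  \<comment> \<open>The factor \<open>\<i> / (2 * k)\<close> is written as division by
    \<open>- 2 * \<i> * k\<close>, which will join the determinant in
    \<open>res_den\<close>.\<close>
  have "edge_sol k a b f x * g x = (a * (wave k x * g x) + b * (exp (\<i> * (- k) * of_real x) * g x) + Wker k f x * g x) / (- 2 * \<i> * k)" for x
    unfolding edge_sol_def Wker_def using k by (simp add: field_simps)
  then have "(LBINT x:{0..L}. edge_sol k a b f x * g x) =
     (LBINT x:{0..L}. a * (wave k x * g x) + b * (exp (\<i> * (- k) * of_real x) * g x) + Wker k f x * g x) / (- 2 * \<i> * k)"
    by (simp only: set_integral_divide_zero)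
  also have "(LBINT x:{0..L}. a * (wave k x * g x) + b * (exp (\<i> * (- k) * of_real x) * g x) + Wker k f x * g x) =
     a * expint k g L + b * expint (- k) g L + Wint k f g L"
  proof -
    have i: "L1_on {0..L} (\<lambda>x. a * (wave k x * g x))"
      "L1_on {0..L} (\<lambda>x. b * (exp (\<i> * (- k) * of_real x) * g x))"
      "L1_on {0..L} (\<lambda>x. Wker k f x * g x)"
      by (intro set_integrable_mult_right expint_integrable g Wker_integrable f)+
    show ?thesis
      unfolding set_integral_add(2)[OF set_integral_add(1)[OF i(1,2)] i(3)] set_integral_add(2)[OF i(1,2)]
      unfolding set_integral_mult_right expint_def Wint_def ..
  qed
  finally show ?thesis .
qed

section \<open>Matrix elements as quotients of entire functions\<close>

context quantum_graph
begin

definition eff :: "real \<Rightarrow> nat \<Rightarrow> real" where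
  "eff R m = (if m < K then R else l m)"

text \<open>Vanishing is required at every point beyond \<open>R\<close>, so that
  \<open>expint\<close> is exactly constant there and pairings reduce to bounded intervals.\<close>

definition supported :: "real \<Rightarrow> (nat \<Rightarrow> real \<Rightarrow> complex) \<Rightarrow> bool" where
  "supported R f \<longleftrightarrow> graph_L2 f \<and> (\<forall>m<K. \<forall>x>R. f m x = 0)"

lemma eff_subset: "m < N \<Longrightarrow> {0..eff R m} \<subseteq> ed m"
  by (auto simp: eff_def edom_def)

lemma eff_nonneg: "R \<ge> 0 \<Longrightarrow> m < N \<Longrightarrow> eff R m \<ge> 0"
  using l_pos[of m] by (auto simp: eff_def)

lemma supported_L2_eff: "supported R f \<Longrightarrow> m < N \<Longrightarrow> L2_on {0..eff R m} (f m)"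
  unfolding supported_def graph_L2_def by (blast intro: L2_on_subset[OF _ _ eff_subset] sets_lborel[THEN equalityD2, THEN subsetD] borel_closed closed_atLeastAtMost)

text \<open>The amplitudes and vertex values multiplied by the determinant, and therefore entire in
  \<open>k\<close>.\<close>

definition sol_coeff :: "real \<Rightarrow> (nat \<Rightarrow> real \<Rightarrow> complex) \<Rightarrow> complex \<Rightarrow> nat \<Rightarrow> complex" where
  "sol_coeff R f k j = (\<Sum>r<nn. fcof nn (V k l) r j * srhs R f r k)"

definition res_num :: "real \<Rightarrow> (nat \<Rightarrow> real \<Rightarrow> complex) \<Rightarrow> (nat \<Rightarrow> real \<Rightarrow> complex) \<Rightarrow> complex \<Rightarrow> complex" where
  "res_num R f g k = (\<Sum>m<N. sol_coeff R f k m * expint k (\<lambda>x. cnj (g m x)) (eff R m) +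
      sol_coeff R f k (N + m) * expint (- k) (\<lambda>x. cnj (g m x)) (eff R m) +
      fdet nn (V k l) * Wint k (f m) (\<lambda>x. cnj (g m x)) (eff R m))"

definition res_den :: "complex \<Rightarrow> complex" where
  "res_den k = - 2 * \<i> * k * fdet nn (V k l)"

lemma res_den_nonzero: "Im k > 0 \<Longrightarrow> res_den k \<noteq> 0"
  using det_nonzero[of k] by (auto simp: res_den_def)

lemma resolvent_exists:
  assumes k: "Im k > 0" and f: "supported R f" and g: "supported R g" and R: "R \<ge> 0"
  obtains u where "resolves k f u" "pair u g = res_num R f g k / res_den k"
proof -
  define D where "D = fdet nn (V k l)"
  have D: "D \<noteq> 0" unfolding D_def by (rule det_nonzero[OF k])
  have k0: "k \<noteq> 0" using k by auto
  define c where "c j = sol_coeff R f k j / D" for j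
  have sys: "srow k i c = srhs R f i k" if i: "i < nn" for i
  proof -
    have "srow k i c = (\<Sum>j<nn. V k l i j * sol_coeff R f k j) / D"
      unfolding vrow_expand[OF i] c_def by (simp add: sum_divide_distrib)
    also have "(\<Sum>j<nn. V k l i j * sol_coeff R f k j) = D * srhs R f i k"
      unfolding sol_coeff_def D_def by (rule fcof_expansion[OF i])
    finally show ?thesis using D by simp
  qed
  have r: "resolves k f (graph_sol k c f)"
    by (rule system_resolves[OF k _ R _ sys]) (use f in \<open>auto simp: supported_def\<close>)
  have "(LBINT x:ed m. graph_sol k c f m x * cnj (g m x)) =
    (c m * expint k (\<lambda>x. cnj (g m x)) (eff R m) + c (N + m) * expint (- k) (\<lambda>x. cnj (g m x)) (eff R m) + Wint k (f m) (\<lambda>x. cnj (g m x)) (eff R m)) / (- 2 * \<i> * k)" if m: "m < N" for m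
  proof -
    \<comment> \<open>On a lead the solution continues beyond \<open>R\<close>, but \<open>g\<close>
      vanishes there.\<close>
    have "(LBINT x:ed m. graph_sol k c f m x * cnj (g m x)) = (LBINT x:{0..eff R m}. graph_sol k c f m x * cnj (g m x))"
      unfolding set_lebesgue_integral_def
      by (rule Bochner_Integration.integral_cong)
         (use g m in \<open>auto simp: indicator_def eff_def edom_def supported_def not_le\<close>)
    also have "\<dots> = (c m * expint k (\<lambda>x. cnj (g m x)) (eff R m) + c (N + m) * expint (- k) (\<lambda>x. cnj (g m x)) (eff R m) + Wint k (f m) (\<lambda>x. cnj (g m x)) (eff R m)) / (- 2 * \<i> * k)"
      unfolding graph_sol_def
      by (rule edge_sol_pairing[OF k0])
         (intro L2_on_Icc_integrable L2_on_cnj supported_L2_eff[OF f m] supported_L2_eff[OF g m])+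
    finally show ?thesis .
  qed
  then have "pair (graph_sol k c f) g = (\<Sum>m<N. (c m * expint k (\<lambda>x. cnj (g m x)) (eff R m) + c (N + m) * expint (- k) (\<lambda>x. cnj (g m x)) (eff R m) + Wint k (f m) (\<lambda>x. cnj (g m x)) (eff R m)) / (- 2 * \<i> * k))"
    unfolding gpair_def by (intro sum.cong) auto
  also have "\<dots> = res_num R f g k / res_den k"
    unfolding res_num_def res_den_def D_def[symmetric] sum_divide_distrib c_def
    using D k0 by (intro sum.cong refl) (simp add: field_simps)
  finally show ?thesis using that r by blast
qed

lemma holomorphic_vrhs:
  assumes f: "supported R f"
  shows "(\<lambda>k. srhs R f i k) holomorphic_on UNIV"
proof -
  have fi: "L1_on {0..eff R m} (f m)" if "m < N" for m
    by (rule L2_on_Icc_integrable[OF supported_L2_eff[OF f that]])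
  have s: "(\<lambda>k. \<Sum>m<N. if K \<le> m \<and> tv m = v then inc k (f m) (l m) + out k (f m) (l m) else 0) holomorphic_on UNIV" for v
  proof (intro holomorphic_on_sum)
    fix m assume m: "m \<in> {..<N}"
    show "(\<lambda>k. if K \<le> m \<and> tv m = v then inc k (f m) (l m) + out k (f m) (l m) else 0) holomorphic_on UNIV"
    proof (cases "K \<le> m \<and> tv m = v")
      case True
      then have "L1_on {0..l m} (f m)" using fi[of m] m by (simp add: eff_def)
      then have "(\<lambda>k. inc k (f m) (l m) + out k (f m) (l m)) holomorphic_on UNIV"
        by (intro holomorphic_intros holomorphic_expint holomorphic_expint_minus)
      then show ?thesis using True by simp
    next
      case False
      then show ?thesis by (simp only: False if_False) simp
    qed
  qed
  consider "i < N" | "\<not> i < N" "i < N + K" | "\<not> i < N + K" "i < 2 * N" | "\<not> i < 2 * N" by linarith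
  then show ?thesis
  proof cases
    case 1
    then show ?thesis by (simp add: vrhs_def)
  next
    case 2
    then have "i - N < N" "i - N < K" by auto
    then have "L1_on {0..R} (f (i - N))" using fi[of "i - N"] by (simp add: eff_def)
    then show ?thesis unfolding vrhs_def using 2 by (simp only: if_True if_False) (rule holomorphic_expint)
  next
    case 3
    then have "i - N < N" "\<not> i - N < K" by auto
    then have i: "L1_on {0..l (i - N)} (f (i - N))" using fi[of "i - N"] by (simp add: eff_def)
    have "\<not> i < N" using 3 by simp
    then show ?thesis unfolding vrhs_def using 3 i
      by (simp only: if_True if_False) (intro holomorphic_intros holomorphic_expint holomorphic_expint_minus)
  next
    case 4
    have "\<not> i < N" "\<not> i < N + K" using 4 by auto
    then show ?thesis unfolding vrhs_def using 4
      by (simp only: if_True if_False) (intro holomorphic_intros s)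
  qed
qed

lemma holomorphic_sol_coeff:
  assumes f: "supported R f"
  shows "(\<lambda>k. sol_coeff R f k j) holomorphic_on UNIV"
  unfolding sol_coeff_def
  by (intro holomorphic_intros holomorphic_on_fcof holomorphic_on_vmat holomorphic_vrhs f)

lemma holomorphic_res_num:
  assumes f: "supported R f" and g: "supported R g"
  shows "res_num R f g holomorphic_on UNIV"
proof -
  have i: "L1_on {0..eff R m} (f m)" "L1_on {0..eff R m} (\<lambda>x. cnj (g m x))" if "m < N" for m
    by (intro L2_on_Icc_integrable L2_on_cnj supported_L2_eff[OF f that] supported_L2_eff[OF g that])+
  show ?thesis unfolding res_num_def[abs_def]
    by (intro holomorphic_intros holomorphic_sol_coeff f holomorphic_on_fdet holomorphic_on_vmat
          holomorphic_expint holomorphic_expint_minus holomorphic_Wint i) auto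
qed

lemma holomorphic_res_den: "res_den holomorphic_on S"
  unfolding res_den_def[abs_def] by (intro holomorphic_intros holomorphic_on_fdet holomorphic_on_vmat)

end

section \<open>Uniform bounds\<close>

text \<open>A singularity of a meromorphic function is not essential, so at a point that is no pole
  there is a finite limit to fill in.\<close>

lemma meromorphic_not_pole_remove_sings:
  assumes "G meromorphic_on UNIV" "\<And>z. z \<in> S \<Longrightarrow> \<not> is_pole G z"
  shows "remove_sings G analytic_on S"
proof -
  have "remove_sings G analytic_on {z}" if z: "z \<in> S" for z
  proof -
    have "G meromorphic_on {z}" using assms(1) by (rule meromorphic_on_subset) simp
    then have iso: "isolated_singularity_at G z" and "not_essential G z"
      using meromorphic_at_iff by blast+
    then obtain c where "G \<midarrow>z\<rightarrow> c" using assms(2)[OF z] unfolding not_essential_def by blast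
    with iso show ?thesis by (rule remove_sings_analytic_at)
  qed
  then show ?thesis using analytic_on_analytic_at by blast
qed

lemma compact_pos_lower_bound:
  fixes S :: "real set"
  assumes "compact S" "S \<subseteq> {0<..}"
  obtains a where "a > 0" "\<And>x. x \<in> S \<Longrightarrow> a \<le> x"
proof (cases "S = {}")
  case False
  then obtain a where "a \<in> S" "\<forall>x\<in>S. a \<le> x" using compact_attains_inf[OF assms(1)] by blast
  then show ?thesis using that assms(2) by auto
qed (use that[of 1] in auto)

lemma compact_upper_bound:
  fixes S :: "real set"
  assumes "compact S"
  obtains b where "b \<ge> 0" "\<And>x. x \<in> S \<Longrightarrow> x \<le> b"
proof -
  obtain b where "\<forall>x\<in>S. norm x \<le> b" using compact_imp_bounded[OF assms] bounded_iff by blast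
  then show ?thesis by (intro that[of "max b 0"]) (auto simp: abs_le_iff max_def)
qed

text \<open>The determinant and cofactors are jointly continuous on the product of a disc and the
  compact space of lengths. At \<open>\<i>\<close> the determinant vanishes for no choice of
  lengths, so its inverse is bounded there as well.\<close>

lemma system_uniform_bounds:
  fixes \<L> :: "real set"
  assumes graph: "qgraph J K M lv iv tv" and \<L>: "compact \<L>" "\<L> \<subseteq> {0<..}"
  shows "\<exists>B>0. \<exists>c>0. \<forall>l. (\<forall>m. K \<le> m \<and> m < K + M \<longrightarrow> l m \<in> \<L>) \<longrightarrow>
       (\<forall>k\<in>cball \<i> r. cmod (fdet (2 * (K + M) + J) (vmat K (K + M) (edge_source K lv iv) tv k l)) \<le> B \<and>
         (\<forall>i<2 * (K + M) + J. \<forall>j<2 * (K + M) + J.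
           cmod (fcof (2 * (K + M) + J) (vmat K (K + M) (edge_source K lv iv) tv k l) i j) \<le> B)) \<and>
       c \<le> cmod (fdet (2 * (K + M) + J) (vmat K (K + M) (edge_source K lv iv) tv \<i> l))"
proof -
  define n where "n = 2 * (K + M) + J"
  define A where "A k l = vmat K (K + M) (edge_source K lv iv) tv k l" for k l
  define \<Lambda> where "\<Lambda> = {l :: nat \<Rightarrow> real. \<forall>m. l m \<in> (if K \<le> m \<and> m < K + M then \<L> else {1})}"
  have \<Lambda>: "compact \<Lambda>" unfolding \<Lambda>_def by (rule compact_lengths[OF \<L>(1)])
  have cA: "continuous_on S (\<lambda>p. A (fst p) (snd p) i j)" for S i j
    unfolding A_def by (rule continuous_on_vmat)
  \<comment> \<open>A single nonnegative function dominating the determinant and every cofactor, so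
    that one bound serves them all.\<close>
  define \<Phi> where "\<Phi> p = cmod (fdet n (A (fst p) (snd p))) + (\<Sum>i<n. \<Sum>j<n. cmod (fcof n (A (fst p) (snd p)) i j))" for p
  have "continuous_on (cball \<i> r \<times> \<Lambda>) \<Phi>" unfolding \<Phi>_def
    by (intro continuous_intros continuous_on_fdet continuous_on_fcof cA)
  then have "bounded (\<Phi> ` (cball \<i> r \<times> \<Lambda>))"
    by (intro compact_imp_bounded compact_continuous_image compact_Times \<Lambda> compact_cball)
  then obtain B where B: "\<And>k l. k \<in> cball \<i> r \<Longrightarrow> l \<in> \<Lambda> \<Longrightarrow> \<bar>\<Phi> (k, l)\<bar> \<le> B"
    unfolding bounded_iff by force
  have nz: "fdet n (A \<i> l) \<noteq> 0" if l: "l \<in> \<Lambda>" for l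
  proof -
    interpret quantum_graph J K M lv iv tv l
    proof
      fix m assume "K \<le> m" "m < K + M"
      moreover have "l m \<in> (if K \<le> m \<and> m < K + M then \<L> else {1})" using l unfolding \<Lambda>_def by blast
      ultimately have "l m \<in> \<L>" by simp
      then show "0 < l m" using \<L>(2) by auto
    qed (rule graph)
    show ?thesis using det_nonzero[of \<i>] unfolding n_def A_def by simp
  qed
  have "continuous_on ({\<i>} \<times> \<Lambda>) (\<lambda>p. inverse (cmod (fdet n (A (fst p) (snd p)))))"
    by (intro continuous_intros continuous_on_fdet cA) (use nz in auto)
  then have "bounded ((\<lambda>p. inverse (cmod (fdet n (A (fst p) (snd p))))) ` ({\<i>} \<times> \<Lambda>))"
    by (intro compact_imp_bounded compact_continuous_image compact_Times \<Lambda>) auto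
  then obtain b where b: "\<And>l. l \<in> \<Lambda> \<Longrightarrow> inverse (cmod (fdet n (A \<i> l))) \<le> b"
    unfolding bounded_iff by force
  have reduce: "\<exists>l'\<in>\<Lambda>. \<forall>k. A k l = A k l'" if l: "\<And>m. K \<le> m \<Longrightarrow> m < K + M \<Longrightarrow> l m \<in> \<L>" for l
  proof (intro bexI allI)
    show "(\<lambda>m. if K \<le> m \<and> m < K + M then l m else 1) \<in> \<Lambda>" unfolding \<Lambda>_def using l by auto
    show "A k l = A k (\<lambda>m. if K \<le> m \<and> m < K + M then l m else 1)" for k
      unfolding A_def by (rule vmat_cong) auto
  qed
  have sum_nn: "(\<Sum>i<n. \<Sum>j<n. cmod (fcof n (A k l) i j)) \<ge> 0" for k l by (intro sum_nonneg) auto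
  \<comment> \<open>The absolute values and the added 1 keep the constants positive even when
    \<open>\<Lambda>\<close> is empty and \<open>B\<close> and \<open>b\<close> are
    arbitrary.\<close>
  show ?thesis
    unfolding n_def[symmetric] A_def[symmetric]
  proof (rule exI[of _ "\<bar>B\<bar> + 1"], intro conjI exI[of _ "1 / (\<bar>b\<bar> + 1)"] allI impI ballI)
    fix l :: "nat \<Rightarrow> real" assume l: "\<forall>m. K \<le> m \<and> m < K + M \<longrightarrow> l m \<in> \<L>"
    obtain l' where l': "l' \<in> \<Lambda>" "\<And>k. A k l = A k l'" using reduce[of l] l by blast
    have "0 < cmod (fdet n (A \<i> l'))" using nz[OF l'(1)] by simp
    moreover have "inverse (cmod (fdet n (A \<i> l'))) \<le> \<bar>b\<bar> + 1" using b[OF l'(1)] by linarith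
    ultimately show "1 / (\<bar>b\<bar> + 1) \<le> cmod (fdet n (A \<i> l))" unfolding l'(2)
      by (simp add: field_simps inverse_eq_divide)
    fix k assume k: "k \<in> cball \<i> r"
    have \<Phi>: "\<Phi> (k, l') \<le> \<bar>B\<bar> + 1" using B[OF k l'(1)] by linarith
    then show "cmod (fdet n (A k l)) \<le> \<bar>B\<bar> + 1" unfolding l'(2) \<Phi>_def using sum_nn[of k l'] by simp
    fix i j assume ij: "i < n" "j < n"
    have "cmod (fcof n (A k l') i j) \<le> (\<Sum>j<n. cmod (fcof n (A k l') i j))"
      using ij by (intro member_le_sum) auto
    also have "\<dots> \<le> (\<Sum>i<n. \<Sum>j<n. cmod (fcof n (A k l') i j))"
      using ij by (intro member_le_sum[of i]) (auto intro: sum_nonneg)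
    also have "\<dots> \<le> \<Phi> (k, l')" unfolding \<Phi>_def by simp
    finally show "cmod (fcof n (A k l) i j) \<le> \<bar>B\<bar> + 1" unfolding l'(2) using \<Phi> by simp
  qed auto
qed

context quantum_graph
begin

lemma supported_L1_bound:
  assumes f: "supported R f" and R: "R \<ge> 0" and m: "m < N" and f1: "norm2 f \<le> 1" and \<Lambda>: "eff R m \<le> \<Lambda>"
  shows "(LBINT x:{0..eff R m}. cmod (f m x)) \<le> (\<Lambda> + 1) / 2"
proof -
  have "(LBINT x:{0..eff R m}. cmod (f m x)) \<le> ((eff R m - 0) + (LBINT x:{0..eff R m}. (cmod (f m x))\<^sup>2)) / 2"
    by (rule L2_on_Icc_L1_bound[OF supported_L2_eff[OF f m] eff_nonneg[OF R m]])
  also have "(LBINT x:{0..eff R m}. (cmod (f m x))\<^sup>2) \<le> norm2 f"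
    using f by (intro edge_norm_le_gnorm2 m eff_subset) (simp add: supported_def)
  finally show ?thesis using f1 \<Lambda> by simp
qed

lemma supported_expint_bound:
  assumes f: "supported R f" and R: "R \<ge> 0" and m: "m < N" and f1: "norm2 f \<le> 1" and \<Lambda>: "eff R m \<le> \<Lambda>"
    and k: "cmod k \<le> r"
  shows "cmod (expint k (f m) (eff R m)) \<le> exp (r * \<Lambda>) * ((\<Lambda> + 1) / 2)"
proof -
  have r: "r \<ge> 0" using k norm_ge_zero[of k] by linarith
  have "cmod (expint k (f m) (eff R m)) \<le> exp (r * eff R m) * (LBINT x:{0..eff R m}. cmod (f m x))"
    by (rule expint_norm_le[OF L2_on_Icc_integrable[OF supported_L2_eff[OF f m]]])
       (use eff_nonneg[OF R m] k in auto)
  also have "\<dots> \<le> exp (r * \<Lambda>) * ((\<Lambda> + 1) / 2)"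
    using \<Lambda> r by (intro mult_mono supported_L1_bound[OF f R m f1 \<Lambda>])
       (auto simp: mult_left_mono set_lebesgue_integral_def intro!: integral_nonneg_AE)
  finally show ?thesis .
qed

lemma supported_cnj: "supported R g \<Longrightarrow> supported R (\<lambda>m x. cnj (g m x))"
  unfolding supported_def graph_L2_def using L2_on_cnj by auto

text \<open>Only the Kirchhoff rows sum over edges; \<open>N \<ge> 1\<close> lets the single-term
  rows share their bound.\<close>

lemma vrhs_bound:
  assumes f: "supported R f" and R: "R \<ge> 0" and f1: "norm2 f \<le> 1" and \<Lambda>: "\<And>m. m < N \<Longrightarrow> eff R m \<le> \<Lambda>"
    and k: "cmod k \<le> r" and N: "N \<ge> 1" and \<Lambda>0: "\<Lambda> \<ge> 0"
  shows "cmod (srhs R f i k) \<le> real N * (2 * exp (r * \<Lambda>) ^ 2 * ((\<Lambda> + 1) / 2))"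
proof -
  define H where "H = (\<Lambda> + 1) / 2"
  define e where "e = exp (r * \<Lambda>)"
  have r: "r \<ge> 0" using k norm_ge_zero[of k] by linarith
  have H: "H > 0" unfolding H_def using \<Lambda>0 by simp
  have e: "e \<ge> 1" unfolding e_def using r \<Lambda>0 by simp
  have b1: "cmod (expint k (f m) (eff R m)) \<le> e * H" "cmod (expint (- k) (f m) (eff R m)) \<le> e * H" if "m < N" for m
    unfolding e_def H_def using k
    by (intro supported_expint_bound[OF f R that f1 \<Lambda>[OF that]], simp)+
  have b2: "cmod (expint k (f m) (l m)) \<le> e * H" "cmod (expint (- k) (f m) (l m)) \<le> e * H"
    "cmod (wave k (l m)) \<le> e" "cmod (wave' k (l m)) \<le> e" if "K \<le> m" "m < N" for m
  proof -
    have em: "eff R m = l m" using that by (simp add: eff_def)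
    show "cmod (expint k (f m) (l m)) \<le> e * H" "cmod (expint (- k) (f m) (l m)) \<le> e * H" using b1[OF that(2)] em by auto
    have "\<bar>l m\<bar> \<le> \<Lambda>" using \<Lambda>[OF that(2)] em l_pos[OF that] by simp
    then show "cmod (wave k (l m)) \<le> e" "cmod (wave' k (l m)) \<le> e"
      unfolding e_def using norm_exp_i_le[of "l m" \<Lambda> k r] norm_exp_i_le[of "l m" \<Lambda> "- k" r] k by auto
  qed
  have two: "cmod (x * y) + cmod (z * w) \<le> 2 * e ^ 2 * H"
    if "cmod x \<le> e * H" "cmod y \<le> e" "cmod z \<le> e * H" "cmod w \<le> e" for x y z w :: complex
  proof -
    have "cmod (x * y) + cmod (z * w) \<le> (e * H) * e + (e * H) * e"
      unfolding norm_mult by (intro add_mono mult_mono that) (use e H in auto)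
    then show ?thesis by (simp add: power2_eq_square algebra_simps)
  qed
  have pos: "0 \<le> 2 * e ^ 2 * H" using e H by simp
  have N1: "2 * e ^ 2 * H \<le> real N * (2 * e ^ 2 * H)"
    using mult_right_mono[of 1 "real N", OF _ pos] N by simp
  have eH: "e * H \<le> 2 * e ^ 2 * H"
  proof -
    have "e * 1 \<le> e * (2 * e)" using e by (intro mult_left_mono) auto
    then have "e * H \<le> (2 * e ^ 2) * H" using H by (intro mult_right_mono) (auto simp: power2_eq_square)
    then show ?thesis .
  qed
  consider "i < N" | "\<not> i < N" "i < N + K" | "\<not> i < N" "\<not> i < N + K" "i < 2 * N" | "\<not> i < N" "\<not> i < N + K" "\<not> i < 2 * N" by linarith
  then have "cmod (srhs R f i k) \<le> real N * (2 * e ^ 2 * H)"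
  proof cases
    case 1
    then show ?thesis using pos N by (simp add: vrhs_def)
  next
    case 2
    then have m: "i - N < N" "i - N < K" by auto
    have "cmod (expint k (f (i - N)) R) \<le> e * H" using b1(1)[OF m(1)] m by (simp add: eff_def)
    then show ?thesis using 2 eH N1 by (simp add: vrhs_def)
  next
    case 3
    then have m: "K \<le> i - N" "i - N < N" by auto
    have "cmod (srhs R f i k) \<le> cmod (out k (f (i - N)) (l (i - N))) + cmod (inc k (f (i - N)) (l (i - N)))"
      unfolding vrhs_def using 3 by (simp only: if_False if_True) (rule norm_triangle_ineq4)
    also have "\<dots> \<le> 2 * e ^ 2 * H" by (intro two b2 m)
    finally show ?thesis using N1 by linarith
  next
    case 4
    have "cmod (\<Sum>m<N. if K \<le> m \<and> tv m = i - 2 * N then inc k (f m) (l m) + out k (f m) (l m) else 0) \<le> real (card {..<N}) * (2 * e ^ 2 * H)"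
    proof (rule sum_norm_bound)
      fix m assume "m \<in> {..<N}"
      then have m: "m < N" by simp
      show "cmod (if K \<le> m \<and> tv m = i - 2 * N then inc k (f m) (l m) + out k (f m) (l m) else 0) \<le> 2 * e ^ 2 * H"
      proof (cases "K \<le> m \<and> tv m = i - 2 * N")
        case True
        then have Km: "K \<le> m" by simp
        have "cmod (inc k (f m) (l m) + out k (f m) (l m)) \<le>
          cmod (inc k (f m) (l m)) + cmod (out k (f m) (l m))"
          by (rule norm_triangle_ineq)
        also have "\<dots> \<le> 2 * e ^ 2 * H" by (intro two b2 m Km)
        finally show ?thesis using True by simp
      next
        case False
        then show ?thesis using pos by (simp only: False if_False norm_zero)
      qed
    qed
    then show ?thesis unfolding vrhs_def using 4 by (simp only: if_False norm_minus_cancel) simp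
  qed
  then show ?thesis unfolding e_def H_def .
qed

text \<open>The lengths enter the right-hand side only through the upper bounds
  \<open>\<Lambda>\<close> and \<open>B\<close>, as the uniform threshold requires.\<close>

lemma res_num_bound:
  assumes f: "supported R f" and g: "supported R g" and R: "R \<ge> 0"
    and f1: "norm2 f \<le> 1" and g1: "norm2 g \<le> 1" and \<Lambda>: "\<And>m. m < N \<Longrightarrow> eff R m \<le> \<Lambda>"
    and k: "cmod k \<le> r" and N: "N \<ge> 1" and \<Lambda>0: "\<Lambda> \<ge> 0"
    and B: "cmod (fdet nn (V k l)) \<le> B" "\<And>i j. i < nn \<Longrightarrow> j < nn \<Longrightarrow> cmod (fcof nn (V k l) i j) \<le> B"
  shows "cmod (res_num R f g k) \<le> real N *
     (2 * (real nn * (B * (real N * (2 * exp (r * \<Lambda>) ^ 2 * ((\<Lambda> + 1) / 2)))) * (exp (r * \<Lambda>) * ((\<Lambda> + 1) / 2))) +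
      B * (2 * exp (r * \<Lambda>) ^ 2 * ((\<Lambda> + 1) / 2) * ((\<Lambda> + 1) / 2)))"
proof -
  define H where "H = (\<Lambda> + 1) / 2"
  define e where "e = exp (r * \<Lambda>)"
  define d where "d = real N * (2 * e ^ 2 * H)"
  have r: "r \<ge> 0" using k norm_ge_zero[of k] by linarith
  have H: "H > 0" unfolding H_def using \<Lambda>0 by simp
  have e: "e \<ge> 1" unfolding e_def using r \<Lambda>0 by simp
  have B0: "B \<ge> 0" using B(1) norm_ge_zero order_trans by blast
  have d0: "d \<ge> 0" unfolding d_def using H e by simp
  have rhs: "cmod (srhs R f i k) \<le> d" for i
    unfolding d_def e_def H_def by (rule vrhs_bound[OF f R f1 \<Lambda> k N \<Lambda>0])
  have sc: "cmod (sol_coeff R f k j) \<le> real nn * (B * d)" if j: "j < nn" for j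
  proof -
    have "cmod (sol_coeff R f k j) \<le> real (card {..<nn}) * (B * d)"
      unfolding sol_coeff_def
    proof (rule sum_norm_bound)
      fix i assume "i \<in> {..<nn}"
      then show "cmod (fcof nn (V k l) i j * srhs R f i k) \<le> B * d"
        unfolding norm_mult using B0 j by (intro mult_mono B(2) rhs) auto
    qed
    then show ?thesis by simp
  qed
  have g': "supported R (\<lambda>m x. cnj (g m x))" "norm2 (\<lambda>m x. cnj (g m x)) \<le> 1"
    using supported_cnj[OF g] g1 by (auto simp: gnorm2_def)
  have "cmod (res_num R f g k) \<le> real (card {..<N}) * (2 * (real nn * (B * d) * (e * H)) + B * (2 * e ^ 2 * H * H))"
    unfolding res_num_def
  proof (rule sum_norm_bound)
    fix m assume "m \<in> {..<N}"
    then have m: "m < N" by simp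
    let ?g = "\<lambda>x. cnj (g m x)"
    have b: "cmod (expint k ?g (eff R m)) \<le> e * H" "cmod (expint (- k) ?g (eff R m)) \<le> e * H"
      unfolding e_def H_def using supported_expint_bound[OF g'(1) R m g'(2) \<Lambda>[OF m]] k by auto
    have "cmod (Wint k (f m) ?g (eff R m)) \<le> 2 * exp (r * eff R m) ^ 2 * (LBINT t:{0..eff R m}. cmod (f m t)) * (LBINT t:{0..eff R m}. cmod (?g t))"
      by (intro Wint_norm_le L2_on_Icc_integrable supported_L2_eff[OF f m] supported_L2_eff[OF g'(1) m] k)
    also have "\<dots> \<le> 2 * e ^ 2 * H * H"
      unfolding e_def H_def using r \<Lambda>[OF m] \<Lambda>0
      by (intro mult_mono supported_L1_bound[OF f R m f1] supported_L1_bound[OF g'(1) R m g'(2)] power_mono)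
         (auto simp: mult_left_mono set_lebesgue_integral_def intro!: integral_nonneg_AE mult_nonneg_nonneg)
    finally have W: "cmod (Wint k (f m) ?g (eff R m)) \<le> 2 * e ^ 2 * H * H" .
    have "cmod (sol_coeff R f k m * expint k ?g (eff R m) + sol_coeff R f k (N + m) * expint (- k) ?g (eff R m) + fdet nn (V k l) * Wint k (f m) ?g (eff R m))
      \<le> cmod (sol_coeff R f k m * expint k ?g (eff R m)) + cmod (sol_coeff R f k (N + m) * expint (- k) ?g (eff R m)) + cmod (fdet nn (V k l) * Wint k (f m) ?g (eff R m))"
      by (intro order_trans[OF norm_triangle_ineq] add_mono norm_triangle_ineq order_refl)
    also have "\<dots> \<le> real nn * (B * d) * (e * H) + real nn * (B * d) * (e * H) + B * (2 * e ^ 2 * H * H)"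
      unfolding norm_mult using m B0 d0 e H
      by (intro add_mono mult_mono sc b B(1) W) auto
    finally show "cmod (sol_coeff R f k m * expint k ?g (eff R m) + sol_coeff R f k (N + m) * expint (- k) ?g (eff R m) + fdet nn (V k l) * Wint k (f m) ?g (eff R m))
      \<le> 2 * (real nn * (B * d) * (e * H)) + B * (2 * e ^ 2 * H * H)" by (simp only: mult_2)
  qed
  then show ?thesis unfolding d_def e_def H_def by simp
qed

end

section \<open>Quasimodes\<close>

context quantum_graph
begin

text \<open>Continuity upgrades vanishing almost everywhere to vanishing everywhere, including the
  end point \<open>R\<close>, and the derivative follows.\<close>

lemma H2_lead_vanishing:
  assumes u: "H2_edge {0..} u du f" and R: "R \<ge> 0" and ae: "AE x in lborel. x > R \<longrightarrow> u x = 0" and x: "x \<ge> R"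
  shows "u x = 0" "du x = 0"
proof -
  have z: "u y = 0" if y: "y \<ge> R" for y
  proof (rule continuous_square_integral_0[where a = R and b = "y + 1"])
    show "continuous_on {R..y + 1} u"
      by (rule continuous_on_subset[OF H2_edge_continuous[OF u]]) (use R in auto)
    show "(LINT x:{R..y + 1}|lborel. (cmod (u x))\<^sup>2) = 0"
      unfolding set_lebesgue_integral_def
    proof (rule integral_eq_zero_AE)
      show "AE x in lborel. indicator {R..y + 1} x *\<^sub>R (cmod (u x))\<^sup>2 = 0"
        using ae AE_lborel_singleton[of R] by eventually_elim (auto simp: indicator_def)
    qed
  qed (use y in auto)
  then show "u x = 0" using x .
  \<comment> \<open>At \<open>x = R\<close> the function is known to vanish only to the right; the
    one-sided difference quotient already determines \<open>du x\<close>.\<close>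
  have "(u has_vector_derivative du x) (at x within cbox R (x + 1))"
    by (rule has_vector_derivative_within_subset[OF H2_edgeD(4)[OF u]]) (use x R in auto)
  moreover have "(u has_vector_derivative 0) (at x within cbox R (x + 1))"
    by (rule has_vector_derivative_transform[where f = "\<lambda>_. 0"]) (use x z in auto)
  ultimately show "du x = 0"
    using vector_derivative_unique_within_closed_interval[of R "x + 1" x u] x by simp
qed

text \<open>Up to \<open>R\<close> the integrals of \<open>f\<close> are unchanged. Beyond
  \<open>R\<close> both \<open>du x\<close> and \<open>du R\<close> vanish, so \<open>du 0\<close>
  equals the integral of \<open>f\<close> over \<open>{0..R}\<close>, which is all that the cutoff
  retains.\<close>

lemma H2_lead_cutoff:
  assumes u: "H2_edge {0..} u du f" and R: "R \<ge> 0" and ae: "AE x in lborel. x > R \<longrightarrow> u x = 0"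
  shows "H2_edge {0..} u du (\<lambda>x. if x > R then 0 else f x)"
proof -
  let ?f = "\<lambda>x. if x > R then 0 else f x"
  note U = H2_edgeD[OF u]
  have "L2_on {0..R} f" by (rule L2_on_subset[OF U(3)]) auto
  moreover have "(\<lambda>x. indicator {0..R} x *\<^sub>R f x) = (\<lambda>x. indicator {0..} x *\<^sub>R ?f x)"
    "(\<lambda>x. indicator {0..R} x * (cmod (f x))\<^sup>2) = (\<lambda>x. indicator {0..} x * (cmod (?f x))\<^sup>2)"
    by (auto simp: indicator_def fun_eq_iff)
  ultimately have L: "L2_on {0..} ?f" unfolding L2_on_def by simp
  have "du x = du 0 - (LBINT t:{0..x}. ?f t)" if x: "x \<in> {0..}" for x
  proof (cases "x \<le> R")
    case True
    then have "(LBINT t:{0..x}. ?f t) = (LBINT t:{0..x}. f t)"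
      by (intro set_lebesgue_integral_cong) auto
    moreover have "du x = du 0 - (LBINT t:{0..x}. f t)" by (rule U(5)[OF x])
    ultimately show ?thesis by simp
  next
    case False
    then have "(LBINT t:{0..x}. ?f t) = (LBINT t:{0..R}. f t)"
      unfolding set_lebesgue_integral_def
      by (intro Bochner_Integration.integral_cong) (auto simp: indicator_def)
    moreover have "du R = du 0 - (LBINT t:{0..R}. f t)" by (rule U(5)) (use R in auto)
    moreover have "du R = 0" "du x = 0" using H2_lead_vanishing(2)[OF u R ae] False by auto
    ultimately show ?thesis by simp
  qed
  then show ?thesis unfolding H2_edge_def using U(1,2,4) L by (intro conjI ballI)
qed

text \<open>Outside \<open>x \<le> R\<close> the function \<open>f\<close> is only known to vanish almost everywhere
  (through \<open>u'\<close>); replacing it by its cutoff avoids Lebesgue differentiation.\<close>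

lemma opP_cutoff:
  assumes "opG u f" and R: "R \<ge> 0"
    and ae: "\<And>m. m < K \<Longrightarrow> AE x in lborel. x > R \<longrightarrow> u m x = 0"
  shows "opG u (\<lambda>m x. if m < K \<and> x > R then 0 else f m x)" and "supported R u"
proof -
  obtain du \<phi> where H: "\<And>m. m < N \<Longrightarrow> H2_edge (ed m) (u m) (du m) (f m)" and vc: "vertex_conditions \<phi> u du"
    using assms(1) unfolding opP_iff by blast
  have lead: "H2_edge {0..} (u m) (du m) (f m)" if "m < K" for m
    using H[of m] that by (simp add: edom_def)
  have "H2_edge (ed m) (u m) (du m) (\<lambda>x. if m < K \<and> x > R then 0 else f m x)" if m: "m < N" for m
  proof (cases "m < K")
    case True
    then show ?thesis using H2_lead_cutoff[OF lead[OF True] R ae[OF True]] by (simp add: edom_def)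
  qed (use H[OF m] in simp)
  then show "opG u (\<lambda>m x. if m < K \<and> x > R then 0 else f m x)"
    unfolding opP_iff using vc by blast
  have "u m x = 0" if "m < K" "x > R" for m x
    using H2_lead_vanishing(1)[OF lead R ae] that by auto
  then show "supported R u" using opP_graph_L2(1)[OF assms(1)] unfolding supported_def by blast
qed

lemma supported_L2comp: "supported R f \<Longrightarrow> L2comp K M l f"
  unfolding supported_def graph_L2_def L2comp_def by (auto intro!: exI[of _ R] AE_I2)

lemma graph_L2_diff_cmult:
  assumes "graph_L2 f" "graph_L2 u" shows "graph_L2 (\<lambda>m x. f m x - c * u m x)"
  using assms unfolding graph_L2_def by (auto intro!: L2_on_diff L2_on_cmult)

lemma gnorm2_mono:
  assumes "graph_L2 f" "graph_L2 g" "\<And>m x. m < N \<Longrightarrow> x \<in> ed m \<Longrightarrow> cmod (f m x) \<le> cmod (g m x)"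
  shows "norm2 f \<le> norm2 g"
  unfolding gnorm2_def
proof (rule sum_mono)
  fix m assume "m \<in> {..<N}"
  then have m: "m < N" by simp
  show "(LBINT x:ed m. (cmod (f m x))\<^sup>2) \<le> (LBINT x:ed m. (cmod (g m x))\<^sup>2)"
    using assms m unfolding graph_L2_def by (intro set_integral_mono L2_on_square_integrable power_mono) auto
qed

text \<open>The explicit quotient is a meromorphic function agreeing with \<open>res_elem\<close> in
  the upper half-plane, hence a witness in the definition of \<open>Res\<close>: any pole of it in
  \<open>S\<close> would be a resonance. Without poles its singularities in \<open>S\<close> are
  removable.\<close>

lemma resolvent_continuation:
  assumes f: "supported R f" and g: "supported R g" and R: "R \<ge> 0"
    and free: "Res J K M lv iv tv l \<inter> S = {}"
  shows "\<exists>F. F holomorphic_on S \<and> (\<forall>z\<in>S. res_den z \<noteq> 0 \<longrightarrow> F z * res_den z = res_num R f g z) \<and>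
    (\<forall>z\<in>S. Im z > 0 \<longrightarrow> (\<forall>u. resolves z f u \<longrightarrow> F z = pair u g))"
proof -
  define G where "G k = res_num R f g k / res_den k" for k
  have gL: "graph_L2 g" using g by (simp add: supported_def)
  have an: "res_num R f g analytic_on UNIV" "res_den analytic_on UNIV"
    using holomorphic_res_num[OF f g] holomorphic_res_den by (simp_all add: analytic_on_open)
  then have mero: "G meromorphic_on UNIV"
    unfolding G_def[abs_def] by (intro meromorphic_intros analytic_on_imp_meromorphic_on)
  have Gres: "G k = res_elem J K M lv iv tv l k f g" if k: "Im k > 0" for k
  proof -
    obtain u where "resolves k f u" "pair u g = G k"
      using resolvent_exists[OF k f g R] unfolding G_def by blast
    then show ?thesis using res_elem_eq[OF _ k gL] by simp
  qed
  have "\<not> is_pole G z" if "z \<in> S" for z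
  proof
    assume "is_pole G z"
    then have "z \<in> Res J K M lv iv tv l"
      unfolding Res_def using supported_L2comp[OF f] supported_L2comp[OF g] mero Gres by blast
    then show False using free that by blast
  qed
  then have F: "remove_sings G analytic_on S"
    by (rule meromorphic_not_pole_remove_sings[OF mero])
  have eq: "remove_sings G z = G z" if "res_den z \<noteq> 0" for z
  proof (rule remove_sings_at_analytic)
    show "G analytic_on {z}" unfolding G_def[abs_def]
      using that by (intro analytic_intros analytic_on_subset[OF an(1)] analytic_on_subset[OF an(2)]) auto
  qed
  show ?thesis
  proof (intro exI[of _ "remove_sings G"] conjI ballI impI allI)
    show "remove_sings G holomorphic_on S" using F by (rule analytic_imp_holomorphic)
    show "remove_sings G z * res_den z = res_num R f g z" if "res_den z \<noteq> 0" for z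
      using eq[OF that] that by (simp add: G_def)
    show "remove_sings G z = pair u g" if "Im z > 0" "resolves z f u" for z u
      using eq[OF res_den_nonzero[OF that(1)]] Gres[OF that(1)] res_elem_eq[OF that(2,1) gL] by simp
  qed
qed

text \<open>The matrix element \<open>H\<close> is continued as well because it must stay bounded
  near \<open>k0\<close>: only then does the factor \<open>k0\<^sup>2 - z\<^sup>2\<close> make its
  contribution disappear in the limit.\<close>

lemma continuation_at_quasimode:
  assumes u: "supported R u" and f: "supported R f" and op: "opG u f" and R: "R \<ge> 0"
    and S: "open S" "of_real k0 \<in> S"
    and F: "F holomorphic_on S"
      "\<And>z w. z \<in> S \<Longrightarrow> Im z > 0 \<Longrightarrow> resolves z (\<lambda>m x. f m x - (of_real k0)\<^sup>2 * u m x) w \<Longrightarrow> F z = pair w u"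
    and H: "H holomorphic_on S"
      "\<And>z w. z \<in> S \<Longrightarrow> Im z > 0 \<Longrightarrow> resolves z u w \<Longrightarrow> H z = pair w u"
  shows "F (of_real k0) = of_real (norm2 u)"
proof -
  let ?f = "\<lambda>m x. f m x - (of_real k0)\<^sup>2 * u m x"
  have uL: "graph_L2 u" and fL: "graph_L2 f" using u f by (auto simp: supported_def)
  have f0: "supported R ?f"
    using graph_L2_diff_cmult[OF fL uL] u f unfolding supported_def by auto
  have id: "F z + ((of_real k0)\<^sup>2 - z\<^sup>2) * H z = of_real (norm2 u)" if z: "z \<in> S" "Im z > 0" for z
  proof -
    obtain w1 where w1: "resolves z ?f w1" using resolvent_exists[OF z(2) f0 u R] by blast
    obtain w2 where w2: "resolves z u w2" using resolvent_exists[OF z(2) u u R] by blast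
    let ?c = "(of_real k0)\<^sup>2 - z\<^sup>2"
    have r1: "resolves z (\<lambda>m x. ?f m x + ?c * u m x) (\<lambda>m x. w1 m x + ?c * w2 m x)"
      by (rule resolves_add_cmult[OF w1 w2])
    have r2: "resolves z (\<lambda>m x. ?f m x + ?c * u m x) u"
      unfolding resolves_def using op by (intro exI[of _ f] conjI) (auto simp: algebra_simps)
    have "pair u u = pair (\<lambda>m x. w1 m x + ?c * w2 m x) u"
      by (rule resolves_gpair_unique[OF r2 r1 z(2) uL])
    also have "\<dots> = pair w1 u + ?c * pair w2 u"
      by (intro gpair_add_cmult resolves_graph_L2[OF w1] resolves_graph_L2[OF w2] uL)
    finally show ?thesis using F(2)[OF z w1] H(2)[OF z w2] by (simp add: gpair_self)
  qed
  \<comment> \<open>The approach is from the upper half-plane, where \<open>F\<close> and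
    \<open>H\<close> are known to be pairings with solutions.\<close>
  define X where "X n = of_real k0 + \<i> * of_real (inverse (real (Suc n)))" for n
  have "X \<longlonglongrightarrow> of_real k0 + \<i> * of_real 0"
    unfolding X_def[abs_def] by (intro tendsto_intros LIMSEQ_inverse_real_of_nat)
  then have X: "X \<longlonglongrightarrow> of_real k0" by simp
  have cont: "isCont F (of_real k0)" "isCont H (of_real k0)"
    using F(1) H(1) S by (auto simp: continuous_on_eq_continuous_at dest!: holomorphic_on_imp_continuous_on)
  have "(\<lambda>n. F (X n) + ((of_real k0)\<^sup>2 - (X n)\<^sup>2) * H (X n)) \<longlonglongrightarrow> F (of_real k0) + ((of_real k0)\<^sup>2 - (of_real k0)\<^sup>2) * H (of_real k0)"
    by (intro tendsto_intros X isCont_tendsto_compose[OF cont(1)] isCont_tendsto_compose[OF cont(2)])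
  moreover have "\<forall>\<^sub>F n in sequentially. F (X n) + ((of_real k0)\<^sup>2 - (X n)\<^sup>2) * H (X n) = of_real (norm2 u)"
    using topological_tendstoD[OF X S] by eventually_elim (rule id, auto simp: X_def)
  then have "(\<lambda>n. F (X n) + ((of_real k0)\<^sup>2 - (X n)\<^sup>2) * H (X n)) \<longlonglongrightarrow> of_real (norm2 u)"
    by (rule tendsto_eventually)
  ultimately show ?thesis using LIMSEQ_unique by fastforce
qed

end

section \<open>Resonances near quasimodes, uniformly in the edge lengths\<close>

theorem theorem2:
  fixes J K M :: nat and lv iv tv :: "nat \<Rightarrow> nat"
    and \<L> I :: "real set" and R \<gamma> :: real
  assumes "qgraph J K M lv iv tv" and "K \<ge> 1"
    and "compact \<L>" and "\<L> \<subseteq> {0<..}"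
    and "compact I" and "I \<subseteq> {0<..}"
    and "R > 0" and "\<gamma> < 1"
  shows "\<exists>eps0>0. \<forall>l :: nat \<Rightarrow> real.
           (\<forall>m. K \<le> m \<and> m < K + M \<longrightarrow> l m \<in> \<L>) \<longrightarrow>
           (\<forall>u f k0 \<epsilon>.
              opP J K M lv iv tv l u f \<and>
              (\<forall>m<K. AE x in lborel. x > R \<longrightarrow> u m x = 0) \<and>
              k0 \<in> I \<and>
              gnorm2 K M l u = 1 \<and>
              \<epsilon> = sqrt (gnorm2 K M l (\<lambda>m x. f m x - (complex_of_real k0)\<^sup>2 * u m x)) \<and>
              0 < \<epsilon> \<and> \<epsilon> < eps0
              \<longrightarrow> Res J K M lv iv tv l \<inter> ball (complex_of_real k0) (\<epsilon> powr \<gamma>) \<noteq> {})"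
proof -
  \<comment> \<open>A positive exponent makes the radii small. For \<open>\<epsilon> < 1\<close> a
    larger exponent gives a smaller disc, so finding a resonance in that one suffices.\<close>
  define \<gamma>' where "\<gamma>' = max \<gamma> (1 / 2)"
  have \<gamma>': "0 < \<gamma>'" "\<gamma>' < 1" "\<gamma> \<le> \<gamma>'" unfolding \<gamma>'_def using assms by auto
  obtain a where a: "a > 0" "\<And>x. x \<in> I \<Longrightarrow> a \<le> x" using compact_pos_lower_bound assms(5,6) by metis
  obtain b where b: "b \<ge> 0" "\<And>x. x \<in> I \<Longrightarrow> x \<le> b" using compact_upper_bound[OF assms(5)] by metis
  obtain b' where b': "b' \<ge> 0" "\<And>x. x \<in> \<L> \<Longrightarrow> x \<le> b'" using compact_upper_bound[OF assms(3)] by metis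
  define \<Lambda> where "\<Lambda> = max R b'"
  have \<Lambda>: "\<Lambda> \<ge> 0" "R \<le> \<Lambda>" "\<And>x. x \<in> \<L> \<Longrightarrow> x \<le> \<Lambda>" unfolding \<Lambda>_def using b' assms(7) by (auto simp: le_max_iff_disj)
  \<comment> \<open>Points of \<open>I\<close> lie within \<open>b + 1\<close> of
    \<open>\<i>\<close> and the discs have radius at most 1, so the ball of radius
    \<open>\<rho> / 2 = b + 2\<close> about \<open>\<i>\<close> contains them all.\<close>
  define \<rho> where "\<rho> = 2 * (b + 2)"
  have \<rho>: "\<rho> \<ge> 1" unfolding \<rho>_def using b by simp
  define r where "r = 4 * \<rho> + 1"
  have rk: "cmod k \<le> r" if "k \<in> ball \<i> (4 * \<rho>)" for k
    using that norm_triangle_sub[of k \<i>] unfolding r_def by (simp add: dist_norm norm_minus_commute)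
  define n where "n = 2 * (K + M) + J"
  obtain B c where B0: "B > 0" "c > 0" and Bl: "\<forall>l. (\<forall>m. K \<le> m \<and> m < K + M \<longrightarrow> l m \<in> \<L>) \<longrightarrow>
       (\<forall>k\<in>cball \<i> (4 * \<rho>). cmod (fdet n (vmat K (K + M) (edge_source K lv iv) tv k l)) \<le> B \<and>
         (\<forall>i<n. \<forall>j<n. cmod (fcof n (vmat K (K + M) (edge_source K lv iv) tv k l) i j) \<le> B)) \<and>
       c \<le> cmod (fdet n (vmat K (K + M) (edge_source K lv iv) tv \<i> l))"
    using system_uniform_bounds[OF assms(1,3,4), of "4 * \<rho>"] unfolding n_def by metis
  define Bn where "Bn = real (K + M) *
     (2 * (real n * (B * (real (K + M) * (2 * exp (r * \<Lambda>) ^ 2 * ((\<Lambda> + 1) / 2)))) * (exp (r * \<Lambda>) * ((\<Lambda> + 1) / 2))) +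
      B * (2 * exp (r * \<Lambda>) ^ 2 * ((\<Lambda> + 1) / 2) * ((\<Lambda> + 1) / 2)))"
  have Bn: "Bn > 0" unfolding Bn_def using B0(1) \<Lambda>(1) assms(2)
    by (intro mult_pos_pos add_nonneg_pos mult_nonneg_nonneg) auto
  have c2: "2 * c > 0" using B0 by simp
  \<comment> \<open>The factor \<open>- 2 * \<i> * k\<close> in \<open>res_den\<close> has modulus 2
    at \<open>\<i>\<close> and at most \<open>2 * r\<close> on the large ball, hence
    \<open>2 * c\<close> and \<open>2 * r * B\<close>. The value \<open>1 / a\<close> of
    \<open>Q\<close> comes from \<open>Im (z\<^sup>2) \<ge> a * Im z\<close> on the disc.\<close>
  show ?thesis
  proof (rule quasimode_threshold[where C = "2 * r * B" and Q = "1 / a", OF c2 Bn \<rho> \<gamma>'(1,2)], goal_cases)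
    case (1 e0)
    note e0 = 1(1,2) and key = 1(3)
    \<comment> \<open>Below this value the radius is at most \<open>a / 2\<close>; then
      \<open>2 * Re z \<ge> a\<close> on the disc.\<close>
    define e1 where "e1 = (a / 2) powr (1 / \<gamma>')"
    have e1: "e1 > 0" unfolding e1_def using a by simp
    show ?thesis
    proof (intro exI[of _ "min e0 e1"] conjI allI impI)
      show "min e0 e1 > 0" using e0 e1 by simp
      fix l :: "nat \<Rightarrow> real" and u f :: "nat \<Rightarrow> real \<Rightarrow> complex" and k0 \<epsilon> :: real
      assume l': "\<forall>m. K \<le> m \<and> m < K + M \<longrightarrow> l m \<in> \<L>"
      assume A: "opP J K M lv iv tv l u f \<and>
                (\<forall>m<K. AE x in lborel. x > R \<longrightarrow> u m x = 0) \<and>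
                k0 \<in> I \<and>
                gnorm2 K M l u = 1 \<and>
                \<epsilon> = sqrt (gnorm2 K M l (\<lambda>m x. f m x - (complex_of_real k0)\<^sup>2 * u m x)) \<and>
                0 < \<epsilon> \<and> \<epsilon> < min e0 e1"
      have l: "\<And>m. K \<le> m \<Longrightarrow> m < K + M \<Longrightarrow> l m \<in> \<L>" using l' by blast
      have B: "\<And>k. k \<in> cball \<i> (4 * \<rho>) \<Longrightarrow> cmod (fdet n (vmat K (K + M) (edge_source K lv iv) tv k l)) \<le> B"
        "\<And>k i j. k \<in> cball \<i> (4 * \<rho>) \<Longrightarrow> i < n \<Longrightarrow> j < n \<Longrightarrow> cmod (fcof n (vmat K (K + M) (edge_source K lv iv) tv k l) i j) \<le> B"
        "c \<le> cmod (fdet n (vmat K (K + M) (edge_source K lv iv) tv \<i> l))"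
        using Bl l' by blast+
      interpret quantum_graph J K M lv iv tv l
        by standard (use assms(1,4) l in auto)
      have u1: "gnorm2 K M l u = 1" and \<epsilon>0: "0 < \<epsilon>" "\<epsilon> < min e0 e1" and k0I: "k0 \<in> I"
        using A by blast+
      then have \<epsilon>: "0 < \<epsilon>" "\<epsilon> < e0" "\<epsilon> < e1" "\<epsilon> < 1" using e0 by auto
      have k0: "a \<le> k0" "k0 \<le> b" using a b k0I by auto
      have R: "R \<ge> 0" using assms(7) by simp
      define f' where "f' = (\<lambda>m x. if m < K \<and> x > R then 0 else f m x)"
      define f0 where "f0 = (\<lambda>m x. f' m x - (complex_of_real k0)\<^sup>2 * u m x)"
      have op: "opP J K M lv iv tv l u f'" and u: "supported R u"
        unfolding f'_def using opP_cutoff[OF _ R] A by blast+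
      have f': "supported R f'"
        using opP_graph_L2(2)[OF op] unfolding supported_def by (simp add: f'_def)
      have L: "graph_L2 u" "graph_L2 f" "graph_L2 f'"
        using opP_graph_L2 A op by blast+
      have f0: "supported R f0"
        using graph_L2_diff_cmult[OF L(3,1)] u f' unfolding supported_def f0_def by auto
      \<comment> \<open>On the leads beyond \<open>R\<close> both \<open>f'\<close> and
        \<open>u\<close> vanish, so the cutoff can only decrease the residual.\<close>
      have "gnorm2 K M l f0 \<le> gnorm2 K M l (\<lambda>m x. f m x - (complex_of_real k0)\<^sup>2 * u m x)"
      proof (rule gnorm2_mono)
        show "graph_L2 f0" using f0 by (simp add: supported_def)
        show "graph_L2 (\<lambda>m x. f m x - (complex_of_real k0)\<^sup>2 * u m x)" by (rule graph_L2_diff_cmult[OF L(2,1)])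
        show "cmod (f0 m x) \<le> cmod (f m x - (complex_of_real k0)\<^sup>2 * u m x)" for m x
          using u unfolding f0_def f'_def supported_def by auto
      qed
      also have "\<dots> = \<epsilon>\<^sup>2" using A gnorm2_nonneg by simp
      finally have f0\<epsilon>: "gnorm2 K M l f0 \<le> \<epsilon>\<^sup>2" .
      also have "\<epsilon>\<^sup>2 \<le> 1" using \<epsilon> by (simp add: power_le_one)
      finally have f01: "gnorm2 K M l f0 \<le> 1" .
      let ?r = "\<epsilon> powr \<gamma>'" and ?k = "complex_of_real k0"
      let ?S = "ball ?k ?r"
      have r1: "0 < ?r" "?r \<le> 1" using \<epsilon> \<gamma>' by (auto simp: powr_le1)
      have "?r \<le> e1 powr \<gamma>'" using \<epsilon> \<gamma>' by (intro powr_mono2) auto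
      also have "\<dots> = a / 2" unfolding e1_def using a \<gamma>' by (simp add: powr_powr)
      finally have ra: "?r \<le> a / 2" .
      show "Res J K M lv iv tv l \<inter> ball ?k (\<epsilon> powr \<gamma>) \<noteq> {}"
      proof
        assume free: "Res J K M lv iv tv l \<inter> ball ?k (\<epsilon> powr \<gamma>) = {}"
        have "?r \<le> \<epsilon> powr \<gamma>" using \<epsilon> \<gamma>' by (intro powr_mono') auto
        then have free': "Res J K M lv iv tv l \<inter> ?S = {}" using free subset_ball by blast
        obtain F where F: "F holomorphic_on ?S"
          "\<And>z. z \<in> ?S \<Longrightarrow> res_den z \<noteq> 0 \<Longrightarrow> F z * res_den z = res_num R f0 u z"
          "\<And>z w. z \<in> ?S \<Longrightarrow> Im z > 0 \<Longrightarrow> resolves z f0 w \<Longrightarrow> F z = gpair K M l w u"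
          using resolvent_continuation[OF f0 u R free'] by metis
        obtain H where H: "H holomorphic_on ?S"
          "\<And>z w. z \<in> ?S \<Longrightarrow> Im z > 0 \<Longrightarrow> resolves z u w \<Longrightarrow> H z = gpair K M l w u"
          using resolvent_continuation[OF u u R free'] by metis
        have "F ?k = of_real (gnorm2 K M l u)"
          by (rule continuation_at_quasimode[OF u f' op R open_ball _ F(1) F(3)[unfolded f0_def] H]) (use r1 in auto)
        then have Fk: "F ?k = 1" by (simp add: u1)
        have sub: "?S \<subseteq> cball \<i> (\<rho> / 2)"
        proof
          fix z assume "z \<in> ?S"
          then have "dist z ?k < 1" using r1 by (simp add: dist_commute)
          moreover have "dist ?k \<i> \<le> b + 1"
            using norm_triangle_ineq4[of ?k \<i>] k0 a by (simp add: dist_norm)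
          ultimately have "dist z \<i> \<le> b + 2" using dist_triangle[of z \<i> ?k] by linarith
          then show "z \<in> cball \<i> (\<rho> / 2)" unfolding \<rho>_def by (simp add: dist_commute)
        qed
        have "cmod (F ?k) < 1"
        proof (rule key[of \<epsilon> res_den \<i> ?k F "res_num R f0 u"])
          show "res_den holomorphic_on ball \<i> (4 * \<rho>)" by (rule holomorphic_res_den)
          show "cmod (res_den z) \<le> 2 * r * B" if z: "z \<in> ball \<i> (4 * \<rho>)" for z
          proof -
            have "cmod z * cmod (fdet nn (V z l)) \<le> r * B"
              using rk[OF z] B(1)[of z] z unfolding n_def
              by (intro mult_mono) (auto intro: order_trans[OF norm_ge_zero])
            then show ?thesis unfolding res_den_def by (simp add: norm_mult)
          qed
          show "2 * c \<le> cmod (res_den \<i>)"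
            using B(3) unfolding res_den_def n_def by (simp add: norm_mult)
          show "cmod (res_num R f0 u z) \<le> Bn" if z: "z \<in> ?S" for z
          proof -
            have z4: "z \<in> ball \<i> (4 * \<rho>)" using subsetD[OF sub z] \<rho> by auto
            then have zc: "z \<in> cball \<i> (4 * \<rho>)" using ball_subset_cball by blast
            show ?thesis unfolding Bn_def n_def
            proof (rule res_num_bound[OF f0 u R f01 _ _ rk[OF z4] _ \<Lambda>(1)])
              show "eff R m \<le> \<Lambda>" if "m < N" for m using \<Lambda> l that by (auto simp: eff_def)
              show "cmod (fdet nn (V z l)) \<le> B" using B(1)[OF zc] unfolding n_def by simp
              show "cmod (fcof nn (V z l) i j) \<le> B" if "i < nn" "j < nn" for i j
                using B(2)[OF zc] that unfolding n_def by simp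
            qed (use u1 assms(2) in auto)
          qed
          show "cmod (F z) * Im z \<le> 1 / a * \<epsilon>" if z: "z \<in> ?S" "Im z > 0" for z
          proof -
            obtain w where w: "resolves z f0 w" using resolvent_exists[OF z(2) f0 u R] by blast
            have "graph_L2 f0" using f0 by (simp add: supported_def)
            from resolves_bound[OF w this L(1)]
            have "(Im (z\<^sup>2) * cmod (F z))\<^sup>2 \<le> gnorm2 K M l f0"
              unfolding F(3)[OF z w] power_mult_distrib u1 by simp
            also note f0\<epsilon>
            finally have le: "Im (z\<^sup>2) * cmod (F z) \<le> \<epsilon>" by (rule power2_le_imp_le) (use \<epsilon> in simp)
            have "\<bar>Re z - k0\<bar> < a / 2"
              using z(1) ra abs_Re_le_cmod[of "z - ?k"] by (simp add: dist_norm norm_minus_commute)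
            then have "a \<le> 2 * Re z" using k0 by linarith
            then have "a * Im z \<le> Im (z\<^sup>2)" using z(2) by (simp add: power2_eq_square)
            then have "a * Im z * cmod (F z) \<le> Im (z\<^sup>2) * cmod (F z)" by (rule mult_right_mono) simp
            then have "a * Im z * cmod (F z) \<le> \<epsilon>" using le by simp
            then show ?thesis using a by (simp add: field_simps)
          qed
        qed (use \<epsilon> sub F in auto)
        then show False using Fk by simp
      qed
    qed
  qed
qed

end
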